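(* Let $\pi$ be a generalized permutation. (1) If $\pi$ is not dynamically irreducible, or if $\pi$ is dynamically irreducible but $\lambda$ does not belong to the set of admissible parameters, then the linear involution $T=(\pi,\lambda)$ is not minimal. (2) If $\pi$ is dynamically irreducible, then for almost all admissible parameters $\lambda$ the linear involution $T=(\pi,\lambda)$ satisfies the Keane's property, and hence is minimal.
   Context: **Generalized permutations.** Let $\mathcal A$ be an alphabet of $d$ letters. A generalized permutation of type $(l,m)$, $l+m=2d$, is a map $\pi:\{1,\dots,2d\}\to\mathcal A$ such that each letter has exactly two preimages. It is written as a table with top row $\pi(1)\dots\pi(l)$ and bottom row $\pi(l+1)\dots\pi(l+m)$. The fixed-point-free involution $\sigma$ is defined by $\pi^{-1}(\{\pi(i)\})=\{i,\sigma(i)\}$. Standing convention: there exist $i\le l$ and $j>l$ with $\sigma(i)\le l$ and $\sigma(j)>l$. Let $\mathcal A_{01}$, $\mathcal A_0$, $\mathcal A_1$ be the sets of letters occurring respectively once in each row, twice in the top row, twice in the bottom row. **Linear involutions.** A parameter (length vector) for $\pi$ is a positive vector $\lambda=(\lambda_\alpha)_{\alpha\in\mathcal A}$ with $L:=\sum_{i=1}^{l}\lambda_{\pi(i)}=\sum_{i=l+1}^{l+m}\lambda_{\pi(i)}$. "Almost all" refers to Lebesgue measure on the space of such vectors. Let $X=(0,L)$. The linear involution $T=(\pi,\lambda)$ is the map $T=f\circ\tilde T$ of $X\times\{0,1\}$ with $f(x,\varepsilon)=(x,1-\varepsilon)$ and $\tilde T$ defined as follows: cut $X\times\{0\}$,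 from left to right, into open intervals $X_1,\dots,X_l$ and $X\times\{1\}$ into $X_{l+1},\dots,X_{l+m}$, with $|X_i|=\lambda_{\pi(i)}$; $\tilde T$ maps $X_i$ isometrically onto $X_{\sigma(i)}$, with derivative $-1$ if $X_i,X_{\sigma(i)}$ lie in the same component of $X\times\{0,1\}$ and $+1$ otherwise. The division points are the singularities of $T$ (where $T$ is undefined); the singularities of $T^{-1}$ are the points where $T^{-1}$ is undefined, i.e. the images under $f$ of the singularities of $T$. $T$ is minimal if all its orbits are dense in $X\times\{0,1\}$. **Keane's property.** $T$ has a connection (of length $r\ge 0$) if there is $(x,\varepsilon)\in X\times\{0,1\}$ which is a singularity of $T^{-1}$ and such that $T^r(x,\varepsilon)$ is a singularity of $T$. $T$ has the Keane's property if it has no connection. **Admissible parameters.** A decomposition of $\pi$ of the form $\left(\begin{array}{c|c|c}F_1&***&F_2\\\hline F_3&***&F_4\end{array}\right)$ means that a (possibly empty) initial segment of the top row consists exactly of the letters (with multiplicity, in any order) of $F_1$, a (possibly empty) disjoint final segment of the top row consists exactly of the letters of $F_2$, and similarly for the bottom row with $F_3$, $F_4$; the middle parts are arbitrary. A parameter $\lambda$ is admissible for $\pi$ if none of the following holds. (a) $\pi$ decomposes as $\left(\begin{array}{c|c}A&***\\\hline A&***\end{array}\right)$, or $\left(\begin{array}{c|c}***&D\\\hline ***&D\end{array}\right)$, or (with nothing in the middle) $\left(\begin{array}{c|c}A\cup B&D\cup B\\\hline A\cup C&D\cup C\end{array}\right)$, with $A,D\subset\mathcal A_{01}$, $B=\mathcal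 A_0$, $C=\mathcal A_1$, and $A$, respectively $D$, non-empty in the first two cases. (b) Up to switching the top and bottom rows, $\pi$ decomposes as $$\left(\begin{array}{c|ccc|c}A\cup B& &***& &B\cup D\\\hline A\cup C&\alpha_0&***&\alpha_0&C\cup D\end{array}\right)$$ with $\alpha_0$ a letter, $A,D\subset\mathcal A_{01}$, $\emptyset\ne B\subset\mathcal A_0$, $C\subset\mathcal A_1$ (the two occurrences of $\alpha_0$ are in the bottom row, adjacent to the two bottom corners), and $$\sum_{\alpha\in C}\lambda_\alpha\le\sum_{\alpha\in B}\lambda_\alpha\le\lambda_{\alpha_0}+\sum_{\alpha\in C}\lambda_\alpha .$$ $\pi$ is dynamically irreducible if the set of parameters admissible for $\pi$ is non-empty. *)

theory Defs
  imports "HOL-Analysis.Analysis"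
begin

section \<open>Generalized permutations\<close>

text \<open>The alphabet is the finite type \<open>'a\<close>. Positions are numbered from 1; positions
  \<open>1, \<dots>, l\<close> form the top row and \<open>l + 1, \<dots>, l + m\<close> the bottom row. Values of \<open>\<pi>\<close> at
  other positions are irrelevant.\<close>

definition partner :: "nat \<Rightarrow> nat \<Rightarrow> (nat \<Rightarrow> 'a) \<Rightarrow> nat \<Rightarrow> nat" where
  "partner l m \<pi> i = (THE j. {k \<in> {1..l + m}. \<pi> k = \<pi> i} = {i, j})"

definition generalized_permutation :: "nat \<Rightarrow> nat \<Rightarrow> (nat \<Rightarrow> 'a::finite) \<Rightarrow> bool" where
  "generalized_permutation l m \<pi> \<longleftrightarrow>
     l + m = 2 * CARD('a) \<and>
     (\<forall>a. card {i \<in> {1..l + m}. \<pi> i = a} = 2) \<and>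
     (\<exists>i\<in>{1..l}. partner l m \<pi> i \<le> l) \<and>
     (\<exists>j\<in>{l + 1..l + m}. partner l m \<pi> j > l)"

definition top_row :: "nat \<Rightarrow> (nat \<Rightarrow> 'a) \<Rightarrow> 'a list" where
  "top_row l \<pi> = map \<pi> [1..<l + 1]"

definition bottom_row :: "nat \<Rightarrow> nat \<Rightarrow> (nat \<Rightarrow> 'a) \<Rightarrow> 'a list" where
  "bottom_row l m \<pi> = map \<pi> [l + 1..<l + m + 1]"

section \<open>Length vectors\<close>

definition balanced_vectors :: "nat \<Rightarrow> nat \<Rightarrow> (nat \<Rightarrow> 'a::finite) \<Rightarrow> (real ^ 'a) set" where
  "balanced_vectors l m \<pi> = {len. (\<Sum>i=1..l. len $ \<pi> i) = (\<Sum>i=l + 1..l + m. len $ \<pi> i)}"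

definition length_vectors :: "nat \<Rightarrow> nat \<Rightarrow> (nat \<Rightarrow> 'a::finite) \<Rightarrow> (real ^ 'a) set" where
  "length_vectors l m \<pi> = {len \<in> balanced_vectors l m \<pi>. \<forall>a. 0 < len $ a}"

text \<open>Lebesgue measure on a linear subspace \<open>S\<close>, carried by the ambient Borel sets: the
  construction of \<^const>\<open>lborel\<close> with \<^const>\<open>Basis\<close> replaced by an orthonormal basis of
  \<open>S\<close>. The result does not depend on the basis. It is needed because the length vectors lie in
  the proper subspace \<^const>\<open>balanced_vectors\<close>, which is null for \<^const>\<open>lborel\<close>.\<close>

definition subspace_lborel :: "'v::euclidean_space set \<Rightarrow> 'v measure" where
  "subspace_lborel S =
     (let B = (SOME B. pairwise orthogonal B \<and> (\<forall>b\<in>B. norm b = 1) \<and>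
                       independent B \<and> span B = S)
      in distr (\<Pi>\<^sub>M b\<in>B. (lborel :: real measure)) borel (\<lambda>f. \<Sum>b\<in>B. f b *\<^sub>R b))"

section \<open>Linear involutions\<close>

definition total_length :: "nat \<Rightarrow> (nat \<Rightarrow> 'a::finite) \<Rightarrow> real ^ 'a \<Rightarrow> real" where
  "total_length l \<pi> len = (\<Sum>i=1..l. len $ \<pi> i)"

definition phase_space :: "nat \<Rightarrow> (nat \<Rightarrow> 'a::finite) \<Rightarrow> real ^ 'a \<Rightarrow> (real \<times> nat) set" where
  "phase_space l \<pi> len = {0<..<total_length l \<pi> len} \<times> {0, 1}"

definition component :: "nat \<Rightarrow> nat \<Rightarrow> nat" where
  "component l i = (if i \<le> l then 0 else 1)"

definition left_end :: "nat \<Rightarrow> (nat \<Rightarrow> 'a::finite) \<Rightarrow> real ^ 'a \<Rightarrow> nat \<Rightarrow> real" where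
  "left_end l \<pi> len i = (\<Sum>k | k \<in> {1..<i} \<and> component l k = component l i. len $ \<pi> k)"

definition piece :: "nat \<Rightarrow> (nat \<Rightarrow> 'a::finite) \<Rightarrow> real ^ 'a \<Rightarrow> nat \<Rightarrow> (real \<times> nat) set" where
  "piece l \<pi> len i =
     {left_end l \<pi> len i<..<left_end l \<pi> len i + len $ \<pi> i} \<times> {component l i}"

definition swap_component :: "real \<times> nat \<Rightarrow> real \<times> nat" where
  "swap_component p = (fst p, 1 - snd p)"

text \<open>Partially defined maps are modelled with \<^type>\<open>option\<close>.\<close>

definition tilde_involution ::
    "nat \<Rightarrow> nat \<Rightarrow> (nat \<Rightarrow> 'a::finite) \<Rightarrow> real ^ 'a \<Rightarrow> real \<times> nat \<Rightarrow> (real \<times> nat) option" where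
  "tilde_involution l m \<pi> len p =
     (if \<exists>i\<in>{1..l + m}. p \<in> piece l \<pi> len i then
        let i = (THE i. i \<in> {1..l + m} \<and> p \<in> piece l \<pi> len i);
            j = partner l m \<pi> i;
            t = fst p - left_end l \<pi> len i
        in Some (if component l i = component l j
                 then left_end l \<pi> len j + len $ \<pi> j - t
                 else left_end l \<pi> len j + t,
                 component l j)
      else None)"

definition linear_involution ::
    "nat \<Rightarrow> nat \<Rightarrow> (nat \<Rightarrow> 'a::finite) \<Rightarrow> real ^ 'a \<Rightarrow> real \<times> nat \<Rightarrow> (real \<times> nat) option" where
  "linear_involution l m \<pi> len p = map_option swap_component (tilde_involution l m \<pi> len p)"

definition partial_iterate :: "('b \<Rightarrow> 'b option) \<Rightarrow> nat \<Rightarrow> 'b \<Rightarrow> 'b option" where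
  "partial_iterate T r p = ((\<lambda>q. Option.bind q T) ^^ r) (Some p)"

text \<open>The pieces are open, so \<open>T\<close> is undefined exactly at the division points.\<close>

definition singularities ::
    "nat \<Rightarrow> nat \<Rightarrow> (nat \<Rightarrow> 'a::finite) \<Rightarrow> real ^ 'a \<Rightarrow> (real \<times> nat) set" where
  "singularities l m \<pi> len =
     {p \<in> phase_space l \<pi> len. linear_involution l m \<pi> len p = None}"

text \<open>Since the inverse of \<open>T = f \<circ> T'\<close> (with \<open>T'\<close> and \<open>f\<close> involutions) is \<open>f \<circ> T \<circ> f\<close>, it is
  undefined exactly on the image under \<open>f\<close> of the singularities of \<open>T\<close>.\<close>

definition inverse_singularities ::
    "nat \<Rightarrow> nat \<Rightarrow> (nat \<Rightarrow> 'a::finite) \<Rightarrow> real ^ 'a \<Rightarrow> (real \<times> nat) set" where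
  "inverse_singularities l m \<pi> len = swap_component ` singularities l m \<pi> len"

definition has_connection ::
    "nat \<Rightarrow> nat \<Rightarrow> (nat \<Rightarrow> 'a::finite) \<Rightarrow> real ^ 'a \<Rightarrow> nat \<Rightarrow> bool" where
  "has_connection l m \<pi> len r \<longleftrightarrow>
     (\<exists>p \<in> inverse_singularities l m \<pi> len. \<exists>q \<in> singularities l m \<pi> len.
        partial_iterate (linear_involution l m \<pi> len) r p = Some q)"

definition keane_property :: "nat \<Rightarrow> nat \<Rightarrow> (nat \<Rightarrow> 'a::finite) \<Rightarrow> real ^ 'a \<Rightarrow> bool" where
  "keane_property l m \<pi> len \<longleftrightarrow> (\<nexists>r. has_connection l m \<pi> len r)"

text \<open>Orbits are two-sided and consist of all iterates, of positive or negative order, that are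
  defined. (The forward orbit of a singularity is always finite.)\<close>

definition two_sided_orbit ::
    "nat \<Rightarrow> nat \<Rightarrow> (nat \<Rightarrow> 'a::finite) \<Rightarrow> real ^ 'a \<Rightarrow> real \<times> nat \<Rightarrow> (real \<times> nat) set" where
  "two_sided_orbit l m \<pi> len p =
     {q \<in> phase_space l \<pi> len. \<exists>n. partial_iterate (linear_involution l m \<pi> len) n p = Some q \<or>
                                partial_iterate (linear_involution l m \<pi> len) n q = Some p}"

definition minimal_involution :: "nat \<Rightarrow> nat \<Rightarrow> (nat \<Rightarrow> 'a::finite) \<Rightarrow> real ^ 'a \<Rightarrow> bool" where
  "minimal_involution l m \<pi> len \<longleftrightarrow>
     (\<forall>p \<in> phase_space l \<pi> len. phase_space l \<pi> len \<subseteq> closure (two_sided_orbit l m \<pi> len p))"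

section \<open>Admissible parameters\<close>

text \<open>The notions below are stated for a pair of rows, so that switching the rows is exchanging
  the two arguments. In \<open>corners xs F v G\<close> the row \<open>xs\<close> has the letters of \<open>F\<close> in its left
  corner and those of \<open>G\<close> in its right corner, each exactly once and in any order, and \<open>v\<close> in
  between.\<close>

definition once_in_each :: "'a list \<Rightarrow> 'a list \<Rightarrow> 'a set" where
  "once_in_each xs ys = {a. count_list xs a = 1 \<and> count_list ys a = 1}"

definition twice_in :: "'a list \<Rightarrow> 'a set" where
  "twice_in xs = {a. count_list xs a = 2}"

definition corners :: "'a list \<Rightarrow> 'a::finite set \<Rightarrow> 'a list \<Rightarrow> 'a set \<Rightarrow> bool" where
  "corners xs F v G \<longleftrightarrow>
     (\<exists>u w. xs = u @ v @ w \<and> mset u = mset_set F \<and> mset w = mset_set G)"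

definition reducible_a :: "'a::finite list \<Rightarrow> 'a list \<Rightarrow> bool" where
  "reducible_a xs ys \<longleftrightarrow>
     (\<exists>A v v'. A \<subseteq> once_in_each xs ys \<and> A \<noteq> {} \<and>
        corners xs A v {} \<and> corners ys A v' {}) \<or>
     (\<exists>D v v'. D \<subseteq> once_in_each xs ys \<and> D \<noteq> {} \<and>
        corners xs {} v D \<and> corners ys {} v' D) \<or>
     (\<exists>A D. A \<subseteq> once_in_each xs ys \<and> D \<subseteq> once_in_each xs ys \<and>
        corners xs (A \<union> twice_in xs) [] (D \<union> twice_in xs) \<and>
        corners ys (A \<union> twice_in ys) [] (D \<union> twice_in ys))"

definition reducible_b :: "real ^ 'a::finite \<Rightarrow> 'a list \<Rightarrow> 'a list \<Rightarrow> bool" where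
  "reducible_b len xs ys \<longleftrightarrow>
     (\<exists>\<alpha>\<^sub>0 A B C D v v'.
        A \<subseteq> once_in_each xs ys \<and> D \<subseteq> once_in_each xs ys \<and>
        B \<noteq> {} \<and> B \<subseteq> twice_in xs \<and> C \<subseteq> twice_in ys \<and>
        corners xs (A \<union> B) v (B \<union> D) \<and>
        corners ys (A \<union> C) ([\<alpha>\<^sub>0] @ v' @ [\<alpha>\<^sub>0]) (C \<union> D) \<and>
        (\<Sum>a\<in>C. len $ a) \<le> (\<Sum>a\<in>B. len $ a) \<and>
        (\<Sum>a\<in>B. len $ a) \<le> len $ \<alpha>\<^sub>0 + (\<Sum>a\<in>C. len $ a))"

definition admissible_parameters :: "nat \<Rightarrow> nat \<Rightarrow> (nat \<Rightarrow> 'a::finite) \<Rightarrow> (real ^ 'a) set" where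
  "admissible_parameters l m \<pi> =
     {len \<in> length_vectors l m \<pi>.
        \<not> reducible_a (top_row l \<pi>) (bottom_row l m \<pi>) \<and>
        \<not> reducible_b len (top_row l \<pi>) (bottom_row l m \<pi>) \<and>
        \<not> reducible_b len (bottom_row l m \<pi>) (top_row l \<pi>)}"

definition dynamically_irreducible :: "nat \<Rightarrow> nat \<Rightarrow> (nat \<Rightarrow> 'a::finite) \<Rightarrow> bool" where
  "dynamically_irreducible l m \<pi> \<longleftrightarrow> admissible_parameters l m \<pi> \<noteq> {}"

end

(* Part (1): for each of the two types of reducibility an explicit proper union of intervals is
   invariant under the involution in both time directions.

   Part (2): assume the lengths satisfy no integer relation beyond those valid on the whole space of
   balanced vectors, and let z_0, ..., z_r be the points of a connection. Telescoping the
   displacements along it expresses a vanishing integer combination of the lengths, so its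
   coefficients are known. They say: a letter occurring once in each row has equally many z_k to
   the right of both its occurrences, and for a letter occurring twice in one row the number of z_k
   to the right of its two occurrences plus the number of crossings of its band is a constant K.
   Hence the connection never crosses a band of the first kind (it would return to the same z_k)
   and every crossing of the second kind sends the point of rank p from the right to that of rank
   K - 1 - p; two successive crossings would again return to the same point, so r is at most 1.
   The case r = 0 with K = 0, 1, 2 gives the three decompositions of type (a), and r = 1 gives a
   decomposition of type (b).

   The Keane property implies minimality: an endpoint of a component of an invariant open set has
   orbit points that are again endpoints of gaps of a fixed minimal size, so its orbit is finite and
   thus periodic or part of a connection. Applied to the set of fixed points of an iterate this
   excludes periodic points; applied to the complement of an orbit closure it gives density. *)
theory Submission
  imports Defs
begin

section \<open>Almost every vector of a subspace is generic\<close>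

text \<open>The balance of the two rows is itself an integer relation, so genericity is taken
  relative to the space of balanced vectors, and a relation can only be tested on balanced vectors:
  the unit vector of a letter occurring once in each row, or the sum of the unit vectors of a letter
  doubled above and a letter doubled below. The second kind exists by the standing convention and
  merely compares two letters, which is why one undetermined constant K remains. A connection is
  recorded by first coordinates alone, each point being regarded in both rows: it arrives through
  one row and departs from the other. At the two ends the missing arrival or departure is replaced
  by a division point. Hence the set of the z_k is preserved by every band, and ranks can be
  compared across a band. The z_k are distinct in every connection, so no shortest one has to be
  chosen: an equality would be a return to the same point, impossible for an orbit issued from a
  singularity of the inverse, or to the opposite point, impossible because no point is fixed before
  the exchange of rows.\<close>

lemma AE_subspace_lborel_inner_nonzero:
  fixes v w :: "'v::euclidean_space"
  assumes S: "subspace S" and w: "w \<in> S" "w \<bullet> v \<noteq> 0"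
  shows "AE x in subspace_lborel S. x \<bullet> v \<noteq> 0"
proof -
  define B where "B = (SOME B. pairwise orthogonal B \<and> (\<forall>b\<in>B. norm b = 1) \<and> independent B \<and> span B = S)"
  have "\<exists>B. pairwise orthogonal B \<and> (\<forall>b\<in>B. norm b = 1) \<and> independent B \<and> span B = S"
    using orthonormal_basis_subspace[OF S] by metis
  then have B: "pairwise orthogonal B \<and> (\<forall>b\<in>B. norm b = 1) \<and> independent B \<and> span B = S"
    unfolding B_def by (rule someI_ex)
  then have fin: "finite B" using independent_imp_finite by blast
  \<comment> \<open>Without such a basis vector \<open>v\<close> would be orthogonal to the span of
    \<open>B\<close>, hence to \<open>w\<close>.\<close>
  obtain b0 where b0: "b0 \<in> B" "b0 \<bullet> v \<noteq> 0"
  proof (rule ccontr)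
    assume "\<not> thesis"
    then have "\<And>b. b \<in> B \<Longrightarrow> orthogonal v b" using that by (auto simp: orthogonal_def inner_commute)
    then have "orthogonal v w" using orthogonal_to_span[of w B v] B w by auto
    then show False using w by (simp add: orthogonal_def inner_commute)
  qed
  define B' where "B' = B - {b0}"
  have B': "B = insert b0 B'" "finite B'" "b0 \<notin> B'" using b0 fin by (auto simp: B'_def)
  let ?M = "\<lambda>b :: 'v. lborel :: real measure"
  interpret product_sigma_finite ?M by standard
  let ?P = "\<lambda>I. \<Pi>\<^sub>M b\<in>I. (lborel :: real measure)"
  have meas: "(\<lambda>f. \<Sum>b\<in>B. f b *\<^sub>R b) \<in> borel_measurable (?P B)" by measurable
  define N where "N = {f \<in> space (?P B). (\<Sum>b\<in>B. f b *\<^sub>R b) \<bullet> v = 0}"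
  have N[measurable]: "N \<in> sets (?P B)" unfolding N_def by measurable
  have "emeasure (?P B) N = (\<integral>\<^sup>+ f. indicator N f \<partial>?P (insert b0 B'))"
    unfolding B'(1)[symmetric] by simp
  also have "\<dots> = (\<integral>\<^sup>+ f. (\<integral>\<^sup>+ y. indicator N (f(b0 := y)) \<partial>lborel) \<partial>?P B')"
    by (rule product_nn_integral_insert) (use B' N in auto)
  also have "\<dots> = (\<integral>\<^sup>+ f. 0 \<partial>?P B')"
  proof (rule nn_integral_cong)
    fix f assume f: "f \<in> space (?P B')"
    \<comment> \<open>With the other coordinates frozen, the scalar product is affine in the
      coordinate along \<open>b0\<close>, with slope \<open>b0 \<bullet> v\<close>. Its only zero is
      \<open>y0\<close>, so the slices of \<open>N\<close> are null.\<close>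
    define y0 where "y0 = - (\<Sum>b\<in>B'. f b * (b \<bullet> v)) / (b0 \<bullet> v)"
    have "(\<Sum>b\<in>B. (f(b0 := y)) b *\<^sub>R b) \<bullet> v = y * (b0 \<bullet> v) + (\<Sum>b\<in>B'. f b * (b \<bullet> v))" for y
    proof -
      have "(\<Sum>b\<in>B'. (f(b0 := y)) b *\<^sub>R b) = (\<Sum>b\<in>B'. f b *\<^sub>R b)"
        by (rule sum.cong) (use B'(3) in auto)
      then show ?thesis unfolding B'(1) using B'
        by (simp add: inner_add_left inner_sum_left)
    qed
    then have "f(b0 := y) \<in> N \<Longrightarrow> y = y0" for y
      using b0 by (auto simp: N_def y0_def field_simps)
    then have "(\<integral>\<^sup>+ y. indicator N (f(b0 := y)) \<partial>lborel) \<le> (\<integral>\<^sup>+ y. indicator {y0} y \<partial>lborel)"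
      by (intro nn_integral_mono) (auto simp: indicator_def)
    then show "(\<integral>\<^sup>+ y. indicator N (f(b0 := y)) \<partial>lborel) = 0" by simp
  qed
  finally have "N \<in> null_sets (?P B)" using N by (auto simp: null_sets_def)
  then have "AE f in ?P B. f \<notin> N" by (rule AE_not_in)
  then have "AE f in ?P B. (\<Sum>b\<in>B. f b *\<^sub>R b) \<bullet> v \<noteq> 0"
    by (rule AE_mp) (auto simp: N_def intro!: AE_I2)
  then show ?thesis
    unfolding subspace_lborel_def Let_def B_def[symmetric]
    by (subst AE_distr_iff[OF meas]) auto
qed

lemma subspace_balanced_vectors: "subspace (balanced_vectors l m \<pi>)"
  by (auto simp: subspace_def balanced_vectors_def sum.distrib sum_distrib_left[symmetric])

text \<open>Rational independence modulo the relations valid on all of \<open>S\<close>. Integer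
  coefficients keep the family of conditions countable.\<close>

definition generic_in :: "(real ^ 'a::finite) set \<Rightarrow> real ^ 'a \<Rightarrow> bool" where
  "generic_in S x \<longleftrightarrow>
     (\<forall>n :: 'a \<Rightarrow> int. (\<Sum>a\<in>UNIV. of_int (n a) * x $ a) = 0 \<longrightarrow>
        (\<forall>y\<in>S. (\<Sum>a\<in>UNIV. of_int (n a) * y $ a) = 0))"

lemma AE_generic_in:
  fixes S :: "(real ^ 'a::finite) set"
  assumes "subspace S" shows "AE x in subspace_lborel S. generic_in S x"
  unfolding generic_in_def
proof (subst AE_all_countable, rule allI)
  fix n :: "'a \<Rightarrow> int"
  define v :: "real ^ 'a" where "v = (\<chi> a. of_int (n a))"
  have v: "(\<Sum>a\<in>UNIV. of_int (n a) * y $ a) = y \<bullet> v" for y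
    by (simp add: v_def inner_vec_def mult.commute)
  show "AE x in subspace_lborel S. (\<Sum>a\<in>UNIV. of_int (n a) * x $ a) = 0 \<longrightarrow>
          (\<forall>y\<in>S. (\<Sum>a\<in>UNIV. of_int (n a) * y $ a) = 0)"
  proof (cases "\<forall>y\<in>S. y \<bullet> v = 0")
    case True
    then show ?thesis by (simp add: v)
  next
    case False
    then obtain w where "w \<in> S" "w \<bullet> v \<noteq> 0" by blast
    from AE_subspace_lborel_inner_nonzero[OF assms this] show ?thesis
      by (rule AE_mp) (auto simp: v)
  qed
qed

text \<open>Turns the multisets in \<open>corners\<close> into bijections from intervals of
  positions, the form in which sums of lengths are reindexed by letters.\<close>

lemma mset_map_upt_eq_mset_set:
  assumes "finite F"
  shows "mset (map g [lo..<hi]) = mset_set F \<longleftrightarrow> bij_betw g {lo..<hi} F"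
proof
  assume m: "mset (map g [lo..<hi]) = mset_set F"
  have "set (map g [lo..<hi]) = F" using arg_cong[OF m, of set_mset] assms by simp
  moreover have "distinct (map g [lo..<hi])"
    unfolding distinct_count_atmost_1 using m assms calculation by (auto simp: count_mset_set)
  ultimately show "bij_betw g {lo..<hi} F" by (simp add: bij_betw_def distinct_map)
next
  assume "bij_betw g {lo..<hi} F"
  then have "distinct (map g [lo..<hi])" "set (map g [lo..<hi]) = F"
    by (auto simp: bij_betw_def distinct_map)
  then show "mset (map g [lo..<hi]) = mset_set F" by (metis mset_set_set)
qed

lemma bij_betw_filter:
  assumes "bij_betw h A B" "\<And>x. x \<in> A \<Longrightarrow> P x \<longleftrightarrow> Q (h x)"
  shows "bij_betw h {x \<in> A. P x} {y \<in> B. Q y}"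
  using assms unfolding bij_betw_def inj_on_def by auto

section \<open>Linear involutions as partial maps\<close>

lemma partial_iterate_0 [simp]: "partial_iterate T 0 p = Some p"
  by (simp add: partial_iterate_def)

lemma partial_iterate_Suc: "partial_iterate T (Suc n) p = Option.bind (partial_iterate T n p) T"
  by (simp add: partial_iterate_def)

lemma partial_iterate_add:
  "partial_iterate T (n + k) p = Option.bind (partial_iterate T n p) (partial_iterate T k)"
proof (induction k)
  case 0
  show ?case by simp
next
  case (Suc k)
  then show ?case by (cases "partial_iterate T n p") (auto simp: partial_iterate_Suc)
qed

lemma partial_iterate_1 [simp]: "partial_iterate T (Suc 0) p = T p"
  by (simp add: partial_iterate_Suc)

lemma swap_component_swap [simp]:
  "snd p \<le> 1 \<Longrightarrow> swap_component (swap_component p) = p"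
  by (cases p) (auto simp: swap_component_def)

locale parametrized_permutation =
  fixes l m :: nat and \<pi> :: "nat \<Rightarrow> 'a::finite" and len :: "real ^ 'a"
  assumes gp: "generalized_permutation l m \<pi>"
    and len: "len \<in> length_vectors l m \<pi>"
begin

abbreviation "\<sigma> \<equiv> partner l m \<pi>"
abbreviation "X \<equiv> phase_space l \<pi> len"
abbreviation "L \<equiv> total_length l \<pi> len"
abbreviation "T \<equiv> linear_involution l m \<pi> len"
abbreviation "iter \<equiv> partial_iterate T"
abbreviation "Sing \<equiv> singularities l m \<pi> len"
abbreviation "f \<equiv> swap_component"

section \<open>Rows, partners and division points\<close>

definition row :: "nat \<Rightarrow> nat set" where
  "row c = (if c = 0 then {1..<l + 1} else {l + 1..<l + m + 1})"
definition start :: "nat \<Rightarrow> nat" where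
  "start c = (if c = 0 then 1 else l + 1)"
definition stop :: "nat \<Rightarrow> nat" where
  "stop c = (if c = 0 then l + 1 else l + m + 1)"
text \<open>Agrees with \<open>left_end\<close> on the positions of row \<open>c\<close>, but is
  also meaningful at \<open>stop c\<close>, where it gives the right end of the row.\<close>

definition pos :: "nat \<Rightarrow> nat \<Rightarrow> real" where
  "pos c i = (\<Sum>k\<in>{start c..<i}. len $ \<pi> k)"

lemma row_eq: "row c = {start c..<stop c}"
  by (auto simp: row_def start_def stop_def)

lemma finite_row [simp]: "finite (row c)"
  by (simp add: row_eq)

lemma positions_eq: "{1..l + m} = row 0 \<union> row 1"
  by (auto simp: row_def)

lemma rows_disjoint: "row 0 \<inter> row 1 = {}"
  by (auto simp: row_def)

lemma row_component: "c \<le> 1 \<Longrightarrow> i \<in> row c \<longleftrightarrow> i \<in> {1..l + m} \<and> component l i = c"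
  by (cases "c = 0") (auto simp: row_def component_def)

lemma component_le_1: "component l i \<le> 1"
  by (simp add: component_def)

lemma component_le_Suc_0 [simp]: "component l i \<le> Suc 0"
  by (simp add: component_def)

lemma in_row_component: "i \<in> {1..l + m} \<Longrightarrow> i \<in> row (component l i)"
  using row_component[of "component l i" i] component_le_1[of i] by blast

lemma len_pos: "0 < len $ a"
  using len by (simp add: length_vectors_def)

lemma fibre:
  assumes "i \<in> {1..l + m}"
  shows "{k \<in> {1..l + m}. \<pi> k = \<pi> i} = {i, \<sigma> i} \<and> \<sigma> i \<noteq> i"
proof -
  let ?F = "{k \<in> {1..l + m}. \<pi> k = \<pi> i}"
  have "card ?F = 2" using gp unfolding generalized_permutation_def by blast
  moreover have "i \<in> ?F" using assms by simp
  ultimately obtain j where j: "?F = {i, j}" "j \<noteq> i"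
    by (metis (no_types, lifting) card_2_iff doubleton_eq_iff insertE singletonD)
  have "\<sigma> i = j" unfolding partner_def
    by (rule the_equality) (use j in auto)
  with j show ?thesis by simp
qed

lemma partner_in: "i \<in> {1..l + m} \<Longrightarrow> \<sigma> i \<in> {1..l + m}"
  using fibre[of i] by blast

lemma partner_neq: "i \<in> {1..l + m} \<Longrightarrow> \<sigma> i \<noteq> i"
  using fibre[of i] by blast

lemma label_partner: "i \<in> {1..l + m} \<Longrightarrow> \<pi> (\<sigma> i) = \<pi> i"
  using fibre[of i] by blast

lemma same_label: "\<lbrakk>i \<in> {1..l + m}; k \<in> {1..l + m}; \<pi> k = \<pi> i; k \<noteq> i\<rbrakk> \<Longrightarrow> k = \<sigma> i"
  using fibre[of i] by blast

lemma partner_partner: "i \<in> {1..l + m} \<Longrightarrow> \<sigma> (\<sigma> i) = i"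
  using same_label[of "\<sigma> i" i] partner_in[of i] partner_neq[of i] label_partner[of i] by simp

lemma start_lt_stop: "start c < stop c"
  using gp by (auto simp: generalized_permutation_def start_def stop_def)

text \<open>By the standing convention each row contains both occurrences of some letter, hence has
  an interior division point. The exclusion of periodic points relies on it.\<close>

lemma start_Suc_lt_stop: "Suc (start c) < stop c"
proof -
  obtain i where i: "i \<in> {1..l}" "\<sigma> i \<le> l" using gp by (auto simp: generalized_permutation_def)
  obtain j where j: "j \<in> {l + 1..l + m}" "\<sigma> j > l" using gp by (auto simp: generalized_permutation_def)
  have "\<sigma> i \<in> {1..l + m}" "\<sigma> i \<noteq> i" using partner_in[of i] partner_neq[of i] i by auto
  moreover have "\<sigma> j \<in> {1..l + m}" "\<sigma> j \<noteq> j" using partner_in[of j] partner_neq[of j] j by auto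
  ultimately show ?thesis using i j by (auto simp: start_def stop_def)
qed

lemma twice_in_row:
  assumes "c \<le> 1" obtains i where "i \<in> row c" "\<sigma> i \<in> row c"
proof -
  obtain i where i: "i \<in> {1..l}" "\<sigma> i \<le> l" using gp by (auto simp: generalized_permutation_def)
  obtain j where j: "j \<in> {l + 1..l + m}" "\<sigma> j > l" using gp by (auto simp: generalized_permutation_def)
  show thesis
  proof (cases "c = 0")
    case True
    then show thesis using i partner_in[of i] that[of i] by (auto simp: row_def)
  next
    case False
    then show thesis using j partner_in[of j] that[of j] by (auto simp: row_def)
  qed
qed

lemma pos_start [simp]: "pos c (start c) = 0"
  by (simp add: pos_def)

lemma pos_Suc: "start c \<le> i \<Longrightarrow> pos c (Suc i) = pos c i + len $ \<pi> i"
  by (simp add: pos_def)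

lemma pos_stop: "pos c (stop c) = L"
proof (cases "c = 0")
  case True
  then show ?thesis
    by (simp add: pos_def start_def stop_def total_length_def atLeastLessThanSuc_atLeastAtMost)
next
  case False
  then have "pos c (stop c) = (\<Sum>i=l + 1..l + m. len $ \<pi> i)"
    by (simp add: pos_def start_def stop_def atLeastLessThanSuc_atLeastAtMost)
  also have "\<dots> = L"
    using len by (simp add: length_vectors_def balanced_vectors_def total_length_def)
  finally show ?thesis .
qed

lemma pos_less: "start c \<le> i \<Longrightarrow> i < j \<Longrightarrow> pos c i < pos c j"
proof (induction j)
  case (Suc j)
  then show ?case using len_pos[of "\<pi> j"] by (cases "i = j") (auto simp: pos_Suc)
qed simp

lemma pos_mono: "start c \<le> i \<Longrightarrow> i \<le> j \<Longrightarrow> pos c i \<le> pos c j"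
  using pos_less[of c i j] by (cases "i = j") auto

lemma pos_less_iff: "start c \<le> i \<Longrightarrow> start c \<le> j \<Longrightarrow> pos c i < pos c j \<longleftrightarrow> i < j"
  using pos_less[of c i j] pos_mono[of c j i] by (meson leD leI)

lemma left_end_pos: "c \<le> 1 \<Longrightarrow> i \<in> row c \<Longrightarrow> left_end l \<pi> len i = pos c i"
  unfolding left_end_def pos_def
  by (rule sum.cong) (auto simp: row_def start_def component_def split: if_splits)

lemma piece_eq: "c \<le> 1 \<Longrightarrow> i \<in> row c \<Longrightarrow> piece l \<pi> len i = {pos c i<..<pos c (Suc i)} \<times> {c}"
  using row_component[of c i] by (simp add: piece_def left_end_pos pos_Suc row_eq)

section \<open>Pieces and the action of the involution\<close>

lemma phase_iff: "(x, c) \<in> X \<longleftrightarrow> 0 < x \<and> x < L \<and> c \<le> 1"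
  by (auto simp: phase_space_def)

lemma pos_locate:
  assumes "0 \<le> x" "x < L"
  obtains i where "i \<in> row c" "pos c i \<le> x" "x < pos c (Suc i)"
proof -
  have "\<exists>i. start c \<le> i \<and> x < pos c (Suc i) \<and> pos c i \<le> x"
  proof -
    define N where "N = (LEAST n. x < pos c n)"
    have ex: "x < pos c (stop c)" using assms by (simp add: pos_stop)
    have N: "x < pos c N" unfolding N_def by (rule LeastI) (rule ex)
    have "start c < N"
    proof (rule ccontr)
      assume "\<not> start c < N"
      then have "pos c N = 0" by (simp add: pos_def)
      with N assms show False by simp
    qed
    then obtain i where i: "N = Suc i" "start c \<le> i" by (metis less_eq_Suc_le Suc_le_D Suc_le_mono)
    have "\<not> x < pos c i" using i not_less_Least[of i "\<lambda>n. x < pos c n"] by (auto simp: N_def)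
    with N i show ?thesis by auto
  qed
  then obtain i where i: "start c \<le> i" "x < pos c (Suc i)" "pos c i \<le> x" by blast
  have "i < stop c"
  proof (rule ccontr)
    assume "\<not> i < stop c"
    then have "pos c (stop c) \<le> pos c i" using start_lt_stop[of c] by (intro pos_mono) auto
    with i assms show False by (simp add: pos_stop)
  qed
  with i show thesis by (intro that[of i]) (auto simp: row_eq)
qed

lemma pos_locate_unique:
  assumes "i \<in> row c" "pos c i \<le> x" "x < pos c (Suc i)"
    and "j \<in> row c" "pos c j \<le> x" "x < pos c (Suc j)"
  shows "i = j"
  using assms pos_mono[of c "Suc i" j] pos_mono[of c "Suc j" i]
  by (cases i j rule: linorder_cases) (auto simp: row_eq)

lemma pos_row_bounds: "i \<in> row c \<Longrightarrow> 0 \<le> pos c i \<and> pos c i < pos c (Suc i) \<and> pos c (Suc i) \<le> L"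
  using pos_mono[of c "start c" i] pos_mono[of c "Suc i" "stop c"] pos_stop[of c] pos_less[of c i "Suc i"]
  by (auto simp: row_eq)

text \<open>First coordinate of the image of a point of piece \<open>i\<close> in row
  \<open>c\<close>, before rows are exchanged: \<open>c'\<close> is the row of the partner, and
  \<open>T\<close> lands in row \<open>1 - c'\<close>.\<close>

definition image_point :: "nat \<Rightarrow> nat \<Rightarrow> nat \<Rightarrow> real \<Rightarrow> real" where
  "image_point c c' i x =
     (if c = c' then pos c' (\<sigma> i) + pos c (Suc i) - x else pos c' (\<sigma> i) - pos c i + x)"

lemma T_piece:
  assumes "c \<le> 1" "c' \<le> 1" "i \<in> row c" "\<sigma> i \<in> row c'" "pos c i < x" "x < pos c (Suc i)"
  shows "T (x, c) = Some (image_point c c' i x, 1 - c')"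
proof -
  have i: "i \<in> {1..l + m}" "component l i = c" using assms row_component by auto
  have j: "component l (\<sigma> i) = c'" using assms row_component by auto
  have mem: "(x, c) \<in> piece l \<pi> len i" using assms by (simp add: piece_eq)
  have uni: "k = i" if "k \<in> {1..l + m}" "(x, c) \<in> piece l \<pi> len k" for k
  proof -
    have "component l k = c" using that by (auto simp: piece_def)
    then have "k \<in> row c" using that assms row_component by auto
    then show ?thesis
      using that assms pos_locate_unique[of k c x i] by (auto simp: piece_eq)
  qed
  have the_i: "(THE i. i \<in> {1..l + m} \<and> (x, c) \<in> piece l \<pi> len i) = i"
    by (rule the_equality) (use mem i(1) uni in blast)+
  have "len $ \<pi> (\<sigma> i) = len $ \<pi> i" using label_partner i by simp
  moreover have "pos c (Suc i) = pos c i + len $ \<pi> i" using assms by (simp add: pos_Suc row_eq)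
  ultimately show ?thesis
    unfolding linear_involution_def tilde_involution_def Let_def the_i
    using mem i j assms
    by (auto simp: left_end_pos[of c i] left_end_pos[of c' "\<sigma> i"] image_point_def swap_component_def)
qed

lemma T_SomeD:
  assumes "T (x, c) = Some q"
  obtains i c' where "c \<le> 1" "c' \<le> 1" "i \<in> row c" "\<sigma> i \<in> row c'" "pos c i < x" "x < pos c (Suc i)"
    "q = (image_point c c' i x, 1 - c')"
proof -
  from assms obtain i where i: "i \<in> {1..l + m}" "(x, c) \<in> piece l \<pi> len i"
    by (auto simp: linear_involution_def tilde_involution_def split: if_splits)
  have c: "component l i = c" "c \<le> 1" using i by (auto simp: piece_def)
  then have ir: "i \<in> row c" using i row_component by auto
  let ?c' = "component l (\<sigma> i)"
  have jr: "\<sigma> i \<in> row ?c'" using i partner_in in_row_component by blast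
  have b: "pos c i < x" "x < pos c (Suc i)" using i ir c by (auto simp: piece_eq)
  show thesis
    using that[OF c(2) _ ir jr b] T_piece[OF c(2) _ ir jr b] assms by auto
qed

lemma partner_image:
  assumes "c \<le> 1" "c' \<le> 1" "i \<in> row c" "\<sigma> i \<in> row c'" "pos c i < x" "x < pos c (Suc i)"
  shows "pos c' (\<sigma> i) < image_point c c' i x \<and> image_point c c' i x < pos c' (Suc (\<sigma> i)) \<and>
         image_point c' c (\<sigma> i) (image_point c c' i x) = x"
proof -
  have i: "i \<in> {1..l + m}" using assms row_component by auto
  have "len $ \<pi> (\<sigma> i) = len $ \<pi> i" "\<sigma> (\<sigma> i) = i" using label_partner partner_partner i by simp_all
  moreover have "pos c (Suc i) = pos c i + len $ \<pi> i" "pos c' (Suc (\<sigma> i)) = pos c' (\<sigma> i) + len $ \<pi> (\<sigma> i)"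
    using assms by (simp_all add: pos_Suc row_eq)
  ultimately show ?thesis using assms by (auto simp: image_point_def)
qed

lemma T_in_phase: "T p = Some q \<Longrightarrow> p \<in> X \<and> q \<in> X"
proof -
  assume a: "T p = Some q"
  obtain x c where p: "p = (x, c)" by (cases p)
  from a[unfolded p] show ?thesis
  proof (rule T_SomeD)
    fix i c' assume h: "c \<le> 1" "c' \<le> 1" "i \<in> row c" "\<sigma> i \<in> row c'" "pos c i < x" "x < pos c (Suc i)"
      and q: "q = (image_point c c' i x, 1 - c')"
    show ?thesis
      using partner_image[OF h] pos_row_bounds[OF h(3)] pos_row_bounds[OF h(4)] h
      unfolding p q by (auto simp: phase_iff)
  qed
qed

lemma phase_snd: "p \<in> X \<Longrightarrow> snd p \<le> 1"
  by (auto simp: phase_space_def)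

lemma f_in_phase [simp]: "p \<in> X \<Longrightarrow> f p \<in> X"
  by (auto simp: phase_space_def swap_component_def)

lemma f_f [simp]: "p \<in> X \<Longrightarrow> f (f p) = p"
  using phase_snd by simp

text \<open>\<open>T\<close> is an involution followed by the exchange of rows \<open>f\<close>, so
  conjugation by \<open>f\<close> inverts it. Statements on backward orbits are reduced to forward
  ones in this way.\<close>

lemma T_reverse:
  assumes "T p = Some q" shows "T (f q) = Some (f p)"
proof -
  obtain x c where p: "p = (x, c)" by (cases p)
  from assms[unfolded p] show ?thesis
  proof (rule T_SomeD)
    fix i c' assume h: "c \<le> 1" "c' \<le> 1" "i \<in> row c" "\<sigma> i \<in> row c'" "pos c i < x" "x < pos c (Suc i)"
      and q: "q = (image_point c c' i x, 1 - c')"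
    have i: "i \<in> {1..l + m}" using h row_component by auto
    have s: "\<sigma> (\<sigma> i) = i" using i partner_partner by simp
    have fq: "f q = (image_point c c' i x, c')" using h by (simp add: q swap_component_def)
    have "T (f q) = Some (image_point c' c (\<sigma> i) (image_point c c' i x), 1 - c)"
      unfolding fq using partner_image[OF h] h s by (intro T_piece) auto
    then show ?thesis using partner_image[OF h] by (simp add: p swap_component_def)
  qed
qed

lemma T_inj: assumes "T p = Some r" "T q = Some r" shows "p = q"
proof -
  have "T (f r) = Some (f p)" "T (f r) = Some (f q)" using assms T_reverse by blast+
  then have "f p = f q" by simp
  then have "f (f p) = f (f q)" by simp
  then show ?thesis using assms T_in_phase f_f by metis
qed

text \<open>Such a point would be fixed before rows are exchanged, but every piece is carried to a
  different one.\<close>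

lemma T_no_turn: "T p \<noteq> Some (f p)"
proof
  assume a: "T p = Some (f p)"
  obtain x c where p: "p = (x, c)" by (cases p)
  from a[unfolded p] show False
  proof (rule T_SomeD)
    fix i c' assume h: "c \<le> 1" "c' \<le> 1" "i \<in> row c" "\<sigma> i \<in> row c'" "pos c i < x" "x < pos c (Suc i)"
      and q: "f (x, c) = (image_point c c' i x, 1 - c')"
    have "c = c'" "image_point c c' i x = x" using q h by (auto simp: swap_component_def)
    then have "\<sigma> i = i" using partner_image[OF h] h pos_locate_unique[of "\<sigma> i" c x i] by auto
    then show False using partner_neq h row_component by auto
  qed
qed

lemma iter_in_phase: "p \<in> X \<Longrightarrow> iter n p = Some q \<Longrightarrow> q \<in> X"
  by (cases n) (auto simp: partial_iterate_Suc bind_eq_Some_conv dest: T_in_phase)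

lemma iter_Suc_iff: "iter (Suc n) p = Some q \<longleftrightarrow> (\<exists>r. iter n p = Some r \<and> T r = Some q)"
  by (auto simp: partial_iterate_Suc bind_eq_Some_conv)

lemma iter_add_iff: "iter (n + k) p = Some q \<longleftrightarrow> (\<exists>r. iter n p = Some r \<and> iter k r = Some q)"
  by (auto simp: partial_iterate_add bind_eq_Some_conv)

lemma iter_Suc_iff': "iter (Suc n) p = Some q \<longleftrightarrow> (\<exists>r. T p = Some r \<and> iter n r = Some q)"
  using iter_add_iff[of "Suc 0" n p q] by simp

lemma iter_reverse: "p \<in> X \<Longrightarrow> iter n p = Some q \<Longrightarrow> iter n (f q) = Some (f p)"
proof (induction n arbitrary: q)
  case (Suc n)
  then obtain r where r: "iter n p = Some r" "T r = Some q" by (auto simp: iter_Suc_iff)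
  then show ?case using Suc T_reverse[OF r(2)] by (auto simp: iter_Suc_iff')
qed simp

lemma iter_inj: "p \<in> X \<Longrightarrow> q \<in> X \<Longrightarrow> iter n p = Some r \<Longrightarrow> iter n q = Some r \<Longrightarrow> p = q"
  by (metis f_f iter_reverse option.inject)

lemma Sing_iff: "p \<in> Sing \<longleftrightarrow> p \<in> X \<and> T p = None"
  by (simp add: singularities_def)

lemma Sing_pos:
  assumes "(x, c) \<in> Sing"
  obtains i where "i \<in> row c" "x = pos c i" "start c < i"
proof -
  have X: "0 < x" "x < L" "c \<le> 1" using assms by (auto simp: Sing_iff phase_iff)
  obtain i where i: "i \<in> row c" "pos c i \<le> x" "x < pos c (Suc i)" using pos_locate[of x c] X by auto
  have "x = pos c i"
  proof (rule ccontr)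
    assume "x \<noteq> pos c i"
    then have "pos c i < x" using i by simp
    moreover have "\<sigma> i \<in> row (component l (\<sigma> i))"
      using i X row_component partner_in in_row_component by blast
    ultimately have "T (x, c) \<noteq> None"
      using T_piece[OF X(3) component_le_1 i(1) _ _ i(3)] by (metis option.distinct(1))
    then show False using assms by (simp add: Sing_iff)
  qed
  moreover have "i \<noteq> start c" using X \<open>x = pos c i\<close> by auto
  ultimately show thesis using i that[of i] by (auto simp: row_eq)
qed

lemma pos_Sing:
  assumes "c \<le> 1" "start c < i" "i < stop c" shows "(pos c i, c) \<in> Sing"
proof -
  have "0 < pos c i" using pos_less[of c "start c" i] assms by simp
  moreover have "pos c i < L" using pos_less[of c i "stop c"] assms pos_stop[of c] by simp
  moreover have "T (pos c i, c) = None"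
  proof (rule ccontr)
    assume "T (pos c i, c) \<noteq> None"
    then obtain q where "T (pos c i, c) = Some q" by auto
    then show False
    proof (rule T_SomeD)
      fix k c' assume "k \<in> row c" "pos c k < pos c i" "pos c i < pos c (Suc k)"
      then show False using assms by (auto simp: pos_less_iff row_eq)
    qed
  qed
  ultimately show ?thesis using assms by (simp add: Sing_iff phase_iff)
qed

lemma finite_Sing: "finite Sing"
proof -
  have "Sing \<subseteq> (\<lambda>(c, i). (pos c i, c)) ` (SIGMA c:{0, 1}. row c)"
  proof
    fix p assume p: "p \<in> Sing"
    obtain x c where pc: "p = (x, c)" by (cases p)
    then have "c \<in> {0, 1}" using p by (auto simp: Sing_iff phase_space_def)
    with p pc show "p \<in> (\<lambda>(c, i). (pos c i, c)) ` (SIGMA c:{0, 1}. row c)"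
      by (auto elim!: Sing_pos)
  qed
  then show ?thesis by (rule finite_subset) auto
qed

section \<open>The Keane property implies minimality\<close>

text \<open>Openness is stated along the first coordinate, the row index being a discrete factor. As
  \<open>T\<close> is partial, the invariance clause gives no forward image for a singularity lying
  in \<open>U\<close>; \<open>clear_radius\<close> deals with those.\<close>

definition invariant_open :: "(real \<times> nat) set \<Rightarrow> bool" where
  "invariant_open U \<longleftrightarrow> U \<subseteq> X \<and>
     (\<forall>x c. (x, c) \<in> U \<longrightarrow> (\<exists>e>0. \<forall>x'. \<bar>x' - x\<bar> < e \<longrightarrow> (x', c) \<in> U)) \<and>
     (\<forall>p q. T p = Some q \<longrightarrow> (p \<in> U \<longleftrightarrow> q \<in> U))"

text \<open>\<open>y\<close> is an endpoint of a component of \<open>U\<close> that extends at least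
  \<open>w\<close> to the side \<open>d\<close>. The fixed width makes such points finite in
  number.\<close>

definition one_sided_at :: "(real \<times> nat) set \<Rightarrow> real \<Rightarrow> real \<times> nat \<Rightarrow> bool" where
  "one_sided_at U w y \<longleftrightarrow> y \<in> X - U \<and>
     (\<exists>d\<in>{1, -1}. \<forall>t. 0 < t \<and> t < w \<longrightarrow> (fst y + d * t, snd y) \<in> U)"

text \<open>A point outside \<open>U\<close> is thus at distance at least \<open>w\<close> from the
  singularities in \<open>U\<close> of its row, so an interval of length \<open>w\<close> in
  \<open>U\<close> starting at such a point contains no singularity.\<close>

definition clear_radius :: "(real \<times> nat) set \<Rightarrow> real \<Rightarrow> bool" where
  "clear_radius U w \<longleftrightarrow> (\<forall>s\<in>Sing \<inter> U. \<forall>x'. \<bar>x' - fst s\<bar> < w \<longrightarrow> (x', snd s) \<in> U)"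

lemma f_image_iff: "U \<subseteq> X \<Longrightarrow> p \<in> X \<Longrightarrow> p \<in> f ` U \<longleftrightarrow> f p \<in> U"
  by (metis f_f image_iff subsetD)

lemma invariant_open_f:
  assumes "invariant_open U" shows "invariant_open (f ` U)"
proof -
  have U: "U \<subseteq> X" using assms by (simp add: invariant_open_def)
  have fU: "f ` U \<subseteq> X" using U by auto
  have "\<exists>e>0. \<forall>x'. \<bar>x' - x\<bar> < e \<longrightarrow> (x', c) \<in> f ` U" if "(x, c) \<in> f ` U" for x c
  proof -
    have x: "(x, c) \<in> X" using that fU by blast
    then have "c \<le> 1" by (simp add: phase_iff)
    have "(x, 1 - c) \<in> U" using that f_image_iff[OF U x] by (simp add: swap_component_def)
    then obtain e where e: "e > 0" "\<And>x'. \<bar>x' - x\<bar> < e \<Longrightarrow> (x', 1 - c) \<in> U"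
      using assms unfolding invariant_open_def by blast
    have "(x', c) \<in> f ` U" if "\<bar>x' - x\<bar> < e" for x'
      using imageI[OF e(2)[OF that], of f] \<open>c \<le> 1\<close> by (simp add: swap_component_def)
    then show ?thesis using e(1) by blast
  qed
  moreover have "p \<in> f ` U \<longleftrightarrow> q \<in> f ` U" if "T p = Some q" for p q
  proof -
    have "f q \<in> U \<longleftrightarrow> f p \<in> U" using assms T_reverse[OF that] unfolding invariant_open_def by blast
    then show ?thesis using T_in_phase[OF that] f_image_iff[OF U] by simp
  qed
  ultimately show ?thesis using fU unfolding invariant_open_def by blast
qed

lemma one_sided_at_f:
  assumes "invariant_open U" "one_sided_at U w y" shows "one_sided_at (f ` U) w (f y)"
proof -
  have U: "U \<subseteq> X" using assms by (simp add: invariant_open_def)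
  have y: "y \<in> X" "y \<notin> U" using assms by (auto simp: one_sided_at_def)
  then have "f y \<in> X" "f y \<notin> f ` U" using f_image_iff[OF U, of "f y"] by auto
  moreover obtain d where d: "d \<in> {1, -1}" "\<And>t. 0 < t \<and> t < w \<Longrightarrow> (fst y + d * t, snd y) \<in> U"
    using assms unfolding one_sided_at_def by blast
  have "(fst (f y) + d * t, snd (f y)) \<in> f ` U" if "0 < t \<and> t < w" for t
    using imageI[OF d(2)[OF that], of f] by (simp add: swap_component_def)
  ultimately show ?thesis using d(1) unfolding one_sided_at_def by blast
qed

lemma clear_radius_exists:
  assumes "invariant_open U" obtains w where "0 < w" "clear_radius U w"
proof -
  have "\<forall>s\<in>Sing \<inter> U. \<exists>e>0. \<forall>x'. \<bar>x' - fst s\<bar> < e \<longrightarrow> (x', snd s) \<in> U"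
    using assms unfolding invariant_open_def by force
  then obtain e where e: "\<forall>s\<in>Sing \<inter> U. e s > 0 \<and> (\<forall>x'. \<bar>x' - fst s\<bar> < e s \<longrightarrow> (x', snd s) \<in> U)"
    by metis
  define w where "w = Min (insert 1 (e ` (Sing \<inter> U)))"
  have fin: "finite (insert 1 (e ` (Sing \<inter> U)))" using finite_Sing by simp
  have "0 < w" unfolding w_def using fin e by (subst Min_gr_iff) auto
  moreover have "w \<le> e s" if "s \<in> Sing \<inter> U" for s
    unfolding w_def using fin that by (intro Min_le) auto
  then have "clear_radius U w" using e unfolding clear_radius_def by (meson less_le_trans)
  ultimately show thesis by (rule that)
qed

lemma clear_radius_mono: "clear_radius U w \<Longrightarrow> w' \<le> w \<Longrightarrow> clear_radius U w'"
  unfolding clear_radius_def by force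

lemma one_sided_at_mono: "one_sided_at U w y \<Longrightarrow> w' \<le> w \<Longrightarrow> one_sided_at U w' y"
  unfolding one_sided_at_def by (meson less_le_trans)

text \<open>By the choice of \<open>w\<close> the interval next to \<open>y\<close> stays inside the
  piece containing \<open>y\<close> and is moved isometrically as a whole, so the width does not
  shrink.\<close>

lemma one_sided_at_step:
  assumes U: "invariant_open U" "clear_radius U w" and y: "one_sided_at U w y" and T: "T y = Some y'"
  shows "one_sided_at U w y'"
proof -
  obtain x c where yx: "y = (x, c)" by (cases y)
  obtain d where d: "d \<in> {1, -1}" "\<And>t. 0 < t \<and> t < w \<Longrightarrow> (x + d * t, c) \<in> U"
    using y unfolding one_sided_at_def yx fst_conv snd_conv by blast
  have yU: "(x, c) \<in> X" "(x, c) \<notin> U" using y by (auto simp: one_sided_at_def yx)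
  from T[unfolded yx] obtain i c' where h: "c \<le> 1" "c' \<le> 1" "i \<in> row c" "\<sigma> i \<in> row c'"
    "pos c i < x" "x < pos c (Suc i)" and y': "y' = (image_point c c' i x, 1 - c')"
    by (rule T_SomeD)
  have no_sing: "k \<notin> {start c<..<stop c}" if "\<bar>x - pos c k\<bar> < w" "(pos c k, c) \<in> U" for k
    using that pos_Sing[OF h(1), of k] U(2) yU(2) unfolding clear_radius_def by force
  have UX: "p \<in> U \<Longrightarrow> p \<in> X" for p using U(1) unfolding invariant_open_def by blast
  have inside: "pos c i < x + d * t \<and> x + d * t < pos c (Suc i)" if t: "0 < t" "t < w" for t
  proof (cases "d = 1")
    case True
    have "x + t < pos c (Suc i)"
    proof (rule ccontr)
      assume "\<not> x + t < pos c (Suc i)"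
      then have b: "0 < pos c (Suc i) - x" "pos c (Suc i) - x < w" using t h by auto
      then have e: "(pos c (Suc i), c) \<in> U" using d(2)[of "pos c (Suc i) - x"] True by simp
      then have "pos c (Suc i) < L" using UX[OF e] by (simp add: phase_iff)
      then have "Suc i \<noteq> stop c" using pos_stop[of c] by auto
      then show False using no_sing[OF _ e] b h(3) by (auto simp: row_eq)
    qed
    then show ?thesis using True h t by simp
  next
    case False
    then have d1: "d = -1" using d by simp
    have "pos c i < x - t"
    proof (rule ccontr)
      assume "\<not> pos c i < x - t"
      then have b: "0 < x - pos c i" "x - pos c i < w" using t h by auto
      then have e: "(pos c i, c) \<in> U" using d(2)[of "x - pos c i"] d1 by simp
      then have "0 < pos c i" using UX[OF e] by (simp add: phase_iff)
      then have "i \<noteq> start c" by auto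
      then show False using no_sing[OF _ e] b h(3) by (auto simp: row_eq)
    qed
    then show ?thesis using d1 h t by simp
  qed
  have inv: "T p = Some q \<Longrightarrow> p \<in> U \<longleftrightarrow> q \<in> U" for p q using U(1) unfolding invariant_open_def by blast
  \<comment> \<open>A band joining two pieces of one row exchanges left and right.\<close>
  define d' where "d' = (if c = c' then - d else d)"
  have "(fst y' + d' * t, snd y') \<in> U" if t: "0 < t \<and> t < w" for t
  proof -
    have "T (x + d * t, c) = Some (image_point c c' i (x + d * t), 1 - c')"
      using inside[of t] t h by (intro T_piece) auto
    moreover have "image_point c c' i (x + d * t) = fst y' + d' * t"
      by (simp add: y' d'_def image_point_def)
    ultimately show ?thesis using inv d(2)[OF t] by (simp add: y')
  qed
  moreover have "d' \<in> {1, -1}" using d by (auto simp: d'_def)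
  moreover have "y' \<in> X - U" using inv[OF T] T_in_phase[OF T] yU by (auto simp: yx)
  ultimately show ?thesis unfolding one_sided_at_def by blast
qed

lemma one_sided_at_iter:
  assumes "invariant_open U" "clear_radius U w" "one_sided_at U w y" "iter n y = Some q"
  shows "one_sided_at U w q"
  using assms(4)
proof (induction n arbitrary: q)
  case 0
  then show ?case using assms(3) by simp
next
  case (Suc n)
  then obtain r where "iter n y = Some r" "T r = Some q" unfolding iter_Suc_iff by blast
  then show ?case using one_sided_at_step[OF assms(1,2)] Suc.IH by blast
qed

text \<open>Two such points in one row with the same side are at least \<open>w\<close> apart, since
  otherwise one of them, lying outside \<open>U\<close>, would be in the interval of the other.
  Hence rounding down in units of \<open>w\<close> is injective.\<close>

lemma finite_one_sided_at:
  assumes w: "0 < w" shows "finite {y. one_sided_at U w y}"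
proof -
  define A where "A c d = {y. snd y = c \<and> y \<in> X - U \<and>
    (\<forall>t. 0 < t \<and> t < w \<longrightarrow> (fst y + d * t, snd y) \<in> U)}" for c and d :: real
  have fin: "finite (A c d)" if d: "d \<in> {1, -1}" for c d
  proof (rule finite_imageD)
    let ?g = "\<lambda>y :: real \<times> nat. \<lfloor>fst y / w\<rfloor>"
    have "?g ` A c d \<subseteq> {0..\<lfloor>L / w\<rfloor>}"
      using w by (auto simp: A_def phase_iff intro!: floor_mono divide_right_mono)
    then show "finite (?g ` A c d)" by (rule finite_subset) simp
    show "inj_on ?g (A c d)"
    proof (rule inj_onI)
      fix y z assume yz: "y \<in> A c d" "z \<in> A c d" "?g y = ?g z"
      have less: False if "u \<in> A c d" "v \<in> A c d" "?g u = ?g v" "fst u < fst v" for u v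
      proof -
        have "fst v / w - fst u / w < 1" using that(3) by linarith
        then have lt: "fst v - fst u < w" using w by (simp add: field_simps)
        have snd: "snd u = snd v" "u \<notin> U" "v \<notin> U" using that by (auto simp: A_def)
        have A: "(fst y + d * t, snd y) \<in> U" if "y \<in> A c d" "0 < t" "t < w" for y t
          using that unfolding A_def by blast
        \<comment> \<open>For \<open>d = 1\<close> the first membership puts \<open>v\<close> into
          \<open>U\<close>; for \<open>d = -1\<close> the second puts \<open>u\<close> into
          \<open>U\<close>.\<close>
        have "(fst u + d * (fst v - fst u), snd u) \<in> U" "(fst v + d * (fst v - fst u), snd v) \<in> U"
          using A[OF that(1)] A[OF that(2)] lt that(4) by simp_all
        moreover have "(fst v, snd u) = v" "(fst u, snd v) = u" using snd(1) by (simp_all add: prod_eq_iff)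
        ultimately show False using snd d by auto
      qed
      then have "fst y = fst z" using yz by (metis linorder_neqE_linordered_idom)
      then show "y = z" using yz by (auto simp: A_def prod_eq_iff)
    qed
  qed
  have "{y. one_sided_at U w y} \<subseteq> (\<Union>c\<in>{0, 1}. \<Union>d\<in>{1, -1}. A c d)"
    by (auto simp: one_sided_at_def A_def phase_iff)
  then show ?thesis by (rule finite_subset) (use fin in auto)
qed

text \<open>A forward orbit that never stops runs in a finite set and repeats; injectivity of
  \<open>T\<close> pulls the repetition back to \<open>y\<close> itself.\<close>

lemma one_sided_at_forward:
  assumes U: "invariant_open U" "clear_radius U w" "0 < w" and y: "one_sided_at U w y"
  shows "(\<exists>n q. iter n y = Some q \<and> q \<in> Sing) \<or> (\<exists>n>0. iter n y = Some y)"
proof (cases "\<exists>n. iter n y = None")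
  case True
  define n where "n = (LEAST n. iter n y = None)"
  have n: "iter n y = None" unfolding n_def using True by (rule LeastI_ex)
  then obtain k where k: "n = Suc k" by (cases n) auto
  then have "iter k y \<noteq> None" using not_less_Least[of k "\<lambda>n. iter n y = None"] by (simp add: n_def)
  then obtain q where q: "iter k y = Some q" by auto
  then have "T q = None" using n by (simp add: k partial_iterate_Suc)
  moreover have "y \<in> X" using y by (simp add: one_sided_at_def)
  then have "q \<in> X" using q iter_in_phase by blast
  ultimately show ?thesis using q Sing_iff by blast
next
  case False
  define g where "g n = the (iter n y)" for n
  have g: "iter n y = Some (g n)" for n using False by (simp add: g_def)
  have "range g \<subseteq> {y. one_sided_at U w y}" using one_sided_at_iter[OF U(1,2) y g] by auto
  then have "finite (range g)" using finite_one_sided_at[OF U(3)] finite_subset by blast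
  then have "\<not> inj g" using finite_imageD by blast
  then obtain j k where jk: "j < k" "g j = g k" unfolding inj_def by (metis linorder_neqE_nat)
  have "iter (k - j + j) y = Some (g k)" using jk g by simp
  then obtain r where r: "iter (k - j) y = Some r" "iter j r = Some (g k)" unfolding iter_add_iff by blast
  have X: "y \<in> X" using y by (simp add: one_sided_at_def)
  have "r = y" using iter_inj[of r y j "g k"] r X iter_in_phase[OF X r(1)] g[of j] jk by simp
  then show ?thesis using r jk by (intro disjI2 exI[of _ "k - j"]) auto
qed

text \<open>The forward orbit of \<open>f y\<close> is the backward orbit of \<open>y\<close> seen
  through \<open>f\<close>. If \<open>y\<close> is not periodic, both orbits stop at singularities;
  reversing the second and appending the first yields a connection.\<close>

lemma keane_one_sided_periodic:
  assumes K: "keane_property l m \<pi> len" and U: "invariant_open U" "0 < w" "one_sided_at U w y"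
  shows "\<exists>n>0. iter n y = Some y"
proof (rule ccontr)
  assume np: "\<not> ?thesis"
  have X: "y \<in> X" using U by (simp add: one_sided_at_def)
  have fU: "invariant_open (f ` U)" using U(1) by (rule invariant_open_f)
  obtain w1 where w1: "0 < w1" "clear_radius U w1" using clear_radius_exists[OF U(1)] .
  obtain w2 where w2: "0 < w2" "clear_radius (f ` U) w2" using clear_radius_exists[OF fU] .
  define v where "v = min w (min w1 w2)"
  have v: "0 < v" "v \<le> w" "v \<le> w1" "v \<le> w2" using U w1 w2 by (auto simp: v_def)
  have yv: "one_sided_at U v y" using U v one_sided_at_mono by blast
  obtain n q where q: "iter n y = Some q" "q \<in> Sing"
    using one_sided_at_forward[OF U(1) clear_radius_mono[OF w1(2) v(3)] v(1) yv] np by blast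
  have np': "\<not> (\<exists>n>0. iter n (f y) = Some (f y))"
    using np iter_reverse[of "f y"] X by (metis f_f f_in_phase)
  obtain k p where p: "iter k (f y) = Some p" "p \<in> Sing"
    using one_sided_at_forward[OF fU clear_radius_mono[OF w2(2) v(4)] v(1) one_sided_at_f[OF U(1) yv]] np'
    by blast
  have "iter k (f p) = Some y" using iter_reverse[OF _ p(1)] X by simp
  then have "iter (k + n) (f p) = Some q" using q by (auto simp: iter_add_iff)
  then have "has_connection l m \<pi> len (k + n)"
    using p(2) q(2) unfolding has_connection_def inverse_singularities_def by blast
  then show False using K by (auto simp: keane_property_def)
qed

text \<open>Rows encode orientation: \<open>T\<close> reverses it exactly when the partner lies in
  the same row, and then \<open>f\<close> leads to the other row. So the sign depends only on
  whether \<open>c = c'\<close>.\<close>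

lemma iter_local:
  assumes "iter n (x, c) = Some (x', c')" "(x, c) \<in> X"
  shows "\<exists>e>0. \<forall>t. \<bar>t\<bar> < e \<longrightarrow> iter n (x + t, c) = Some (x' + (if c = c' then t else - t), c')"
  using assms(1)
proof (induction n arbitrary: x' c')
  case 0
  then show ?case by (auto intro!: exI[of _ 1])
next
  case (Suc n)
  then obtain x1 c1 where 1: "iter n (x, c) = Some (x1, c1)" "T (x1, c1) = Some (x', c')"
    by (auto simp: iter_Suc_iff)
  obtain e1 where e1: "e1 > 0"
    "\<And>t. \<bar>t\<bar> < e1 \<Longrightarrow> iter n (x + t, c) = Some (x1 + (if c = c1 then t else - t), c1)"
    using Suc.IH[OF 1(1)] by blast
  from 1(2) obtain i c2 where h: "c1 \<le> 1" "c2 \<le> 1" "i \<in> row c1" "\<sigma> i \<in> row c2"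
    "pos c1 i < x1" "x1 < pos c1 (Suc i)" and q: "(x', c') = (image_point c1 c2 i x1, 1 - c2)"
    by (rule T_SomeD)
  have c: "c \<in> {0, 1}" "c1 \<in> {0, 1}" "c2 \<in> {0, 1}" using assms(2) h by (auto simp: phase_iff)
  define e where "e = min e1 (min (x1 - pos c1 i) (pos c1 (Suc i) - x1))"
  have "e > 0" using e1 h by (simp add: e_def)
  moreover have "iter (Suc n) (x + t, c) = Some (x' + (if c = c' then t else - t), c')" if "\<bar>t\<bar> < e" for t
  proof -
    define u where "u = (if c = c1 then t else - t)"
    have "pos c1 i < x1 + u" "x1 + u < pos c1 (Suc i)" using that by (auto simp: e_def u_def)
    then have "T (x1 + u, c1) = Some (image_point c1 c2 i (x1 + u), 1 - c2)"
      using h by (intro T_piece) auto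
    moreover have "image_point c1 c2 i (x1 + u) = x' + (if c = c' then t else - t)"
      using q c by (auto simp: image_point_def u_def)
    ultimately show ?thesis using e1(2)[of t] that q by (auto simp: e_def u_def iter_Suc_iff)
  qed
  ultimately show ?case by blast
qed

text \<open>On the way from \<open>x\<close> to \<open>x'\<close>, compactness supplies the first
  point outside \<open>U\<close>; the width is its distance from \<open>x\<close>.\<close>

lemma boundary_point:
  assumes U: "invariant_open U" and x: "(x, c) \<in> U" and x': "(x', c) \<in> X - U"
  obtains y w where "0 < w" "one_sided_at U w y"
proof -
  define V where "V = {y. (y, c) \<in> U}"
  have "open V" unfolding V_def open_dist
    using U by (auto simp: invariant_open_def dist_real_def)
  have c: "0 < x" "x < L" "0 < x'" "x' < L" "c \<le> 1"
    using x x' U by (auto simp: invariant_open_def phase_iff)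
  show thesis
  proof (cases "x < x'")
    case True
    have "compact ({x..x'} \<inter> - V)" using \<open>open V\<close> by (intro compact_Int_closed) auto
    moreover have "x' \<in> {x..x'} \<inter> - V" using True x' by (auto simp: V_def)
    ultimately obtain z where z: "z \<in> {x..x'} \<inter> - V" "\<And>t. t \<in> {x..x'} \<inter> - V \<Longrightarrow> z \<le> t"
      using compact_attains_inf[of "{x..x'} \<inter> - V"] by blast
    have "z \<noteq> x" using z(1) x by (auto simp: V_def)
    have "(z + (-1) * t, c) \<in> U" if "0 < t" "t < z - x" for t
      using z(2)[of "z - t"] z(1) that by (auto simp: V_def)
    then have "one_sided_at U (z - x) (z, c)"
      unfolding one_sided_at_def using z(1) c by (auto simp: V_def phase_iff)
    then show thesis using that[of "z - x" "(z, c)"] z(1) \<open>z \<noteq> x\<close> by auto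
  next
    case False
    have "compact ({x'..x} \<inter> - V)" using \<open>open V\<close> by (intro compact_Int_closed) auto
    moreover have "x' \<in> {x'..x} \<inter> - V" using False x' by (auto simp: V_def)
    ultimately obtain z where z: "z \<in> {x'..x} \<inter> - V" "\<And>t. t \<in> {x'..x} \<inter> - V \<Longrightarrow> t \<le> z"
      using compact_attains_sup[of "{x'..x} \<inter> - V"] by blast
    have "z \<noteq> x" using z(1) x by (auto simp: V_def)
    have "(z + 1 * t, c) \<in> U" if "0 < t" "t < x - z" for t
      using z(2)[of "z + t"] z(1) that by (auto simp: V_def)
    then have "one_sided_at U (x - z) (z, c)"
      unfolding one_sided_at_def using z(1) c by (auto simp: V_def phase_iff)
    then show thesis using that[of "x - z" "(z, c)"] z(1) \<open>z \<noteq> x\<close> by auto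
  qed
qed

text \<open>At a fixed point of the iterate the rows agree, so nearby points are moved by the same
  zero translation: the fixed points form an open set. It has no boundary point, hence would contain
  the singularity of its row, where no iterate of positive order is defined.\<close>

lemma keane_no_periodic:
  assumes K: "keane_property l m \<pi> len" and p: "p \<in> X" and n: "0 < n"
  shows "iter n p \<noteq> Some p"
proof
  assume per: "iter n p = Some p"
  define U where "U = {u \<in> X. iter n u = Some u}"
  have def: "\<exists>q. T u = Some q" if "u \<in> U" for u
  proof -
    obtain k where "n = Suc k" using n by (cases n) auto
    then show ?thesis using that by (auto simp: U_def iter_Suc_iff')
  qed
  have "\<exists>e>0. \<forall>x'. \<bar>x' - x\<bar> < e \<longrightarrow> (x', c) \<in> U" if u: "(x, c) \<in> U" for x c
  proof -
    obtain e where e: "e > 0" "\<And>t. \<bar>t\<bar> < e \<Longrightarrow> iter n (x + t, c) = Some (x + t, c)"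
      using iter_local[of n x c x c] u by (auto simp: U_def)
    obtain k where k: "n = Suc k" using n by (cases n) auto
    have "(x', c) \<in> U" if "\<bar>x' - x\<bar> < e" for x'
      using e(2)[of "x' - x"] that T_in_phase unfolding U_def by (auto simp: k iter_Suc_iff)
    then show ?thesis using e(1) by blast
  qed
  moreover have "u \<in> U \<longleftrightarrow> v \<in> U" if T: "T u = Some v" for u v
  proof
    assume "u \<in> U"
    then have "iter (Suc n) u = Some v" using T by (auto simp: U_def iter_Suc_iff)
    then show "v \<in> U" using T T_in_phase[OF T] by (auto simp: U_def iter_Suc_iff')
  next
    assume "v \<in> U"
    then have "iter (Suc n) u = Some v" using T by (auto simp: U_def iter_Suc_iff')
    then show "u \<in> U" using T_in_phase[OF T] T_inj[OF _ T] unfolding U_def iter_Suc_iff by blast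
  qed
  ultimately have U: "invariant_open U" unfolding invariant_open_def by (auto simp: U_def)
  have no_boundary: False if y: "0 < w" "one_sided_at U w y" for w y
  proof -
    obtain k where k: "0 < k" "iter k y = Some y" using keane_one_sided_periodic[OF K U y] by blast
    have X: "y \<in> X" "y \<notin> U" using y by (auto simp: one_sided_at_def)
    \<comment> \<open>The period \<open>k\<close> of \<open>y\<close> is unrelated to
      \<open>n\<close>, but \<open>n * k\<close> is at least \<open>n\<close>, so the iterate of
      order \<open>n\<close> is defined at \<open>y\<close>.\<close>
    have "iter (j * k) y = Some y" for j
      by (induction j) (use k in \<open>auto simp: iter_add_iff\<close>)
    moreover have "n * k = n + (n * k - n)" using k n by simp
    ultimately obtain z where z: "iter n y = Some z" by (metis iter_add_iff)
    obtain x c x' c' where yz: "y = (x, c)" "z = (x', c')" by (metis prod.collapse)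
    obtain e where e: "e > 0"
      "\<And>t. \<bar>t\<bar> < e \<Longrightarrow> iter n (x + t, c) = Some (x' + (if c = c' then t else - t), c')"
      using iter_local[of n x c x' c'] z X(1) unfolding yz by blast
    obtain d where d: "d \<in> {1, -1}" "\<And>t. 0 < t \<and> t < w \<Longrightarrow> (x + d * t, c) \<in> U"
      using y unfolding one_sided_at_def yz fst_conv snd_conv by blast
    \<comment> \<open>A point of \<open>U\<close> within both radii is fixed, so there the local
      isometry at \<open>y\<close> agrees with the identity. It therefore preserves the row and
      translates by zero, which makes \<open>y\<close> a fixed point as well.\<close>
    define t where "t = min e w / 2"
    have t: "0 < t" "t < e" "t < w" using e(1) y(1) by (auto simp: t_def)
    then have "iter n (x + d * t, c) = Some (x + d * t, c)" using d by (auto simp: U_def)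
    moreover have "\<bar>d * t\<bar> < e" using d t by auto
    ultimately have "(x' + (if c = c' then d * t else - (d * t)), c') = (x + d * t, c)"
      using e(2)[of "d * t"] by (metis option.inject)
    then have "c' = c" "x' = x" by (auto split: if_splits)
    then show False using z X yz by (simp add: U_def)
  qed
  obtain x c where px: "p = (x, c)" by (cases p)
  then have pU: "(x, c) \<in> U" using p per by (simp add: U_def)
  have c: "c \<le> 1" using p px by (simp add: phase_iff)
  let ?s = "(pos c (Suc (start c)), c)"
  have s: "?s \<in> Sing" using c start_Suc_lt_stop by (intro pos_Sing) auto
  show False
  proof (cases "?s \<in> U")
    case True
    then show False using def[OF True] s by (auto simp: Sing_iff)
  next
    case False
    then have "?s \<in> X - U" using s by (simp add: Sing_iff)
    then show False using boundary_point[OF U pU] no_boundary by blast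
  qed
qed

section \<open>Orbit closures and the passage to minimality\<close>

lemma closure_rows:
  "(x, c) \<in> closure S \<longleftrightarrow> (\<forall>e>0. \<exists>x'. (x', c) \<in> S \<and> \<bar>x' - x\<bar> < e)" for S :: "(real \<times> nat) set"
proof
  assume cl: "(x, c) \<in> closure S"
  show "\<forall>e>0. \<exists>x'. (x', c) \<in> S \<and> \<bar>x' - x\<bar> < e"
  proof (intro allI impI)
    fix e :: real assume "e > 0"
    moreover have "open (ball x e \<times> {c})" by (intro open_Times open_ball open_discrete)
    ultimately have "S \<inter> (ball x e \<times> {c}) \<noteq> {}"
      using cl unfolding closure_iff_nhds_not_empty by (metis centre_in_ball mem_Sigma_iff order_refl singletonI)
    then show "\<exists>x'. (x', c) \<in> S \<and> \<bar>x' - x\<bar> < e" by (auto simp: dist_real_def abs_minus_commute)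
  qed
next
  assume r: "\<forall>e>0. \<exists>x'. (x', c) \<in> S \<and> \<bar>x' - x\<bar> < e"
  show "(x, c) \<in> closure S" unfolding closure_iff_nhds_not_empty
  proof (intro allI impI)
    fix A V assume V: "V \<subseteq> A" "open V" "(x, c) \<in> V"
    obtain I J where IJ: "open I" "open J" "(x, c) \<in> I \<times> J" "I \<times> J \<subseteq> V" using open_prod_elim[OF V(2,3)] by blast
    then obtain e where "e > 0" "\<And>y. dist y x < e \<Longrightarrow> y \<in> I" unfolding open_dist by blast
    moreover from this obtain x' where "(x', c) \<in> S" "\<bar>x' - x\<bar> < e" using r by blast
    ultimately show "S \<inter> A \<noteq> {}" using IJ V by (force simp: dist_real_def)
  qed
qed

lemma orbit_invariant:
  assumes p: "p \<in> X" and T: "T u = Some v"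
  shows "u \<in> two_sided_orbit l m \<pi> len p \<longleftrightarrow> v \<in> two_sided_orbit l m \<pi> len p"
proof
  assume "u \<in> two_sided_orbit l m \<pi> len p"
  then obtain n where "iter n p = Some u \<or> iter n u = Some p" by (auto simp: two_sided_orbit_def)
  then have "\<exists>n. iter n p = Some v \<or> iter n v = Some p"
  proof
    assume "iter n p = Some u"
    then have "iter (Suc n) p = Some v" using T by (auto simp: iter_Suc_iff)
    then show ?thesis by blast
  next
    assume n: "iter n u = Some p"
    show ?thesis
    proof (cases n)
      case 0
      then have "iter (Suc 0) p = Some v" using n T by simp
      then show ?thesis by blast
    next
      case (Suc k)
      then show ?thesis using n T by (auto simp: iter_Suc_iff')
    qed
  qed
  then show "v \<in> two_sided_orbit l m \<pi> len p" using T_in_phase[OF T] by (simp add: two_sided_orbit_def)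
next
  assume "v \<in> two_sided_orbit l m \<pi> len p"
  then obtain n where "iter n p = Some v \<or> iter n v = Some p" by (auto simp: two_sided_orbit_def)
  then have "\<exists>n. iter n p = Some u \<or> iter n u = Some p"
  proof
    assume n: "iter n p = Some v"
    show ?thesis
    proof (cases n)
      case 0
      then have "iter (Suc 0) u = Some p" using n T by simp
      then show ?thesis by blast
    next
      case (Suc k)
      then show ?thesis using n T_inj[OF _ T] unfolding Suc iter_Suc_iff by blast
    qed
  next
    assume "iter n v = Some p"
    then have "iter (Suc n) u = Some p" using T by (auto simp: iter_Suc_iff')
    then show ?thesis by blast
  qed
  then show "u \<in> two_sided_orbit l m \<pi> len p" using T_in_phase[OF T] by (simp add: two_sided_orbit_def)
qed

lemma closure_orbit_forward:
  assumes p: "p \<in> X" and T: "T u = Some v" and u: "u \<in> closure (two_sided_orbit l m \<pi> len p)"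
  shows "v \<in> closure (two_sided_orbit l m \<pi> len p)"
proof -
  let ?O = "two_sided_orbit l m \<pi> len p"
  obtain x c x' c' where uv: "u = (x, c)" "v = (x', c')" by (metis prod.collapse)
  obtain e0 where e0: "e0 > 0"
    "\<And>t. \<bar>t\<bar> < e0 \<Longrightarrow> T (x + t, c) = Some (x' + (if c = c' then t else - t), c')"
    using iter_local[of "Suc 0" x c x' c'] T T_in_phase[OF T] unfolding uv by auto
  show ?thesis unfolding uv closure_rows
  proof (intro allI impI)
    fix e :: real assume "e > 0"
    then obtain z where z: "(z, c) \<in> ?O" "\<bar>z - x\<bar> < min e e0"
      using u e0(1) unfolding uv closure_rows by (meson min_less_iff_conj)
    have "T (z, c) = Some (x' + (if c = c' then z - x else - (z - x)), c')" using e0(2)[of "z - x"] z by simp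
    then have "(x' + (if c = c' then z - x else - (z - x)), c') \<in> ?O" using orbit_invariant[OF p] z by blast
    then show "\<exists>x''. (x'', c') \<in> ?O \<and> \<bar>x'' - x'\<bar> < e" using z by (intro exI conjI) auto
  qed
qed

lemma invariant_open_orbit:
  assumes p: "p \<in> X" shows "invariant_open (X - closure (two_sided_orbit l m \<pi> len p))"
proof -
  let ?O = "two_sided_orbit l m \<pi> len p"
  have "\<exists>e>0. \<forall>x'. \<bar>x' - x\<bar> < e \<longrightarrow> (x', c) \<in> X - closure ?O" if u: "(x, c) \<in> X - closure ?O" for x c
  proof -
    obtain e0 where e0: "e0 > 0" "\<And>x'. \<bar>x' - x\<bar> < e0 \<Longrightarrow> (x', c) \<notin> ?O"
      using DiffD2[OF u] unfolding closure_rows by blast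
    \<comment> \<open>The half leaves room for the triangle inequality; the other terms keep
      \<open>x'\<close> inside the open interval.\<close>
    define e where "e = min (e0 / 2) (min x (L - x))"
    have "e > 0" using e0 u by (auto simp: e_def phase_iff)
    moreover have "(x', c) \<in> X - closure ?O" if "\<bar>x' - x\<bar> < e" for x'
    proof -
      have "(x', c) \<notin> closure ?O"
      proof
        assume "(x', c) \<in> closure ?O"
        then obtain z where "(z, c) \<in> ?O" "\<bar>z - x'\<bar> < e0 / 2"
          using e0(1) unfolding closure_rows by (meson half_gt_zero)
        moreover from this have "\<bar>z - x\<bar> < e0" using that unfolding e_def by linarith
        ultimately show False using e0(2) by blast
      qed
      then show ?thesis using u that by (auto simp: e_def phase_iff)
    qed
    ultimately show ?thesis by blast
  qed
  moreover have "u \<in> X - closure ?O \<longleftrightarrow> v \<in> X - closure ?O" if T: "T u = Some v" for u v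
  proof -
    have "v \<in> closure ?O" if "u \<in> closure ?O" using closure_orbit_forward[OF p T that] .
    moreover have "u \<in> closure ?O" if v: "v \<in> closure ?O"
    proof -
      obtain x c x' c' where uv: "u = (x, c)" "v = (x', c')" by (metis prod.collapse)
      obtain e0 where e0: "e0 > 0"
        "\<And>t. \<bar>t\<bar> < e0 \<Longrightarrow> T (x + t, c) = Some (x' + (if c = c' then t else - t), c')"
        using iter_local[of "Suc 0" x c x' c'] T T_in_phase[OF T] unfolding uv by auto
      show ?thesis unfolding uv closure_rows
      proof (intro allI impI)
        fix e :: real assume "e > 0"
        then obtain z where z: "(z, c') \<in> ?O" "\<bar>z - x'\<bar> < min e e0"
          using v e0(1) unfolding uv closure_rows by (meson min_less_iff_conj)
        \<comment> \<open>The sign undoes a possible reflection, so that \<open>x + t\<close> is the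
          preimage of \<open>z\<close>.\<close>
        define t where "t = (if c = c' then z - x' else - (z - x'))"
        have "T (x + t, c) = Some (z, c')" using e0(2)[of t] z by (auto simp: t_def)
        then have "(x + t, c) \<in> ?O" using orbit_invariant[OF p] z by blast
        then show "\<exists>x''. (x'', c) \<in> ?O \<and> \<bar>x'' - x\<bar> < e" using z by (intro exI[of _ "x + t"]) (auto simp: t_def)
      qed
    qed
    ultimately show ?thesis using T_in_phase[OF T] by blast
  qed
  ultimately show ?thesis unfolding invariant_open_def by blast
qed

text \<open>Pieces of a letter occurring twice in row \<open>c\<close> land in the other row after
  the exchange. This carries a property of one whole row to the other.\<close>

lemma row_exchange:
  assumes "c \<le> 1" obtains x x' where "T (x, c) = Some (x', 1 - c)"
proof -
  obtain i where i: "i \<in> row c" "\<sigma> i \<in> row c" using twice_in_row[OF assms] .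
  define x where "x = (pos c i + pos c (Suc i)) / 2"
  have "pos c i < x" "x < pos c (Suc i)" using pos_row_bounds[OF i(1)] by (auto simp: x_def)
  then show thesis using T_piece[OF assms assms i] that by blast
qed

text \<open>The complement of an orbit closure has no boundary, so in each row it is everything or
  nothing. It misses \<open>p\<close>, and \<open>row_exchange\<close> carries its emptiness to the
  other row.\<close>

theorem keane_imp_minimal:
  assumes K: "keane_property l m \<pi> len" shows "minimal_involution l m \<pi> len"
  unfolding minimal_involution_def
proof
  fix p assume p: "p \<in> X"
  let ?O = "two_sided_orbit l m \<pi> len p"
  let ?U = "X - closure ?O"
  have U: "invariant_open ?U" using p by (rule invariant_open_orbit)
  have no_boundary: False if "0 < w" "one_sided_at ?U w y" for w y
    using keane_one_sided_periodic[OF K U that] keane_no_periodic[OF K] that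
    unfolding one_sided_at_def by blast
  have full: "(x', c) \<in> ?U" if "(x, c) \<in> ?U" "(x', c) \<in> X" for x x' c
    using boundary_point[OF U that(1), of x'] that(2) no_boundary by blast
  have "iter 0 p = Some p" by simp
  then have pO: "p \<in> ?O" using p unfolding two_sided_orbit_def by blast
  then have p_notin: "p \<notin> ?U" using closure_subset[of ?O] by blast
  obtain x c where px: "p = (x, c)" by (cases p)
  have c: "c \<le> 1" using p px by (simp add: phase_iff)
  have "(y, c) \<notin> ?U" for y using full[of y c x] p p_notin px by blast
  moreover obtain y y' where T: "T (y, c) = Some (y', 1 - c)" using row_exchange[OF c] .
  ultimately have "(y', 1 - c) \<notin> ?U" using U unfolding invariant_open_def by blast
  then have "(z, 1 - c) \<notin> ?U" for z using full[of z "1 - c" y'] T_in_phase[OF T] by blast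
  then have "(z, c') \<notin> ?U" for z c'
    using \<open>\<And>y. (y, c) \<notin> ?U\<close> c by (cases "c' = c"; cases "c' = 1 - c") (auto simp: phase_iff)
  then show "X \<subseteq> closure ?O" by auto
qed

section \<open>Parameters that are not admissible\<close>

text \<open>Both rows under one index, so that switching top and bottom means replacing
  \<open>c\<close> by \<open>1 - c\<close>.\<close>

definition row_list :: "nat \<Rightarrow> 'a list" where
  "row_list c = map \<pi> [start c..<stop c]"

lemma top_row_eq: "top_row l \<pi> = row_list 0"
  by (simp add: top_row_def row_list_def start_def stop_def)

lemma bottom_row_eq: "bottom_row l m \<pi> = row_list 1"
  by (simp add: bottom_row_def row_list_def start_def stop_def)

text \<open>Replaces a list decomposition by two cut indices, whose positions become the endpoints
  of the invariant intervals.\<close>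

lemma corners_row_iff:
  "corners (row_list c) F v G \<longleftrightarrow>
     (\<exists>P Q. start c \<le> P \<and> P \<le> Q \<and> Q \<le> stop c \<and> v = map \<pi> [P..<Q] \<and>
        bij_betw \<pi> {start c..<P} F \<and> bij_betw \<pi> {Q..<stop c} G)"
proof
  assume "corners (row_list c) F v G"
  then obtain u w where uw: "row_list c = u @ v @ w" "mset u = mset_set F" "mset w = mset_set G"
    by (auto simp: corners_def)
  define P where "P = start c + length u"
  define Q where "Q = P + length v"
  have len_row: "stop c = Q + length w"
    using arg_cong[OF uw(1), of length] start_lt_stop[of c] by (simp add: row_list_def P_def Q_def)
  then have split: "[start c..<stop c] = [start c..<P] @ [P..<Q] @ [Q..<stop c]"
    using upt_add_eq_append[of "start c" P "length v + length w"] upt_add_eq_append[of P Q "length w"]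
    by (simp add: P_def Q_def add.assoc)
  have "u = map \<pi> [start c..<P] \<and> v = map \<pi> [P..<Q] \<and> w = map \<pi> [Q..<stop c]"
    using uw(1) unfolding row_list_def split map_append
    by (simp add: append_eq_append_conv P_def Q_def)
  then show "\<exists>P Q. start c \<le> P \<and> P \<le> Q \<and> Q \<le> stop c \<and> v = map \<pi> [P..<Q] \<and>
        bij_betw \<pi> {start c..<P} F \<and> bij_betw \<pi> {Q..<stop c} G"
    using uw(2,3) mset_map_upt_eq_mset_set[of F \<pi> "start c" P, OF finite]
      mset_map_upt_eq_mset_set[of G \<pi> Q "stop c", OF finite] len_row
    by (intro exI[of _ P] exI[of _ Q]) (simp add: P_def Q_def del: mset_map)
next
  assume "\<exists>P Q. start c \<le> P \<and> P \<le> Q \<and> Q \<le> stop c \<and> v = map \<pi> [P..<Q] \<and>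
        bij_betw \<pi> {start c..<P} F \<and> bij_betw \<pi> {Q..<stop c} G"
  then obtain P Q where PQ: "start c \<le> P" "P \<le> Q" "Q \<le> stop c" "v = map \<pi> [P..<Q]"
    "bij_betw \<pi> {start c..<P} F" "bij_betw \<pi> {Q..<stop c} G" by blast
  have "[start c..<stop c] = [start c..<P] @ [P..<Q] @ [Q..<stop c]"
    using PQ upt_add_eq_append[of "start c" P "stop c - P"] upt_add_eq_append[of P Q "stop c - Q"] by simp
  then have "row_list c = map \<pi> [start c..<P] @ v @ map \<pi> [Q..<stop c]"
    by (simp add: row_list_def PQ(4))
  then show "corners (row_list c) F v G" unfolding corners_def
    using PQ(5,6) mset_map_upt_eq_mset_set[of F \<pi> "start c" P, OF finite]
      mset_map_upt_eq_mset_set[of G \<pi> Q "stop c", OF finite] by blast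
qed

lemma row_unique: "c \<le> 1 \<Longrightarrow> c' \<le> 1 \<Longrightarrow> i \<in> row c \<Longrightarrow> i \<in> row c' \<Longrightarrow> c = c'"
  using row_component[of c i] row_component[of c' i] by simp

lemma row_disjoint: "c \<le> 1 \<Longrightarrow> i \<in> row c \<Longrightarrow> i \<notin> row (1 - c)"
proof
  assume c: "c \<le> 1" and "i \<in> row c" "i \<in> row (1 - c)"
  then have "c = 1 - c" using row_unique[of c "1 - c" i] by simp
  then show False by arith
qed

lemma count_row_list: "count_list (row_list c) a = card {i \<in> row c. \<pi> i = a}"
proof -
  have "count_list (map g [x..<y]) b = card {i \<in> {x..<y}. g i = b}" for g :: "nat \<Rightarrow> 'a" and x y b
  proof (induction y)
    case (Suc y)
    have "{i \<in> {x..<Suc y}. g i = b} =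
      (if x \<le> y \<and> g y = b then insert y {i \<in> {x..<y}. g i = b} else {i \<in> {x..<y}. g i = b})"
      by (auto simp: less_Suc_eq)
    then show ?case using Suc by simp
  qed simp
  then show ?thesis by (simp add: row_list_def row_eq)
qed

lemma labels_in_row:
  assumes "c \<le> 1" "i \<in> row c"
  shows "{k \<in> row c. \<pi> k = \<pi> i} = (if \<sigma> i \<in> row c then {i, \<sigma> i} else {i})"
    and "{k \<in> row (1 - c). \<pi> k = \<pi> i} = (if \<sigma> i \<in> row c then {} else {\<sigma> i})"
proof -
  have i: "i \<in> {1..l + m}" using assms row_component by blast
  have c: "c = 0 \<or> c = 1" using assms by auto
  have rows: "k \<in> {1..l + m} \<longleftrightarrow> k \<in> row c \<or> k \<in> row (1 - c)" "\<not> (k \<in> row c \<and> k \<in> row (1 - c))" for k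
    using c positions_eq rows_disjoint by auto
  have "{k \<in> {1..l + m}. \<pi> k = \<pi> i} = {i, \<sigma> i}" using fibre[OF i] by blast
  then have k: "(k \<in> row c \<or> k \<in> row (1 - c)) \<and> \<pi> k = \<pi> i \<longleftrightarrow> k = i \<or> k = \<sigma> i" for k
    using rows(1) by blast
  have "\<sigma> i \<in> row c \<or> \<sigma> i \<in> row (1 - c)" using k[of "\<sigma> i"] by blast
  moreover have "k \<in> row c \<and> \<pi> k = \<pi> i \<longleftrightarrow> (k = i \<or> k = \<sigma> i) \<and> k \<in> row c"
    "k \<in> row (1 - c) \<and> \<pi> k = \<pi> i \<longleftrightarrow> (k = i \<or> k = \<sigma> i) \<and> k \<in> row (1 - c)" for k
    using k[of k] by blast+
  ultimately show "{k \<in> row c. \<pi> k = \<pi> i} = (if \<sigma> i \<in> row c then {i, \<sigma> i} else {i})"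
    and "{k \<in> row (1 - c). \<pi> k = \<pi> i} = (if \<sigma> i \<in> row c then {} else {\<sigma> i})"
    using rows(2)[of i] rows(2)[of "\<sigma> i"] assms(2) by (auto simp del: One_nat_def)
qed

lemma partner_in_segment:
  assumes "bij_betw \<pi> {lo..<hi} F" "\<pi> i \<in> F" "i \<in> row c" "c \<le> 1"
    and "{lo..<hi} \<subseteq> row c'" "c' \<le> 1" "i \<notin> {lo..<hi}"
  shows "\<sigma> i \<in> {lo..<hi}"
proof -
  obtain k where k: "k \<in> {lo..<hi}" "\<pi> k = \<pi> i"
    using assms(1,2) unfolding bij_betw_def by (metis imageE)
  have "k \<in> {1..l + m}" "i \<in> {1..l + m}"
    using k assms row_component[of c'] row_component[of c] by blast+
  then have "k = \<sigma> i" using same_label[of i k] k assms by blast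
  then show ?thesis using k by simp
qed

lemma count_label:
  assumes "c \<le> 1" "i \<in> row c"
  shows "count_list (row_list c) (\<pi> i) = (if \<sigma> i \<in> row c then 2 else 1)"
    and "count_list (row_list (1 - c)) (\<pi> i) = (if \<sigma> i \<in> row c then 0 else 1)"
proof -
  have "\<sigma> i \<noteq> i" using partner_neq[of i] row_component[OF assms(1), of i] assms(2) by blast
  then show "count_list (row_list c) (\<pi> i) = (if \<sigma> i \<in> row c then 2 else 1)"
    unfolding count_row_list labels_in_row(1)[OF assms] by (cases "\<sigma> i \<in> row c") simp_all
  show "count_list (row_list (1 - c)) (\<pi> i) = (if \<sigma> i \<in> row c then 0 else 1)"
    unfolding count_row_list labels_in_row(2)[OF assms] by (cases "\<sigma> i \<in> row c") simp_all
qed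

lemma twice_in_row_list: "c \<le> 1 \<Longrightarrow> i \<in> row c \<Longrightarrow> \<pi> i \<in> twice_in (row_list c) \<longleftrightarrow> \<sigma> i \<in> row c"
  using count_label(1)[of c i] by (simp add: twice_in_def)

lemma once_in_each_row_list:
  "c \<le> 1 \<Longrightarrow> i \<in> row c \<Longrightarrow>
     \<pi> i \<in> once_in_each (row_list c) (row_list (1 - c)) \<longleftrightarrow> \<sigma> i \<notin> row c"
  using count_label(1)[of c i] count_label(2)[of c i] by (simp add: once_in_each_def split: if_splits)

lemma once_twice_disjoint:
  "once_in_each xs ys \<inter> twice_in xs = {}" "once_in_each xs ys \<inter> twice_in ys = {}"
  by (auto simp: once_in_each_def twice_in_def)

section \<open>Invariant sets obtained from corners\<close>

lemma pos_bij: "bij_betw \<pi> {start c..<P} F \<Longrightarrow> pos c P = (\<Sum>a\<in>F. len $ a)"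
  unfolding pos_def by (rule sum.reindex_bij_betw)

lemma pos_bij_right:
  assumes "bij_betw \<pi> {Q..<stop c} F" "start c \<le> Q" "Q \<le> stop c"
  shows "pos c Q = L - (\<Sum>a\<in>F. len $ a)"
proof -
  have "pos c (stop c) = pos c Q + (\<Sum>k\<in>{Q..<stop c}. len $ \<pi> k)"
    unfolding pos_def using assms by (simp add: sum.atLeastLessThan_concat)
  then show ?thesis using sum.reindex_bij_betw[OF assms(1), of "\<lambda>a. len $ a"] by (simp add: pos_stop)
qed

text \<open>The two-sided orbit of \<open>p\<close> stays in \<open>U\<close>, hence away from the
  interval of radius \<open>e\<close> around \<open>y\<close>.\<close>

lemma not_minimalI:
  assumes U: "p \<in> U" "U \<subseteq> X" and V: "(y, c) \<in> X" "0 < e" "\<And>x'. \<bar>x' - y\<bar> < e \<Longrightarrow> (x', c) \<notin> U"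
    and inv: "\<And>p q. T p = Some q \<Longrightarrow> p \<in> U \<longleftrightarrow> q \<in> U"
  shows "\<not> minimal_involution l m \<pi> len"
proof
  assume "minimal_involution l m \<pi> len"
  then have cl: "(y, c) \<in> closure (two_sided_orbit l m \<pi> len p)"
    using U V(1) unfolding minimal_involution_def by blast
  have inv_iter: "u \<in> U \<longleftrightarrow> v \<in> U" if "iter n u = Some v" for n u v
    using that
  proof (induction n arbitrary: v)
    case (Suc n)
    then obtain r where "iter n u = Some r" "T r = Some v" unfolding iter_Suc_iff by blast
    then show ?case using Suc.IH inv by blast
  qed simp
  have "two_sided_orbit l m \<pi> len p \<subseteq> U"
    unfolding two_sided_orbit_def using inv_iter U(1) by blast
  then show False using cl V unfolding closure_rows by blast
qed

text \<open>The left corners have the same total length \<open>x1\<close> in both rows, and each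
  piece of one has its partner in the other. So the strip to the left of \<open>x1\<close> is
  invariant.\<close>

lemma not_minimal_left:
  assumes A: "A \<subseteq> once_in_each (row_list 0) (row_list 1)" "A \<noteq> {}"
    and P: "\<And>c. c \<le> 1 \<Longrightarrow> start c \<le> P c \<and> P c \<le> stop c \<and> bij_betw \<pi> {start c..<P c} A"
  shows "\<not> minimal_involution l m \<pi> len"
proof -
  define x1 where "x1 = (\<Sum>a\<in>A. len $ a)"
  have x1: "pos c (P c) = x1" if "c \<le> 1" for c using P[OF that] pos_bij unfolding x1_def by blast
  have "0 < x1" unfolding x1_def by (rule sum_pos) (use A len_pos in auto)
  have left_partner: "\<sigma> i \<in> {start (1 - c)..<P (1 - c)}" if "c \<le> 1" "i \<in> row c" "i < P c" for i c
  proof (rule partner_in_segment[of _ _ A i c "1 - c"])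
    show "\<pi> i \<in> A" using P[OF that(1)] that by (auto simp: bij_betw_def row_eq)
    show seg: "{start (1 - c)..<P (1 - c)} \<subseteq> row (1 - c)" using P[of "1 - c"] by (auto simp: row_eq)
    show "i \<notin> {start (1 - c)..<P (1 - c)}" using seg row_disjoint[OF that(1,2)] by blast
    show "bij_betw \<pi> {start (1 - c)..<P (1 - c)} A" using P[of "1 - c"] by auto
  qed (use that in auto)
  have left_iff: "i < P c \<longleftrightarrow> \<sigma> i < P c'"
    if "c \<le> 1" "c' \<le> 1" "i \<in> row c" "\<sigma> i \<in> row c'" for i c c'
  proof -
    have inv: "\<sigma> (\<sigma> i) = i" using that row_component partner_partner by blast
    have other: "{start (1 - c)..<P (1 - c)} \<subseteq> row (1 - c)" for c :: nat using P[of "1 - c"] by (auto simp: row_eq)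
    show ?thesis
    proof
      assume "i < P c"
      then have s: "\<sigma> i \<in> {start (1 - c)..<P (1 - c)}" using left_partner that by blast
      then have "c' = 1 - c" using other[of c] that row_unique[of c' "1 - c" "\<sigma> i"] by auto
      then show "\<sigma> i < P c'" using s by simp
    next
      assume "\<sigma> i < P c'"
      then have s: "i \<in> {start (1 - c')..<P (1 - c')}" using left_partner[of c' "\<sigma> i"] that inv by simp
      then have "c = 1 - c'" using other[of c'] that row_unique[of c "1 - c'" i] by auto
      then show "i < P c" using s by simp
    qed
  qed
  define U where "U = {(x, c) \<in> X. x < x1}"
  have side: "x < x1 \<longleftrightarrow> i < P c"
    if "c \<le> 1" "i \<in> row c" "pos c i < x" "x < pos c (Suc i)" for x c i
    using that P[OF that(1)] x1[OF that(1)] pos_mono[of c "Suc i" "P c"] pos_mono[of c "P c" i]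
    by (cases "i < P c") (auto simp: row_eq)
  have inv: "p \<in> U \<longleftrightarrow> q \<in> U" if T: "T p = Some q" for p q
  proof -
    obtain x c where p: "p = (x, c)" by (cases p)
    from T[unfolded p] obtain i c' where h: "c \<le> 1" "c' \<le> 1" "i \<in> row c" "\<sigma> i \<in> row c'"
      "pos c i < x" "x < pos c (Suc i)" and q: "q = (image_point c c' i x, 1 - c')"
      by (rule T_SomeD)
    have "i < P c \<longleftrightarrow> \<sigma> i < P c'" using left_iff[OF h(1-4)] .
    then show ?thesis using side[OF h(1,3,5,6)] side[OF h(2,4)] partner_image[OF h] T_in_phase[OF T]
      by (auto simp: U_def p q)
  qed
  obtain i where i: "i \<in> row 0" "\<sigma> i \<in> row 0" using twice_in_row[of 0] by auto
  \<comment> \<open>If \<open>A\<close> filled the top row, no letter could occur twice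
    there.\<close>
  have "x1 < L"
  proof (rule ccontr)
    assume "\<not> x1 < L"
    then have "P 0 = stop 0"
      using P[of 0] x1[of 0] pos_stop[of 0] pos_less[of 0 "P 0" "stop 0"] by force
    then have "\<pi> i \<in> A" using P[of 0] i by (auto simp: bij_betw_def row_eq)
    moreover have "\<pi> i \<in> twice_in (row_list 0)" using i twice_in_row_list[of 0 i] by simp
    ultimately show False using A(1) once_twice_disjoint(1) by (metis disjoint_iff subsetD)
  qed
  show ?thesis
  proof (rule not_minimalI[OF _ _ _ _ _ inv])
    show "(x1 / 2, 0) \<in> U" "U \<subseteq> X" using \<open>0 < x1\<close> \<open>x1 < L\<close> by (auto simp: U_def phase_iff)
    show "((x1 + L) / 2, 0) \<in> X" "0 < (L - x1) / 2"
      using \<open>0 < x1\<close> \<open>x1 < L\<close> by (auto simp: phase_iff)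
    show "(x', 0) \<notin> U" if "\<bar>x' - (x1 + L) / 2\<bar> < (L - x1) / 2" for x'
    proof -
      have "\<not> x' < x1" using that by (simp add: abs_less_iff field_simps)
      then show ?thesis by (simp add: U_def)
    qed
  qed
qed

text \<open>Mirror image of \<open>not_minimal_left\<close>, with the strip to the right of
  \<open>x2\<close>.\<close>

lemma not_minimal_right:
  assumes A: "D \<subseteq> once_in_each (row_list 0) (row_list 1)" "D \<noteq> {}"
    and P: "\<And>c. c \<le> 1 \<Longrightarrow> start c \<le> Q c \<and> Q c \<le> stop c \<and> bij_betw \<pi> {Q c..<stop c} D"
  shows "\<not> minimal_involution l m \<pi> len"
proof -
  define x2 where "x2 = L - (\<Sum>a\<in>D. len $ a)"
  have x2: "pos c (Q c) = x2" if "c \<le> 1" for c using P[OF that] pos_bij_right unfolding x2_def by blast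
  have "0 < (\<Sum>a\<in>D. len $ a)" by (rule sum_pos) (use A len_pos in auto)
  then have "x2 < L" by (simp add: x2_def)
  have right_partner: "\<sigma> i \<in> {Q (1 - c)..<stop (1 - c)}" if "c \<le> 1" "i \<in> row c" "Q c \<le> i" for i c
  proof (rule partner_in_segment[of _ _ D i c "1 - c"])
    show "\<pi> i \<in> D" using P[OF that(1)] that by (auto simp: bij_betw_def row_eq)
    show seg: "{Q (1 - c)..<stop (1 - c)} \<subseteq> row (1 - c)" using P[of "1 - c"] by (auto simp: row_eq)
    show "i \<notin> {Q (1 - c)..<stop (1 - c)}" using seg row_disjoint[OF that(1,2)] by blast
    show "bij_betw \<pi> {Q (1 - c)..<stop (1 - c)} D" using P[of "1 - c"] by auto
  qed (use that in auto)
  have right_iff: "Q c \<le> i \<longleftrightarrow> Q c' \<le> \<sigma> i"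
    if "c \<le> 1" "c' \<le> 1" "i \<in> row c" "\<sigma> i \<in> row c'" for i c c'
  proof -
    have inv: "\<sigma> (\<sigma> i) = i" using that row_component partner_partner by blast
    have other: "{Q (1 - c)..<stop (1 - c)} \<subseteq> row (1 - c)" for c :: nat using P[of "1 - c"] by (auto simp: row_eq)
    show ?thesis
    proof
      assume "Q c \<le> i"
      then have s: "\<sigma> i \<in> {Q (1 - c)..<stop (1 - c)}" using right_partner that by blast
      then have "c' = 1 - c" using other[of c] that row_unique[of c' "1 - c" "\<sigma> i"] by auto
      then show "Q c' \<le> \<sigma> i" using s by simp
    next
      assume "Q c' \<le> \<sigma> i"
      then have s: "i \<in> {Q (1 - c')..<stop (1 - c')}" using right_partner[of c' "\<sigma> i"] that inv by simp
      then have "c = 1 - c'" using other[of c'] that row_unique[of c "1 - c'" i] by auto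
      then show "Q c \<le> i" using s by simp
    qed
  qed
  define U where "U = {(x, c) \<in> X. x2 < x}"
  have side: "x2 < x \<longleftrightarrow> Q c \<le> i"
    if "c \<le> 1" "i \<in> row c" "pos c i < x" "x < pos c (Suc i)" for x c i
    using that P[OF that(1)] x2[OF that(1)] pos_mono[of c "Suc i" "Q c"] pos_mono[of c "Q c" i]
    by (cases "i < Q c") (auto simp: row_eq)
  have inv: "p \<in> U \<longleftrightarrow> q \<in> U" if T: "T p = Some q" for p q
  proof -
    obtain x c where p: "p = (x, c)" by (cases p)
    from T[unfolded p] obtain i c' where h: "c \<le> 1" "c' \<le> 1" "i \<in> row c" "\<sigma> i \<in> row c'"
      "pos c i < x" "x < pos c (Suc i)" and q: "q = (image_point c c' i x, 1 - c')"
      by (rule T_SomeD)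
    have "Q c \<le> i \<longleftrightarrow> Q c' \<le> \<sigma> i" using right_iff[OF h(1-4)] .
    then show ?thesis using side[OF h(1,3,5,6)] side[OF h(2,4)] partner_image[OF h] T_in_phase[OF T]
      by (auto simp: U_def p q)
  qed
  obtain i where i: "i \<in> row 0" "\<sigma> i \<in> row 0" using twice_in_row[of 0] by auto
  have "0 < x2"
  proof (rule ccontr)
    assume "\<not> 0 < x2"
    then have "Q 0 = start 0"
      using P[of 0] x2[of 0] pos_less[of 0 "start 0" "Q 0"] by force
    then have "\<pi> i \<in> D" using P[of 0] i by (auto simp: bij_betw_def row_eq)
    moreover have "\<pi> i \<in> twice_in (row_list 0)" using i twice_in_row_list[of 0 i] by simp
    ultimately show False using A(1) once_twice_disjoint(1) by (metis disjoint_iff subsetD)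
  qed
  show ?thesis
  proof (rule not_minimalI[OF _ _ _ _ _ inv])
    show "((x2 + L) / 2, 0) \<in> U" "U \<subseteq> X" using \<open>0 < x2\<close> \<open>x2 < L\<close> by (auto simp: U_def phase_iff)
    show "(x2 / 2, 0) \<in> X" "0 < x2 / 2"
      using \<open>0 < x2\<close> \<open>x2 < L\<close> by (auto simp: phase_iff)
    show "(x', 0) \<notin> U" if "\<bar>x' - x2 / 2\<bar> < x2 / 2" for x'
    proof -
      have "\<not> x2 < x'" using that by (simp add: abs_less_iff field_simps)
      then show ?thesis by (simp add: U_def)
    qed
  qed
qed

text \<open>Covers both the third decomposition of type (a), where the middles are empty, and type
  (b). The invariant set joins the part of row \<open>c\<close> before \<open>x1\<close> with the
  part of row \<open>c'\<close> beyond \<open>x2\<close>. The inequalities of type (b) appear in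
  \<open>le\<close> and \<open>mid\<close>; the last equation of \<open>mid\<close> centres the
  reflection of the exceptional letter at the midpoint of \<open>x1\<close> and
  \<open>x2\<close>.\<close>

lemma not_minimal_cross:
  assumes c: "c \<le> 1" "c' = 1 - c"
    and PQ: "start c \<le> P" "P \<le> Q" "Q \<le> stop c" "start c' \<le> P'" "P' \<le> Q'" "Q' \<le> stop c'"
    and bij: "bij_betw \<pi> {start c..<P} (A \<union> B)" "bij_betw \<pi> {Q..<stop c} (B \<union> D)"
      "bij_betw \<pi> {start c'..<P'} (A \<union> C)" "bij_betw \<pi> {Q'..<stop c'} (C \<union> D)"
    and le: "pos c' P' \<le> pos c P" "pos c Q \<le> pos c' Q'"
    and proper: "start c < P" "P < stop c"
    and mid: "P' < Q' \<Longrightarrow> \<sigma> P' = Q' - 1 \<and> pos c P \<le> pos c' (Suc P') \<and> pos c' (Q' - 1) \<le> pos c Q \<and>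
                pos c' P' + pos c' Q' = pos c P + pos c Q"
  shows "\<not> minimal_involution l m \<pi> len"
proof -
  have c': "c' \<le> 1" "c \<noteq> c'" "1 - c' = c" using c by arith+
  define x1 where "x1 = pos c P"
  define x2 where "x2 = pos c Q"
  define U where "U = {(x, e) \<in> X. e = c \<and> x < x1 \<or> e = c' \<and> x2 < x}"
  have x12: "0 < x1" "x1 \<le> x2" "x1 < L"
    using pos_less[of c "start c" P] pos_mono[of c P Q] pos_less[of c P "stop c"] PQ proper
    by (auto simp: x1_def x2_def pos_stop)
  have segs: "{start c..<P} \<subseteq> row c" "{Q..<stop c} \<subseteq> row c" "{start c'..<P'} \<subseteq> row c'"
    "{Q'..<stop c'} \<subseteq> row c'" using PQ by (auto simp: row_eq)
  have other: "i \<notin> row c'" if "i \<in> row c" for i using row_unique[OF c(1) c'(1) that] c' by blast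
  have other': "i \<notin> row c" if "i \<in> row c'" for i using row_unique[OF c(1) c'(1) _ that] c' by blast
  \<comment> \<open>Before rows are exchanged, \<open>A\<close> leads from the left of
    \<open>c\<close> to the left of \<open>c'\<close>, \<open>B\<close> from the left to the right
    of \<open>c\<close>, \<open>C\<close> from the right to the left of \<open>c'\<close>, and
    \<open>D\<close> from the right of \<open>c'\<close> to the right of \<open>c\<close>. So the
    pieces \<open>inn\<close>, contained in \<open>U\<close>, go to the pieces \<open>out\<close>,
    contained in the image of \<open>U\<close> under \<open>f\<close>.\<close>
  define inn where "inn i \<longleftrightarrow> i \<in> {start c..<P} \<or> i \<in> {Q'..<stop c'}" for i
  define out where "out i \<longleftrightarrow> i \<in> {start c'..<P'} \<or> i \<in> {Q..<stop c}" for i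
  have inn_row: "i \<in> row c \<Longrightarrow> inn i \<longleftrightarrow> i < P" "i \<in> row c' \<Longrightarrow> inn i \<longleftrightarrow> Q' \<le> i" for i
    using segs other[of i] other'[of i] by (auto simp: inn_def row_eq)
  have out_row: "i \<in> row c \<Longrightarrow> out i \<longleftrightarrow> Q \<le> i" "i \<in> row c' \<Longrightarrow> out i \<longleftrightarrow> i < P'" for i
    using segs other[of i] other'[of i] by (auto simp: out_def row_eq)
  have inn_out: "out (\<sigma> i)" if "inn i" for i
  proof -
    from that consider (l) "i \<in> {start c..<P}" | (r) "i \<in> {Q'..<stop c'}" unfolding inn_def by blast
    then show ?thesis
    proof cases
      case l
      have ir: "i \<in> row c" using segs(1) l by blast
      have lab: "\<pi> i \<in> A \<union> B" using bij_betwE[OF bij(1)] l by blast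
      have n: "i \<notin> {start c'..<P'}" "i \<notin> {Q..<stop c}" using segs other[OF ir] l PQ by auto
      show ?thesis
        using lab partner_in_segment[OF bij(3) _ ir c(1) segs(3) c'(1) n(1)]
          partner_in_segment[OF bij(2) _ ir c(1) segs(2) c(1) n(2)]
        unfolding out_def by blast
    next
      case r
      have ir: "i \<in> row c'" using segs(4) r by blast
      have lab: "\<pi> i \<in> C \<union> D" using bij_betwE[OF bij(4)] r by blast
      have n: "i \<notin> {start c'..<P'}" "i \<notin> {Q..<stop c}" using segs other'[OF ir] r PQ by auto
      show ?thesis
        using lab partner_in_segment[OF bij(3) _ ir c'(1) segs(3) c'(1) n(1)]
          partner_in_segment[OF bij(2) _ ir c'(1) segs(2) c(1) n(2)]
        unfolding out_def by blast
    qed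
  qed
  have out_inn: "inn (\<sigma> i)" if "out i" for i
  proof -
    from that consider (l) "i \<in> {start c'..<P'}" | (r) "i \<in> {Q..<stop c}" unfolding out_def by blast
    then show ?thesis
    proof cases
      case l
      have ir: "i \<in> row c'" using segs(3) l by blast
      have lab: "\<pi> i \<in> A \<union> C" using bij_betwE[OF bij(3)] l by blast
      have n: "i \<notin> {start c..<P}" "i \<notin> {Q'..<stop c'}" using segs other'[OF ir] l PQ by auto
      show ?thesis
        using lab partner_in_segment[OF bij(1) _ ir c'(1) segs(1) c(1) n(1)]
          partner_in_segment[OF bij(4) _ ir c'(1) segs(4) c'(1) n(2)]
        unfolding inn_def by blast
    next
      case r
      have ir: "i \<in> row c" using segs(2) r by blast
      have lab: "\<pi> i \<in> B \<union> D" using bij_betwE[OF bij(2)] r by blast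
      have n: "i \<notin> {start c..<P}" "i \<notin> {Q'..<stop c'}" using segs other[OF ir] r PQ by auto
      show ?thesis
        using lab partner_in_segment[OF bij(1) _ ir c(1) segs(1) c(1) n(1)]
          partner_in_segment[OF bij(4) _ ir c(1) segs(4) c'(1) n(2)]
        unfolding inn_def by blast
    qed
  qed
  have sp: "\<sigma> P' = Q' - 1" "\<sigma> (Q' - 1) = P'" "P' \<in> row c'" "Q' - 1 \<in> row c'" "Suc P' \<le> Q' - 1"
    "x1 \<le> pos c' (Suc P')" "pos c' (Q' - 1) \<le> x2" "pos c' P' + pos c' Q' = x1 + x2"
    if lt: "P' < Q'"
  proof -
    show M: "\<sigma> P' = Q' - 1" "x1 \<le> pos c' (Suc P')" "pos c' (Q' - 1) \<le> x2"
      "pos c' P' + pos c' Q' = x1 + x2" using mid[OF lt] by (simp_all add: x1_def x2_def)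
    show rows: "P' \<in> row c'" "Q' - 1 \<in> row c'" using PQ lt by (auto simp: row_eq)
    then have P': "P' \<in> {1..l + m}" using row_component[OF c'(1), of P'] by blast
    show "\<sigma> (Q' - 1) = P'" using partner_partner[OF P'] M(1) by simp
    show "Suc P' \<le> Q' - 1" using partner_neq[OF P'] M(1) lt by simp
  qed
  have inv: "p \<in> U \<longleftrightarrow> q \<in> U" if T: "T p = Some q" for p q
  proof -
    obtain x e where p: "p = (x, e)" by (cases p)
    from T[unfolded p] obtain i e' where h: "e \<le> 1" "e' \<le> 1" "i \<in> row e" "\<sigma> i \<in> row e'"
      "pos e i < x" "x < pos e (Suc i)" and q: "q = (image_point e e' i x, 1 - e')"
      by (rule T_SomeD)
    define y where "y = image_point e e' i x"
    define j where "j = \<sigma> i"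
    have y: "pos e' j < y" "y < pos e' (Suc j)" using partner_image[OF h] by (auto simp: y_def j_def)
    have inv_j: "\<sigma> j = i" using h row_component partner_partner by (auto simp: j_def)
    have j: "j \<in> row e'" using h by (simp add: j_def)
    have e: "e = c \<or> e = c'" "e' = c \<or> e' = c'" using h(1,2) c by auto
    have pU: "p \<in> U \<longleftrightarrow> e = c \<and> x < x1 \<or> e = c' \<and> x2 < x" using T_in_phase[OF T] by (auto simp: U_def p)
    have qU: "q \<in> U \<longleftrightarrow> e' = c' \<and> y < x1 \<or> e' = c \<and> x2 < y"
      using T_in_phase[OF T] e c c' by (auto simp: U_def q y_def)
    have fst_inn: "e = c \<and> x < x1 \<or> e = c' \<and> x2 < x"
      if "inn i" "i \<in> row e" "pos e i < x" "x < pos e (Suc i)" "e = c \<or> e = c'" for i x e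
      using that inn_row[of i] PQ le pos_mono[of c "Suc i" P] pos_mono[of c' Q' i]
      by (auto simp: row_eq x1_def x2_def)
    have fst_out: "e = c' \<and> x < x1 \<or> e = c \<and> x2 < x"
      if "out i" "i \<in> row e" "pos e i < x" "x < pos e (Suc i)" "e = c \<or> e = c'" for i x e
      using that out_row[of i] PQ le pos_mono[of c' "Suc i" P'] pos_mono[of c Q i]
      by (auto simp: row_eq x1_def x2_def)
    consider "inn i" | "out i" | "\<not> inn i" "\<not> out i" by blast
    then show ?thesis
    proof cases
      case 1
      then have "out j" using inn_out by (simp add: j_def)
      then show ?thesis using pU qU fst_inn[OF 1 h(3,5,6) e(1)] fst_out[OF _ j y e(2)] by blast
    next
      case 2
      then have "inn j" using out_inn by (simp add: j_def)
      then show ?thesis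
        using pU qU fst_out[OF 2 h(3,5,6) e(1)] fst_inn[OF _ j y e(2)] x12 c' by fastforce
    next
      case 3
      then have 4: "\<not> inn j" "\<not> out j" using inn_out[of j] out_inn[of j] inv_j by auto
      have mid_row: "x1 < x \<and> x < x2"
        if "\<not> inn i" "\<not> out i" "i \<in> row c" "pos c i < x" "x < pos c (Suc i)" for i x
        using that inn_row[of i] out_row[of i] PQ pos_mono[of c P i] pos_mono[of c "Suc i" Q]
        by (auto simp: row_eq x1_def x2_def)
      have mid_row': "x1 < x \<and> x < x2 \<or> i = P' \<and> P' < Q' \<or> i = Q' - 1 \<and> P' < Q'"
        if "\<not> inn i" "\<not> out i" "i \<in> row c'" "pos c' i < x" "x < pos c' (Suc i)" for i x
      proof (cases "i = P' \<or> i = Q' - 1")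
        case True
        then show ?thesis using that inn_row[of i] out_row[of i] by (auto simp: row_eq)
      next
        case False
        then have "P' < i" "Suc i \<le> Q' - 1" using that inn_row[of i] out_row[of i] by auto
        moreover from this have "P' < Q'" by simp
        ultimately show ?thesis
          using that sp(6,7) pos_mono[of c' "Suc P'" i] pos_mono[of c' "Suc i" "Q' - 1"] PQ by fastforce
      qed
      show ?thesis
      \<comment> \<open>In row \<open>c'\<close> the corners may stop short of \<open>x1\<close> and
        \<open>x2\<close>; the missing parts of \<open>U\<close> and of its image under
        \<open>f\<close> lie in the pieces of the exceptional letter.\<close>
      proof (cases "e = c' \<and> (i = P' \<or> i = Q' - 1) \<and> P' < Q'")
        case True
        then have eP: "e = c'" "P' < Q'" by simp_all
        then have ij: "i = P' \<and> j = Q' - 1 \<or> i = Q' - 1 \<and> j = P'"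
          using True sp(1,2) by (auto simp: j_def)
        then have e': "e' = c'" using j sp(3,4) eP row_unique[OF h(2) c'(1)] by blast
        have "len $ \<pi> j = len $ \<pi> i" using label_partner[of i] row_component[OF h(1), of i] h(3) by (simp add: j_def)
        then have "x + y = pos c' i + pos c' (Suc j)"
          using pos_Suc[of c' i] pos_Suc[of c' j] h(3) j eP e' by (simp add: y_def image_point_def j_def row_eq)
        moreover have "Suc (Q' - 1) = Q'" using eP by simp
        ultimately have xy: "x + y = x1 + x2 \<or> x + y = pos c' (Q' - 1) + pos c' (Suc P')"
          using ij sp(8) eP by auto
        have "pos c' (Q' - 1) + pos c' (Suc P') = pos c' P' + pos c' Q'"
          using pos_Suc[of c' P'] pos_Suc[of c' "Q' - 1"] \<open>len $ \<pi> j = len $ \<pi> i\<close> ij eP PQ by auto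
        \<comment> \<open>The centre is the same whichever of the two pieces contains
          \<open>x\<close>. The reflection exchanges points beyond \<open>x2\<close> with points
          before \<open>x1\<close>.\<close>
        then have xy: "x + y = x1 + x2" using xy sp(8) eP by auto
        have "pos c' (Suc P') \<le> pos c' (Q' - 1)" using PQ sp(5) eP by (intro pos_mono) auto
        show ?thesis using pU qU eP e' xy c' by auto
      next
        case False
        have special: "j = P' \<or> j = Q' - 1 \<Longrightarrow> P' < Q' \<Longrightarrow> e' = c' \<Longrightarrow> e = c' \<and> (i = P' \<or> i = Q' - 1)"
        proof -
          assume a: "j = P' \<or> j = Q' - 1" "P' < Q'" "e' = c'"
          then have "i = P' \<or> i = Q' - 1" using sp(1,2) inv_j by auto
          then show ?thesis using a sp(3,4) h(3) row_unique[OF h(1) c'(1)] by blast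
        qed
        have "\<not> (e = c \<and> x < x1 \<or> e = c' \<and> x2 < x)"
          using e(1) mid_row[of i x] mid_row'[of i x] 3 h False c' by auto
        moreover have "\<not> (e' = c' \<and> y < x1 \<or> e' = c \<and> x2 < y)"
          using e(2) mid_row[of j y] mid_row'[of j y] 4 j y False special c' by auto
        ultimately show ?thesis using pU qU by blast
      qed
    qed
  qed
  show ?thesis
  proof (rule not_minimalI[OF _ _ _ _ _ inv])
    show "(x1 / 2, c) \<in> U" "U \<subseteq> X" using x12 c by (auto simp: U_def phase_iff)
    show "((x1 + L) / 2, c) \<in> X" "0 < (L - x1) / 2" using x12 c by (auto simp: phase_iff)
    show "(x', c) \<notin> U" if "\<bar>x' - (x1 + L) / 2\<bar> < (L - x1) / 2" for x'
    proof -
      have "\<not> x' < x1" using that by (simp add: abs_less_iff field_simps)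
      then show ?thesis using c' by (simp add: U_def)
    qed
  qed
qed

lemma sum_Un_once_twice:
  assumes "A \<subseteq> once_in_each xs ys" "B \<subseteq> twice_in xs \<or> B \<subseteq> twice_in ys"
  shows "(\<Sum>a\<in>A \<union> B. len $ a) = (\<Sum>a\<in>A. len $ a) + (\<Sum>a\<in>B. len $ a)"
  by (rule sum.union_disjoint) (use assms once_twice_disjoint[of xs ys] in auto)

lemma reducible_a_not_minimal:
  assumes "reducible_a (row_list 0) (row_list 1)"
  shows "\<not> minimal_involution l m \<pi> len"
proof -
  let ?O = "once_in_each (row_list 0) (row_list 1)"
  let ?B = "twice_in (row_list 0)"
  let ?C = "twice_in (row_list 1)"
  consider
    (left) A v v' where "A \<subseteq> ?O" "A \<noteq> {}" "corners (row_list 0) A v {}" "corners (row_list 1) A v' {}"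
  | (right) D v v' where "D \<subseteq> ?O" "D \<noteq> {}" "corners (row_list 0) {} v D" "corners (row_list 1) {} v' D"
  | (cross) A D where "A \<subseteq> ?O" "D \<subseteq> ?O" "corners (row_list 0) (A \<union> ?B) [] (D \<union> ?B)"
      "corners (row_list 1) (A \<union> ?C) [] (D \<union> ?C)"
    using assms unfolding reducible_a_def by (elim disjE exE conjE) (erule (3) that)+
  then show ?thesis
  proof cases
    case left
    then obtain P0 P1 where "start 0 \<le> P0 \<and> P0 \<le> stop 0 \<and> bij_betw \<pi> {start 0..<P0} A"
      "start 1 \<le> P1 \<and> P1 \<le> stop 1 \<and> bij_betw \<pi> {start 1..<P1} A"
      unfolding corners_row_iff by (meson order_trans)
    then show ?thesis
      by (intro not_minimal_left[OF left(1,2), of "\<lambda>c. if c = 0 then P0 else P1"]) (auto simp: le_Suc_eq)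
  next
    case right
    then obtain Q0 Q1 where "start 0 \<le> Q0 \<and> Q0 \<le> stop 0 \<and> bij_betw \<pi> {Q0..<stop 0} D"
      "start 1 \<le> Q1 \<and> Q1 \<le> stop 1 \<and> bij_betw \<pi> {Q1..<stop 1} D"
      unfolding corners_row_iff by (meson order_trans)
    then show ?thesis
      by (intro not_minimal_right[OF right(1,2), of "\<lambda>c. if c = 0 then Q0 else Q1"]) (auto simp: le_Suc_eq)
  next
    case cross
    obtain P Q where PQ: "start 0 \<le> P" "P \<le> Q" "Q \<le> stop 0" "[] = map \<pi> [P..<Q]"
      "bij_betw \<pi> {start 0..<P} (A \<union> ?B)" "bij_betw \<pi> {Q..<stop 0} (D \<union> ?B)"
      using cross(3) unfolding corners_row_iff by blast
    obtain P' Q' where PQ': "start 1 \<le> P'" "P' \<le> Q'" "Q' \<le> stop 1" "[] = map \<pi> [P'..<Q']"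
      "bij_betw \<pi> {start 1..<P'} (A \<union> ?C)" "bij_betw \<pi> {Q'..<stop 1} (D \<union> ?C)"
      using cross(4) unfolding corners_row_iff by blast
    have eq: "Q = P" "Q' = P'" using PQ PQ' by auto
    have sums: "(\<Sum>a\<in>A \<union> ?B. len $ a) = (\<Sum>a\<in>A. len $ a) + (\<Sum>a\<in>?B. len $ a)"
      "(\<Sum>a\<in>A \<union> ?C. len $ a) = (\<Sum>a\<in>A. len $ a) + (\<Sum>a\<in>?C. len $ a)"
      "(\<Sum>a\<in>D \<union> ?B. len $ a) = (\<Sum>a\<in>D. len $ a) + (\<Sum>a\<in>?B. len $ a)"
      "(\<Sum>a\<in>D \<union> ?C. len $ a) = (\<Sum>a\<in>D. len $ a) + (\<Sum>a\<in>?C. len $ a)"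
      using sum_Un_once_twice cross by blast+
    \<comment> \<open>Measured from the left the cut is \<open>A\<close> plus the doubled letters;
      measured from the right it is \<open>L\<close> minus \<open>D\<close> minus the same doubled
      letters. Adding the two cancels the doubled letters, so both rows are cut at one
      point.\<close>
    have same: "pos 1 P' = pos 0 P"
      using pos_bij[OF PQ(5)] pos_bij_right[OF PQ(6)] pos_bij[OF PQ'(5)] pos_bij_right[OF PQ'(6)]
        PQ PQ' eq sums by simp
    obtain i where i: "i \<in> row 0" "\<sigma> i \<in> row 0" using twice_in_row[of 0] by auto
    then have "\<pi> i \<in> ?B" using twice_in_row_list[of 0 i] by simp
    then have "{start 0..<P} \<noteq> {}" "{Q..<stop 0} \<noteq> {}"
      using PQ(5,6) unfolding bij_betw_def by (metis UnI2 empty_iff image_empty)+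
    then have proper: "start 0 < P" "P < stop 0" using eq by auto
    show ?thesis
      by (rule not_minimal_cross[of 0 1 P Q P' Q' A ?B D ?C])
        (use PQ PQ' eq same proper in \<open>auto simp: Un_commute\<close>)
  qed
qed

lemma reducible_b_not_minimal:
  assumes c: "c \<le> 1" and "reducible_b len (row_list c) (row_list (1 - c))"
  shows "\<not> minimal_involution l m \<pi> len"
proof -
  let ?c = "1 - c"
  have c': "?c \<le> 1" by simp
  obtain a0 A B C D v v' where AD: "A \<subseteq> once_in_each (row_list c) (row_list ?c)"
      "D \<subseteq> once_in_each (row_list c) (row_list ?c)"
    and BC: "B \<noteq> {}" "B \<subseteq> twice_in (row_list c)" "C \<subseteq> twice_in (row_list ?c)"
    and cor: "corners (row_list c) (A \<union> B) v (B \<union> D)"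
      "corners (row_list ?c) (A \<union> C) ([a0] @ v' @ [a0]) (C \<union> D)"
    and ineq: "(\<Sum>a\<in>C. len $ a) \<le> (\<Sum>a\<in>B. len $ a)"
      "(\<Sum>a\<in>B. len $ a) \<le> len $ a0 + (\<Sum>a\<in>C. len $ a)"
    using assms(2) unfolding reducible_b_def by blast
  obtain P Q where PQ: "start c \<le> P" "P \<le> Q" "Q \<le> stop c"
    "bij_betw \<pi> {start c..<P} (A \<union> B)" "bij_betw \<pi> {Q..<stop c} (B \<union> D)"
    using cor(1) unfolding corners_row_iff by blast
  obtain P' Q' where PQ': "start ?c \<le> P'" "P' \<le> Q'" "Q' \<le> stop ?c" "[a0] @ v' @ [a0] = map \<pi> [P'..<Q']"
    "bij_betw \<pi> {start ?c..<P'} (A \<union> C)" "bij_betw \<pi> {Q'..<stop ?c} (C \<union> D)"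
    using cor(2) unfolding corners_row_iff by blast
  \<comment> \<open>The block has at least two entries, so its ends are different positions with the
    same letter, that is, partners.\<close>
  have "length ([a0] @ v' @ [a0]) = Q' - P'" unfolding PQ'(4) by simp
  then have lt: "Suc P' < Q'" by simp
  have "hd ([a0] @ v' @ [a0]) = \<pi> P'" unfolding PQ'(4) using lt by (simp add: hd_map)
  moreover have "last ([a0] @ v' @ [a0]) = \<pi> (Q' - 1)" unfolding PQ'(4) using lt by (simp add: last_map)
  ultimately have a0: "\<pi> P' = a0" "\<pi> (Q' - 1) = a0" by simp_all
  have "P' \<in> row ?c" "Q' - 1 \<in> row ?c" using lt PQ' by (auto simp: row_eq)
  then have "P' \<in> {1..l + m}" "Q' - 1 \<in> {1..l + m}" using row_component[OF c'] by blast+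
  then have partner: "\<sigma> P' = Q' - 1" using same_label[of P' "Q' - 1"] a0 lt by simp
  have sums: "(\<Sum>a\<in>A \<union> B. len $ a) = (\<Sum>a\<in>A. len $ a) + (\<Sum>a\<in>B. len $ a)"
    "(\<Sum>a\<in>A \<union> C. len $ a) = (\<Sum>a\<in>A. len $ a) + (\<Sum>a\<in>C. len $ a)"
    "(\<Sum>a\<in>D \<union> B. len $ a) = (\<Sum>a\<in>D. len $ a) + (\<Sum>a\<in>B. len $ a)"
    "(\<Sum>a\<in>D \<union> C. len $ a) = (\<Sum>a\<in>D. len $ a) + (\<Sum>a\<in>C. len $ a)"
    using sum_Un_once_twice AD BC by blast+
  have p: "pos c P = (\<Sum>a\<in>A. len $ a) + (\<Sum>a\<in>B. len $ a)"
    "pos c Q = L - ((\<Sum>a\<in>D. len $ a) + (\<Sum>a\<in>B. len $ a))"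
    "pos ?c P' = (\<Sum>a\<in>A. len $ a) + (\<Sum>a\<in>C. len $ a)"
    "pos ?c Q' = L - ((\<Sum>a\<in>D. len $ a) + (\<Sum>a\<in>C. len $ a))"
    using pos_bij[OF PQ(4)] pos_bij_right[OF PQ(5)] pos_bij[OF PQ'(5)] pos_bij_right[OF PQ'(6)]
      PQ PQ' sums by (simp_all add: Un_commute)
  have s: "pos ?c (Suc P') = pos ?c P' + len $ a0" "pos ?c Q' = pos ?c (Q' - 1) + len $ a0"
    using pos_Suc[of ?c P'] pos_Suc[of ?c "Q' - 1"] a0 PQ' lt by auto
  have "{start c..<P} \<noteq> {}" "{Q..<stop c} \<noteq> {}"
    using PQ(4,5) BC(1) unfolding bij_betw_def by auto
  then have proper: "start c < P" "P < stop c" using PQ by auto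
  show ?thesis
    by (rule not_minimal_cross[OF c refl PQ(1-3) PQ'(1-3) PQ(4,5) PQ'(5,6)])
      (use p s ineq partner proper in auto)
qed

lemma not_admissible_not_minimal:
  assumes "len \<notin> admissible_parameters l m \<pi>"
  shows "\<not> minimal_involution l m \<pi> len"
proof -
  consider "reducible_a (row_list 0) (row_list 1)" | "reducible_b len (row_list 0) (row_list 1)"
    | "reducible_b len (row_list 1) (row_list 0)"
    using assms len unfolding admissible_parameters_def top_row_eq bottom_row_eq by blast
  then show ?thesis
    using reducible_a_not_minimal reducible_b_not_minimal[of 0] reducible_b_not_minimal[of 1]
    by cases auto
qed

section \<open>Labels, offsets and impossible returns\<close>

lemma bij_betw_labels:
  assumes "c \<le> 1" "S \<subseteq> row c" "\<And>i. i \<in> S \<Longrightarrow> \<sigma> i \<notin> S" "\<pi> ` S = F"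
  shows "bij_betw \<pi> S F"
proof -
  have "inj_on \<pi> S"
  proof (rule inj_onI, rule ccontr)
    fix i k assume ik: "i \<in> S" "k \<in> S" "\<pi> i = \<pi> k" "i \<noteq> k"
    then have "i \<in> {1..l + m}" "k \<in> {1..l + m}" using assms(2) row_component[OF assms(1)] by blast+
    then have "k = \<sigma> i" using same_label[of i k] ik by simp
    then show False using assms(3)[OF ik(1)] ik(2) by simp
  qed
  then show ?thesis using assms(4) by (simp add: bij_betw_def)
qed

lemma partner_rows:
  assumes "c \<le> 1" "i \<in> row c"
  shows "\<sigma> (\<sigma> i) = i" "\<sigma> i \<noteq> i" "\<pi> (\<sigma> i) = \<pi> i" "\<sigma> i \<notin> row c \<longleftrightarrow> \<sigma> i \<in> row (1 - c)"
proof -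
  have i: "i \<in> {1..l + m}" using row_component[OF assms(1), of i] assms(2) by blast
  show "\<sigma> (\<sigma> i) = i" "\<sigma> i \<noteq> i" "\<pi> (\<sigma> i) = \<pi> i"
    using i partner_partner partner_neq label_partner by auto
  have "\<sigma> i \<in> row (component l (\<sigma> i))" using in_row_component partner_in i by blast
  moreover have "component l (\<sigma> i) = c \<or> component l (\<sigma> i) = 1 - c"
    using component_le_1[of "\<sigma> i"] assms(1) by arith
  ultimately show "\<sigma> i \<notin> row c \<longleftrightarrow> \<sigma> i \<in> row (1 - c)" using row_disjoint[OF assms(1)] by auto
qed

lemma twice_labelE:
  assumes "a \<in> twice_in (row_list c)" "c \<le> 1"
  obtains i where "i \<in> row c" "\<sigma> i \<in> row c" "\<pi> i = a"
proof -
  have "card {i \<in> row c. \<pi> i = a} = 2" using assms(1) by (simp add: twice_in_def count_row_list)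
  then have "{i \<in> row c. \<pi> i = a} \<noteq> {}" by force
  then obtain i where "i \<in> row c" "\<pi> i = a" by blast
  then show thesis using that assms twice_in_row_list[of c i] by blast
qed

text \<open>The left endpoint of the piece of row \<open>c\<close> around \<open>x\<close>. Written
  as a sum over the pieces to the left, it turns sums over points into integer combinations of
  lengths.\<close>

definition floor_pos :: "nat \<Rightarrow> real \<Rightarrow> real" where
  "floor_pos c x = (\<Sum>g\<in>{g \<in> row c. pos c (Suc g) \<le> x}. len $ \<pi> g)"

lemma floor_pos_eq:
  assumes "i \<in> row c" "pos c i \<le> x" "x < pos c (Suc i)"
  shows "floor_pos c x = pos c i"
proof -
  have "pos c (Suc g) \<le> x \<longleftrightarrow> g < i" if "g \<in> row c" for g
    using that assms pos_mono[of c "Suc g" i] pos_mono[of c "Suc i" "Suc g"]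
    by (cases "g < i") (auto simp: row_eq)
  then have "{g \<in> row c. pos c (Suc g) \<le> x} = {start c..<i}"
    using assms(1) by (auto simp: row_eq)
  then show ?thesis by (simp add: floor_pos_def pos_def)
qed

lemma floor_pos_Sing: "(x, c) \<in> Sing \<Longrightarrow> floor_pos c x = x"
  using pos_row_bounds floor_pos_eq by (metis Sing_pos order_refl)

lemma Sing_not_inside: "(x, c) \<in> Sing \<Longrightarrow> i \<in> row c \<Longrightarrow> pos c i < x \<Longrightarrow> \<not> x < pos c (Suc i)"
proof
  assume s: "(x, c) \<in> Sing" and i: "i \<in> row c" "pos c i < x" "x < pos c (Suc i)"
  obtain k where "k \<in> row c" "x = pos c k" "start c < k" using Sing_pos[OF s] .
  then show False using i by (auto simp: pos_less_iff row_eq)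
qed

text \<open>The first and last steps of such an orbit mirror each other: \<open>T_reverse\<close>
  gives \<open>w = f v\<close>, so removing both leaves a shorter orbit of the same kind.\<close>

lemma iter_no_turn: "u \<in> X \<Longrightarrow> iter n u \<noteq> Some (f u)"
proof (induction n arbitrary: u rule: less_induct)
  case (less n)
  consider "n = 0" | "n = 1" | k where "n = Suc (Suc k)" by (metis One_nat_def nat.exhaust)
  then show ?case
  proof cases
    case 1
    have "snd (f u) \<noteq> snd u" using phase_snd[OF less.prems] by (simp add: swap_component_def) arith
    then show ?thesis using 1 by auto
  next
    case 2
    then show ?thesis using T_no_turn by simp
  next
    case 3
    show ?thesis
    proof
      assume "iter n u = Some (f u)"
      then obtain v w where v: "T u = Some v" "iter k v = Some w" "T w = Some (f u)"
        unfolding 3 iter_Suc_iff' using iter_Suc_iff iter_Suc_iff' by metis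
      have "T u = Some (f w)" using T_reverse[OF v(3)] less.prems by simp
      then have "w = f v" using v(1) T_in_phase[OF v(3)] by auto
      then show False using less.IH[of k v] v T_in_phase[OF v(1)] 3 by auto
    qed
  qed
qed

text \<open>Injectivity pulls a return back to the initial point \<open>f s\<close>, which would
  then have a preimage; reversing that step would define \<open>T\<close> at
  \<open>s\<close>.\<close>

lemma inverse_singularity_no_return:
  assumes s: "s \<in> Sing" and n: "0 < n" and j: "iter j (f s) = Some u"
  shows "iter n u \<noteq> Some u"
proof
  assume "iter n u = Some u"
  have X: "s \<in> X" using s by (simp add: Sing_iff)
  have "iter (n + j) (f s) = Some u"
    using j \<open>iter n u = Some u\<close> by (subst add.commute) (auto simp: iter_add_iff)
  then obtain v where v: "iter n (f s) = Some v" "iter j v = Some u" by (auto simp: iter_add_iff)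
  have "v = f s" using iter_inj[OF _ _ v(2) j] iter_in_phase[OF _ v(1)] X by simp
  moreover obtain k where "n = Suc k" using n by (cases n) auto
  ultimately obtain w where "T w = Some (f s)" using v(1) by (auto simp: iter_Suc_iff)
  then have "T s = Some (f w)" using T_reverse X by fastforce
  then show False using s by (simp add: Sing_iff)
qed

end

section \<open>Connections for generic parameters\<close>

text \<open>\<open>(z k, \<epsilon> k)\<close> is the orbit point number \<open>k\<close> and \<open>\<iota> k\<close> the piece containing it. The involution
  maps the piece to its partner and then switches rows, so the point arrives through row
  \<open>1 - \<epsilon> (Suc k)\<close>.\<close>

locale generic_connection = parametrized_permutation +
  fixes r :: nat and z :: "nat \<Rightarrow> real" and \<epsilon> :: "nat \<Rightarrow> nat" and \<iota> :: "nat \<Rightarrow> nat"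
  assumes eps: "\<And>k. k \<le> r \<Longrightarrow> \<epsilon> k \<le> 1"
    and crossing: "\<And>k. k < r \<Longrightarrow> \<iota> k \<in> row (\<epsilon> k) \<and> \<sigma> (\<iota> k) \<in> row (1 - \<epsilon> (Suc k)) \<and>
          pos (\<epsilon> k) (\<iota> k) < z k \<and> z k < pos (\<epsilon> k) (Suc (\<iota> k)) \<and>
          z (Suc k) = image_point (\<epsilon> k) (1 - \<epsilon> (Suc k)) (\<iota> k) (z k)"
    and z_inj: "inj_on z {..r}"
    and start_sing: "(z 0, 1 - \<epsilon> 0) \<in> Sing"
    and stop_sing: "(z r, \<epsilon> r) \<in> Sing"
    and generic: "generic_in (balanced_vectors l m \<pi>) len"
begin

section \<open>The integer relation of a connection\<close>

definition flip_sign :: "nat \<Rightarrow> int" where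
  "flip_sign k = (if \<epsilon> (Suc k) = \<epsilon> k then 0 else if \<epsilon> k = 0 then - 1 else 1)"

text \<open>The coefficient that piece \<open>g\<close> receives when \<open>floor_pos c\<close> is
  summed over the points of the connection.\<close>

definition right_count :: "nat \<Rightarrow> nat \<Rightarrow> nat" where
  "right_count c g = card {k \<in> {..r}. pos c (Suc g) \<le> z k}"

lemma floor_sum: "(\<Sum>k\<le>r. floor_pos c (z k)) = (\<Sum>g\<in>row c. real (right_count c g) * len $ \<pi> g)"
proof -
  have "(\<Sum>k\<le>r. floor_pos c (z k)) =
      (\<Sum>k\<le>r. \<Sum>g\<in>row c. if pos c (Suc g) \<le> z k then len $ \<pi> g else 0)"
    by (simp add: floor_pos_def sum.inter_filter)
  also have "\<dots> = (\<Sum>g\<in>row c. \<Sum>k\<le>r. if pos c (Suc g) \<le> z k then len $ \<pi> g else 0)"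
    by (rule sum.swap)
  also have "\<dots> = (\<Sum>g\<in>row c. real (right_count c g) * len $ \<pi> g)"
    by (rule sum.cong) (simp_all add: right_count_def sum.inter_filter[symmetric])
  finally show ?thesis .
qed

definition sgn_dir :: "nat \<Rightarrow> real" where
  "sgn_dir k = (if \<epsilon> k = 0 then 1 else - 1)"

text \<open>A translation keeps the offset of a point in its piece; a reflection replaces it by the
  length minus the offset and also changes the row, hence \<open>sgn_dir\<close>. So the signed
  offset changes by zero or by a signed length.\<close>

lemma crossing_relation:
  assumes k: "k < r"
  shows "sgn_dir (Suc k) * (z (Suc k) - floor_pos (1 - \<epsilon> (Suc k)) (z (Suc k))) =
         sgn_dir k * (z k - floor_pos (\<epsilon> k) (z k)) + flip_sign k * len $ \<pi> (\<iota> k)"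
proof -
  let ?c = "\<epsilon> k" and ?d = "1 - \<epsilon> (Suc k)" and ?i = "\<iota> k"
  have c: "?c \<le> 1" "?d \<le> 1" "\<epsilon> (Suc k) \<le> 1" using eps[of k] eps[of "Suc k"] k by auto
  note cr = crossing[OF k]
  have im: "pos ?d (\<sigma> ?i) < z (Suc k)" "z (Suc k) < pos ?d (Suc (\<sigma> ?i))"
    using partner_image[of ?c ?d ?i "z k"] cr c by auto
  have fl: "floor_pos ?c (z k) = pos ?c ?i" "floor_pos ?d (z (Suc k)) = pos ?d (\<sigma> ?i)"
    using cr im by (auto intro!: floor_pos_eq)
  have S: "pos ?c (Suc ?i) = pos ?c ?i + len $ \<pi> ?i" using cr by (simp add: pos_Suc row_eq)
  have e: "(?c = 0 \<or> ?c = 1) \<and> (\<epsilon> (Suc k) = 0 \<or> \<epsilon> (Suc k) = 1)" using c by auto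
  then have q: "?c = ?d \<longleftrightarrow> \<epsilon> (Suc k) \<noteq> \<epsilon> k" by (elim conjE disjE) simp_all
  have "z (Suc k) = image_point ?c ?d ?i (z k)" using cr by blast
  then show ?thesis unfolding fl using e q S
    by (elim conjE disjE) (simp_all add: image_point_def sgn_dir_def flip_sign_def)
qed

text \<open>Each point has a signed offset \<open>a k\<close> in its departure row and
  \<open>b k\<close> in its arrival row, and their difference is that of the two left endpoints. A
  crossing relates \<open>a k\<close> to \<open>b (Suc k)\<close>, which makes the sum telescope;
  \<open>b 0\<close> and \<open>a r\<close> vanish at division points.\<close>

lemma length_relation:
  "(\<Sum>g\<in>row 0. real (right_count 0 g) * len $ \<pi> g) - (\<Sum>g\<in>row 1. real (right_count 1 g) * len $ \<pi> g)
     = (\<Sum>k<r. flip_sign k * len $ \<pi> (\<iota> k))"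
proof -
  define a where "a k = sgn_dir k * (z k - floor_pos (\<epsilon> k) (z k))" for k
  define b where "b k = sgn_dir k * (z k - floor_pos (1 - \<epsilon> k) (z k))" for k
  have D: "floor_pos 0 (z k) - floor_pos 1 (z k) = b k - a k" if "k \<le> r" for k
    using eps[OF that] by (cases "\<epsilon> k = 0") (auto simp: a_def b_def sgn_dir_def algebra_simps le_Suc_eq)
  have "(\<Sum>k\<le>n. b k - a k) = (\<Sum>k<n. flip_sign k * len $ \<pi> (\<iota> k)) - a n" if "n \<le> r" for n
    using that
  proof (induction n)
    case 0
    have "b 0 = 0" using floor_pos_Sing[OF start_sing] by (simp add: b_def)
    then show ?case by simp
  next
    case (Suc n)
    then show ?case using crossing_relation[of n] by (simp add: a_def b_def)
  qed
  from this[of r] have "(\<Sum>k\<le>r. b k - a k) = (\<Sum>k<r. flip_sign k * len $ \<pi> (\<iota> k)) - a r" by simp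
  moreover have "a r = 0" using floor_pos_Sing[OF stop_sing] by (simp add: a_def)
  moreover have "(\<Sum>k\<le>r. b k - a k) = (\<Sum>k\<le>r. floor_pos 0 (z k) - floor_pos 1 (z k))"
    by (intro sum.cong refl D[symmetric]) simp
  ultimately show ?thesis using floor_sum[of 0] floor_sum[of 1] by (simp add: sum_subtractf)
qed

lemma generic_relation:
  assumes y: "y \<in> balanced_vectors l m \<pi>"
  shows "(\<Sum>g\<in>row 0. real (right_count 0 g) * y $ \<pi> g) - (\<Sum>g\<in>row 1. real (right_count 1 g) * y $ \<pi> g)
     = (\<Sum>k<r. flip_sign k * y $ \<pi> (\<iota> k))"
proof -
  \<comment> \<open>The relation moved to one side and collected letter by letter; being integers,
    these coefficients are accessible to genericity.\<close>
  define n where "n a = (\<Sum>g\<in>row 0. if \<pi> g = a then int (right_count 0 g) else 0) -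
      (\<Sum>g\<in>row 1. if \<pi> g = a then int (right_count 1 g) else 0) - (\<Sum>k<r. if \<pi> (\<iota> k) = a then flip_sign k else 0)" for a
  have reindex: "(\<Sum>a\<in>UNIV. of_int (\<Sum>j\<in>J. if h j = a then w j else 0) * u $ a) = (\<Sum>j\<in>J. of_int (w j) * u $ h j)"
    for J :: "nat set" and h :: "nat \<Rightarrow> 'a" and w :: "nat \<Rightarrow> int" and u :: "real ^ 'a"
  proof -
    have "(\<Sum>a\<in>UNIV. of_int (\<Sum>j\<in>J. if h j = a then w j else 0) * u $ a) =
        (\<Sum>a\<in>UNIV. \<Sum>j\<in>J. if h j = a then of_int (w j) * u $ a else 0)"
      by (simp add: sum_distrib_right if_distrib cong: if_cong) (intro sum.cong refl, auto)
    also have "\<dots> = (\<Sum>j\<in>J. \<Sum>a\<in>UNIV. if h j = a then of_int (w j) * u $ a else 0)" by (rule sum.swap)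
    also have "\<dots> = (\<Sum>j\<in>J. of_int (w j) * u $ h j)" by (rule sum.cong) simp_all
    finally show ?thesis .
  qed
  have n: "(\<Sum>a\<in>UNIV. of_int (n a) * u $ a) = (\<Sum>g\<in>row 0. real (right_count 0 g) * u $ \<pi> g) -
      (\<Sum>g\<in>row 1. real (right_count 1 g) * u $ \<pi> g) - (\<Sum>k<r. flip_sign k * u $ \<pi> (\<iota> k))" for u :: "real ^ 'a"
    unfolding n_def of_int_diff left_diff_distrib sum_subtractf reindex by simp
  have "(\<Sum>a\<in>UNIV. of_int (n a) * len $ a) = 0" unfolding n using length_relation by simp
  then have "(\<Sum>a\<in>UNIV. of_int (n a) * y $ a) = 0" using generic y unfolding generic_in_def by blast
  then show ?thesis unfolding n by simp
qed

definition crossings :: "nat \<Rightarrow> nat" where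
  "crossings g = card {k \<in> {..<r}. \<pi> (\<iota> k) = \<pi> g}"

lemma balanced_rows:
  "y \<in> balanced_vectors l m \<pi> \<longleftrightarrow> (\<Sum>g\<in>row 0. y $ \<pi> g) = (\<Sum>g\<in>row 1. y $ \<pi> g)"
proof -
  have "row 0 = {1..l}" "row 1 = {l + 1..l + m}" by (auto simp: row_def)
  then show ?thesis by (simp add: balanced_vectors_def)
qed

lemma sum_axis:
  fixes w :: "nat \<Rightarrow> real"
  assumes "finite J"
  shows "(\<Sum>g\<in>J. w g * axis a 1 $ h g) = (\<Sum>g\<in>{k \<in> J. h k = a}. w g)"
  using assms by (simp add: axis_def sum.inter_filter if_distrib cong: if_cong)

lemma crossing_in:
  assumes "k < r" shows "\<iota> k \<in> row (\<epsilon> k)" "\<sigma> (\<iota> k) \<in> row (1 - \<epsilon> (Suc k))" "\<epsilon> k \<le> 1" "\<epsilon> (Suc k) \<le> 1"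
    "\<iota> k \<in> {1..l + m}"
proof -
  show i: "\<iota> k \<in> row (\<epsilon> k)" "\<sigma> (\<iota> k) \<in> row (1 - \<epsilon> (Suc k))" using crossing[OF assms] by blast+
  show e: "\<epsilon> k \<le> 1" "\<epsilon> (Suc k) \<le> 1" using eps[of k] eps[of "Suc k"] assms by auto
  show "\<iota> k \<in> {1..l + m}" using row_component[OF e(1), of "\<iota> k"] i(1) by blast
qed

lemma crossing_label:
  assumes "k < r" "g \<in> {1..l + m}" "\<pi> (\<iota> k) = \<pi> g" shows "\<iota> k = g \<or> \<iota> k = \<sigma> g"
  using same_label[OF assms(2) crossing_in(5)[OF assms(1)] assms(3)] by blast

text \<open>The unit vector of this letter is balanced, and crossing its band keeps the row, so the
  right-hand side of the relation vanishes.\<close>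

lemma right_count_once_aux:
  assumes g: "g \<in> row 0" "\<sigma> g \<in> row 1" shows "right_count 1 (\<sigma> g) = right_count 0 g"
proof -
  define y :: "real ^ 'a" where "y = axis (\<pi> g) 1"
  have n: "\<sigma> g \<notin> row 0" using row_unique[of 0 1 "\<sigma> g"] g by auto
  have L0: "{k \<in> row 0. \<pi> k = \<pi> g} = {g}" using labels_in_row(1)[of 0 g] g n by simp
  have L1: "{k \<in> row 1. \<pi> k = \<pi> g} = {\<sigma> g}" using labels_in_row(2)[of 0 g] g n by simp
  have s: "(\<Sum>k\<in>row 0. w k * y $ \<pi> k) = w g" "(\<Sum>k\<in>row 1. w k * y $ \<pi> k) = w (\<sigma> g)" for w
    unfolding y_def sum_axis[OF finite_row] L0 L1 by simp_all
  have "y \<in> balanced_vectors l m \<pi>"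
    unfolding balanced_rows using s[of "\<lambda>_. 1"] by simp
  then have "real (right_count 0 g) - real (right_count 1 (\<sigma> g)) = (\<Sum>k<r. flip_sign k * y $ \<pi> (\<iota> k))"
    using generic_relation[of y] s by simp
  also have "\<dots> = 0"
  proof (rule sum.neutral, rule ballI)
    fix k assume "k \<in> {..<r}"
    then have k: "k < r" by simp
    show "flip_sign k * y $ \<pi> (\<iota> k) = 0"
    proof (cases "\<pi> (\<iota> k) = \<pi> g")
      case True
      have "g \<in> {1..l + m}" "\<sigma> (\<sigma> g) = g" using g row_component[of 0 g] partner_partner[of g] by auto
      then have "\<iota> k = g \<and> \<sigma> (\<iota> k) = \<sigma> g \<or> \<iota> k = \<sigma> g \<and> \<sigma> (\<iota> k) = g"
        using crossing_label[OF k _ True] by auto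
      then have "\<epsilon> k = 0 \<and> 1 - \<epsilon> (Suc k) = 1 \<or> \<epsilon> k = 1 \<and> 1 - \<epsilon> (Suc k) = 0"
        using crossing_in[OF k] g row_unique[of "\<epsilon> k" 0 "\<iota> k"] row_unique[of "\<epsilon> k" 1 "\<iota> k"]
          row_unique[of "1 - \<epsilon> (Suc k)" 0 "\<sigma> (\<iota> k)"] row_unique[of "1 - \<epsilon> (Suc k)" 1 "\<sigma> (\<iota> k)"]
        by (metis diff_le_self le_refl le_zero_eq nle_le)
      then have "\<epsilon> (Suc k) = \<epsilon> k" using crossing_in(4)[OF k] by auto
      then show ?thesis by (simp add: flip_sign_def)
    qed (simp add: y_def axis_def)
  qed
  finally show ?thesis by simp
qed

lemma right_count_once:
  assumes "c \<le> 1" "g \<in> row c" "\<sigma> g \<in> row (1 - c)" shows "right_count (1 - c) (\<sigma> g) = right_count c g"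
proof (cases "c = 0")
  case True
  then show ?thesis using right_count_once_aux[of g] assms by simp
next
  case False
  then have c: "c = 1" using assms by simp
  have "\<sigma> (\<sigma> g) = g" using assms(2) c row_component[of 1 g] partner_partner[of g] by simp
  then show ?thesis using right_count_once_aux[of "\<sigma> g"] assms(2,3) unfolding c by simp
qed

text \<open>In whichever direction the band is traversed, a crossing departs from row
  \<open>c\<close> and changes the row, so all signs agree.\<close>

lemma flip_sum:
  assumes c: "c \<le> 1" and g: "g \<in> row c" "\<sigma> g \<in> row c"
  shows "(\<Sum>k<r. real_of_int (flip_sign k) * (axis (\<pi> g) 1 :: real ^ 'a) $ \<pi> (\<iota> k)) = (if c = 0 then - real (crossings g) else real (crossings g))"
proof -
  have gp: "g \<in> {1..l + m}" "\<sigma> (\<sigma> g) = g" using g row_component[OF c, of g] partner_partner[of g] by auto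
  have "flip_sign k = (if c = 0 then - 1 else 1)" if k: "k < r" "\<pi> (\<iota> k) = \<pi> g" for k
  proof -
    have "\<iota> k \<in> row c" "\<sigma> (\<iota> k) \<in> row c" using crossing_label[OF k(1) gp(1) k(2)] gp(2) g by auto
    then have "\<epsilon> k = c" "1 - \<epsilon> (Suc k) = c"
      using crossing_in[OF k(1)] c row_unique[of "\<epsilon> k" c "\<iota> k"]
        row_unique[of "1 - \<epsilon> (Suc k)" c "\<sigma> (\<iota> k)"] by auto
    then show ?thesis using crossing_in(4)[OF k(1)] c by (auto simp: flip_sign_def)
  qed
  then have "(\<Sum>k\<in>{k \<in> {..<r}. \<pi> (\<iota> k) = \<pi> g}. real_of_int (flip_sign k)) =
      (\<Sum>k\<in>{k \<in> {..<r}. \<pi> (\<iota> k) = \<pi> g}. if c = 0 then - 1 else 1)"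
    by (intro sum.cong refl) auto
  then show ?thesis unfolding sum_axis[OF finite_lessThan] crossings_def by simp
qed

definition weight :: "nat \<Rightarrow> nat \<Rightarrow> nat" where
  "weight c g = right_count c g + right_count c (\<sigma> g) + crossings g"

text \<open>Neither unit vector is balanced, but their sum is. The opposite signs in
  \<open>flip_sum\<close> turn its relation into an equality of weights.\<close>

lemma weight_eq:
  assumes g: "g \<in> row 0" "\<sigma> g \<in> row 0" and h: "h \<in> row 1" "\<sigma> h \<in> row 1"
  shows "weight 0 g = weight 1 h"
proof -
  define u :: "real ^ 'a" where "u = axis (\<pi> g) 1"
  define v :: "real ^ 'a" where "v = axis (\<pi> h) 1"
  have L: "{k \<in> row 0. \<pi> k = \<pi> g} = {g, \<sigma> g}" "{k \<in> row 1. \<pi> k = \<pi> g} = {}"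
    "{k \<in> row 1. \<pi> k = \<pi> h} = {h, \<sigma> h}" "{k \<in> row 0. \<pi> k = \<pi> h} = {}"
    using labels_in_row[of 0 g] labels_in_row[of 1 h] g h by simp_all
  have neq: "\<sigma> g \<noteq> g" "\<sigma> h \<noteq> h"
    using partner_neq[of g] partner_neq[of h] g h row_component[of 0 g] row_component[of 1 h] by auto
  have s: "(\<Sum>k\<in>row 0. w k * u $ \<pi> k) = w g + w (\<sigma> g)" "(\<Sum>k\<in>row 1. w k * u $ \<pi> k) = 0"
    "(\<Sum>k\<in>row 1. w k * v $ \<pi> k) = w h + w (\<sigma> h)" "(\<Sum>k\<in>row 0. w k * v $ \<pi> k) = 0" for w
    unfolding u_def v_def sum_axis[OF finite_row] L using neq by auto
  have "u + v \<in> balanced_vectors l m \<pi>"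
    unfolding balanced_rows using s[of "\<lambda>_. 1"] by (simp add: sum.distrib)
  from generic_relation[OF this]
  have "real (right_count 0 g) + real (right_count 0 (\<sigma> g)) - (real (right_count 1 h) + real (right_count 1 (\<sigma> h))) =
      (\<Sum>k<r. flip_sign k * u $ \<pi> (\<iota> k)) + (\<Sum>k<r. flip_sign k * v $ \<pi> (\<iota> k))"
    using s[of "\<lambda>g. real (right_count 0 g)"] s[of "\<lambda>g. real (right_count 1 g)"] by (simp add: distrib_left sum.distrib)
  also have "\<dots> = - real (crossings g) + real (crossings h)"
    using flip_sum[of 0 g] flip_sum[of 1 h] g h by (simp add: u_def v_def)
  finally have "real (weight 0 g) = real (weight 1 h)" by (simp add: weight_def)
  then show ?thesis by simp
qed

text \<open>Doubled letters of one row are compared through a doubled letter of the other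
  row.\<close>

lemma weight_const:
  obtains K where "\<And>c g. c \<le> 1 \<Longrightarrow> g \<in> row c \<Longrightarrow> \<sigma> g \<in> row c \<Longrightarrow> weight c g = K"
proof -
  obtain g0 where g0: "g0 \<in> row 0" "\<sigma> g0 \<in> row 0" using twice_in_row[of 0] by auto
  obtain h0 where h0: "h0 \<in> row 1" "\<sigma> h0 \<in> row 1" using twice_in_row[of 1] by auto
  have "weight c g = weight 0 g0" if "c \<le> 1" "g \<in> row c" "\<sigma> g \<in> row c" for c g
  proof (cases "c = 0")
    case True
    then show ?thesis using that weight_eq[OF _ _ h0] weight_eq[OF g0 h0] by auto
  next
    case False
    then have c: "c = 1" using that by simp
    show ?thesis using that(2,3) weight_eq[OF g0] unfolding c by simp
  qed
  then show thesis by (rule that[of "weight 0 g0"])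
qed

section \<open>Ranks of the points of a connection\<close>

definition Z :: "real set" where
  "Z = z ` {..r}"

definition marks :: "nat \<Rightarrow> nat \<Rightarrow> real set" where
  "marks c i = {x \<in> Z. pos c i < x \<and> x < pos c (Suc i)}"

definition rank :: "real \<Rightarrow> nat" where
  "rank x = card {x' \<in> Z. x < x'}"

lemma finite_Z [simp]: "finite Z"
  by (simp add: Z_def)

lemma right_count_eq: "right_count c g = card {x \<in> Z. pos c (Suc g) \<le> x}"
proof -
  have "{x \<in> Z. pos c (Suc g) \<le> x} = z ` {k \<in> {..r}. pos c (Suc g) \<le> z k}" by (auto simp: Z_def)
  moreover have "inj_on z {k \<in> {..r}. pos c (Suc g) \<le> z k}" by (rule inj_on_subset[OF z_inj]) auto
  ultimately show ?thesis unfolding right_count_def by (metis card_image)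
qed

lemma rank_inj: assumes "x \<in> Z" "y \<in> Z" "rank x = rank y" shows "x = y"
proof -
  have less: "rank v < rank u" if "u < v" "v \<in> Z" for u v
    unfolding rank_def by (rule psubset_card_mono) (use that in auto)
  show ?thesis using assms less[of x y] less[of y x] by (cases x y rule: linorder_cases) auto
qed

text \<open>A point strictly inside a piece of its departure row is not the last one, and a point
  strictly inside a piece of its arrival row is not the first, because the ends are division points
  there. So the next or the previous crossing passes through that piece.\<close>

lemma mark_cases:
  assumes c: "c \<le> 1" "c' \<le> 1" and i: "i \<in> row c" "\<sigma> i \<in> row c'"
    and k: "k \<le> r" "pos c i < z k" "z k < pos c (Suc i)"
  shows "(k < r \<and> \<iota> k = i \<and> \<epsilon> k = c \<and> z (Suc k) = image_point c c' i (z k)) \<or>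
         (\<exists>k'. k = Suc k' \<and> k' < r \<and> \<iota> k' = \<sigma> i \<and> \<epsilon> k' = c' \<and> 1 - \<epsilon> k = c \<and> z k' = image_point c c' i (z k))"
proof (cases "\<epsilon> k = c")
  case True
  have "k \<noteq> r" using stop_sing Sing_not_inside[of "z r" c i] i k True by auto
  then have kr: "k < r" using k by simp
  have "\<iota> k = i"
    using crossing[OF kr] k i True pos_locate_unique[of "\<iota> k" c "z k" i] by auto
  moreover from this have "1 - \<epsilon> (Suc k) = c'"
    using crossing_in[OF kr] i(2) c row_unique[of "1 - \<epsilon> (Suc k)" c' "\<sigma> i"] by auto
  ultimately show ?thesis using kr True crossing[OF kr] by auto
next
  case False
  then have ek: "1 - \<epsilon> k = c" using eps[OF k(1)] c by auto
  have "k \<noteq> 0"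
  proof
    assume "k = 0"
    then show False using start_sing Sing_not_inside[of "z 0" c i] i k ek by simp
  qed
  then obtain k' where k': "k = Suc k'" by (cases k) auto
  then have kr: "k' < r" using k by simp
  note ci = crossing_in[OF kr]
  note cr = crossing[OF kr, unfolded k'[symmetric] ek]
  have im: "pos c (\<sigma> (\<iota> k')) < z k" "z k < pos c (Suc (\<sigma> (\<iota> k')))"
    "image_point c (\<epsilon> k') (\<sigma> (\<iota> k')) (z k) = z k'"
    using partner_image[of "\<epsilon> k'" c "\<iota> k'" "z k'"] cr ci c by auto
  have "\<sigma> (\<iota> k') = i" using pos_locate_unique[of "\<sigma> (\<iota> k')" c "z k" i] cr i im k by auto
  moreover from this have "\<iota> k' = \<sigma> i" using partner_partner[OF ci(5)] by simp
  moreover from this have "\<epsilon> k' = c'" using ci(1,3) i(2) c row_unique[of "\<epsilon> k'" c' "\<sigma> i"] by auto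
  ultimately show ?thesis using k' kr ek im(3) by auto
qed

lemma marks_image:
  assumes c: "c \<le> 1" "c' \<le> 1" and i: "i \<in> row c" "\<sigma> i \<in> row c'"
  shows "bij_betw (image_point c c' i) (marks c i) (marks c' (\<sigma> i))"
proof (rule bij_betw_byWitness[where f' = "image_point c' c (\<sigma> i)"])
  have ip: "i \<in> {1..l + m}" using row_component[OF c(1), of i] i by blast
  have inv: "\<sigma> (\<sigma> i) = i" using partner_partner[OF ip] .
  have step: "image_point c c' i x \<in> marks c' (\<sigma> i)" if st: "c \<le> 1" "c' \<le> 1" "i \<in> row c" "\<sigma> i \<in> row c'" "x \<in> marks c i"
    for c c' i x
  proof -
    obtain k where k: "k \<le> r" "x = z k" using st(5) by (auto simp: marks_def Z_def)
    have b: "pos c i < x" "x < pos c (Suc i)" using st(5) by (auto simp: marks_def)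
    have "image_point c c' i x \<in> Z"
      using mark_cases[OF st(1-4) k(1)] b unfolding k(2) Z_def by (metis Suc_leI atMost_iff imageI less_imp_le)
    then show ?thesis using partner_image[OF st(1-4) b] by (simp add: marks_def)
  qed
  show "\<forall>x\<in>marks c i. image_point c' c (\<sigma> i) (image_point c c' i x) = x"
    using partner_image[OF c i] by (auto simp: marks_def)
  show "\<forall>y\<in>marks c' (\<sigma> i). image_point c c' i (image_point c' c (\<sigma> i) y) = y"
    using partner_image[OF c(2,1) i(2)] i(1) inv by (auto simp: marks_def)
  show "image_point c c' i ` marks c i \<subseteq> marks c' (\<sigma> i)" using step[OF c i] by blast
  show "image_point c' c (\<sigma> i) ` marks c' (\<sigma> i) \<subseteq> marks c i" using step[OF c(2,1) i(2)] i(1) inv by auto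
qed

text \<open>Each crossing of the band has exactly one end in piece \<open>i\<close>, its departure
  or its arrival; \<open>g\<close> selects it.\<close>

lemma card_marks:
  assumes c: "c \<le> 1" and i: "i \<in> row c" "\<sigma> i \<in> row c"
  shows "card (marks c i) = crossings i"
proof -
  have ip: "i \<in> {1..l + m}" using row_component[OF c, of i] i by blast
  let ?S = "{k \<in> {..<r}. \<pi> (\<iota> k) = \<pi> i}"
  define g where "g k = (if \<iota> k = i then z k else z (Suc k))" for k
  have S: "k < r" "\<iota> k = i \<or> \<iota> k = \<sigma> i" "\<epsilon> k = c" "1 - \<epsilon> (Suc k) = c" if "k \<in> ?S" for k
  proof -
    show k: "k < r" using that by simp
    show ik: "\<iota> k = i \<or> \<iota> k = \<sigma> i" using crossing_label[OF k ip] that by simp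
    show "\<epsilon> k = c" using crossing_in[OF k] ik i c row_unique[of "\<epsilon> k" c "\<iota> k"] by auto
    show "1 - \<epsilon> (Suc k) = c"
      using crossing_in[OF k] ik i c row_unique[of "1 - \<epsilon> (Suc k)" c "\<sigma> (\<iota> k)"] partner_partner[OF ip] by auto
  qed
  have "inj_on g ?S"
  proof (rule inj_onI)
    fix a b assume ab: "a \<in> ?S" "b \<in> ?S" "g a = g b"
    have r: "a \<in> {..r}" "Suc a \<in> {..r}" "b \<in> {..r}" "Suc b \<in> {..r}" using S(1)[OF ab(1)] S(1)[OF ab(2)] by auto
    \<comment> \<open>A crossing of this band departs from row \<open>c\<close> and leaves the point
      in row \<open>1 - c\<close>, so the next step cannot cross the same band again.\<close>
    have "c \<noteq> 1 - c" by arith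
    then have "a \<noteq> Suc b" "b \<noteq> Suc a"
      using S(3,4)[OF ab(1)] S(3,4)[OF ab(2)] by metis+
    then show "a = b" using ab(3) r inj_onD[OF z_inj] by (auto simp: g_def split: if_splits)
  qed
  moreover have "g ` ?S = marks c i"
  proof
    show "g ` ?S \<subseteq> marks c i"
    proof
      fix x assume "x \<in> g ` ?S"
      then obtain k where k: "k \<in> ?S" "x = g k" by blast
      show "x \<in> marks c i"
      proof (cases "\<iota> k = i")
        case True
        then show ?thesis using k crossing[of k] S[OF k(1)] by (auto simp: g_def marks_def Z_def)
      next
        case False
        then have "\<iota> k = \<sigma> i" using S(2)[OF k(1)] by blast
        then have "\<sigma> (\<iota> k) = i" using partner_partner[OF ip] by simp
        moreover have "z (Suc k) \<in> Z" using S(1)[OF k(1)] by (auto simp: Z_def)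
        ultimately show ?thesis
          using False k(2) S[OF k(1)] crossing[of k] partner_image[of c c "\<iota> k" "z k"] c
          by (auto simp: g_def marks_def)
      qed
    qed
    show "marks c i \<subseteq> g ` ?S"
    proof
      fix x assume "x \<in> marks c i"
      then obtain k where k: "k \<le> r" "x = z k" "pos c i < z k" "z k < pos c (Suc i)"
        by (auto simp: marks_def Z_def)
      from mark_cases[OF c c i k(1,3,4)] show "x \<in> g ` ?S"
      proof
        assume "k < r \<and> \<iota> k = i \<and> \<epsilon> k = c \<and> z (Suc k) = image_point c c i (z k)"
        then show ?thesis using k(2) by (intro image_eqI[of _ _ k]) (auto simp: g_def)
      next
        assume "\<exists>k'. k = Suc k' \<and> k' < r \<and> \<iota> k' = \<sigma> i \<and> \<epsilon> k' = c \<and> 1 - \<epsilon> k = c \<and> z k' = image_point c c i (z k)"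
        then obtain k' where "k = Suc k'" "k' < r" "\<iota> k' = \<sigma> i" by blast
        then show ?thesis using k(2) partner_neq[OF ip] label_partner[OF ip]
          by (intro image_eqI[of _ _ k']) (auto simp: g_def)
      qed
    qed
  qed
  ultimately show ?thesis unfolding crossings_def using card_image by metis
qed

lemma rank_mark:
  assumes i: "i \<in> row c" and x: "x \<in> marks c i"
  shows "rank x = right_count c i + card {y \<in> marks c i. x < y}"
proof -
  have "{x' \<in> Z. x < x'} = {x' \<in> Z. pos c (Suc i) \<le> x'} \<union> {y \<in> marks c i. x < y}"
    using x by (auto simp: marks_def)
  moreover have "{x' \<in> Z. pos c (Suc i) \<le> x'} \<inter> {y \<in> marks c i. x < y} = {}"
    by (auto simp: marks_def)
  ultimately show ?thesis unfolding rank_def right_count_eq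
    by (simp add: card_Un_disjoint marks_def)
qed

lemma crossing_marks:
  assumes k: "k < r"
  shows "z k \<in> marks (\<epsilon> k) (\<iota> k)" "z (Suc k) \<in> marks (1 - \<epsilon> (Suc k)) (\<sigma> (\<iota> k))"
proof -
  show m: "z k \<in> marks (\<epsilon> k) (\<iota> k)" using crossing[OF k] k by (auto simp: marks_def Z_def)
  have "1 - \<epsilon> (Suc k) \<le> 1" by simp
  from marks_image[OF crossing_in(3)[OF k] this crossing_in(1,2)[OF k]]
  show "z (Suc k) \<in> marks (1 - \<epsilon> (Suc k)) (\<sigma> (\<iota> k))"
    using m crossing[OF k] bij_betwE by metis
qed

text \<open>A translation keeps the order of the marks in the piece, and the two occurrences have
  equal right counts. So the rank would be preserved, although distinct points have distinct
  ranks.\<close>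

lemma crossing_flips:
  assumes k: "k < r" shows "\<epsilon> (Suc k) \<noteq> \<epsilon> k"
proof
  assume e: "\<epsilon> (Suc k) = \<epsilon> k"
  let ?c = "\<epsilon> k" and ?i = "\<iota> k" and ?\<phi> = "image_point (\<epsilon> k) (1 - \<epsilon> k) (\<iota> k)"
  note ci = crossing_in[OF k, unfolded e]
  note mk = crossing_marks[OF k, unfolded e]
  have z': "z (Suc k) = ?\<phi> (z k)" using crossing[OF k] e by simp
  have bij: "bij_betw ?\<phi> (marks ?c ?i) (marks (1 - ?c) (\<sigma> ?i))"
    using marks_image[of ?c "1 - ?c" ?i] ci by simp
  have mono: "?\<phi> x < ?\<phi> y \<longleftrightarrow> x < y" for x y
  proof -
    have "?c \<noteq> 1 - ?c" by arith
    then show ?thesis by (simp add: image_point_def)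
  qed
  have "bij_betw ?\<phi> {y \<in> marks ?c ?i. z k < y} {y \<in> marks (1 - ?c) (\<sigma> ?i). z (Suc k) < y}"
    unfolding z' by (rule bij_betw_filter[OF bij]) (rule mono[symmetric])
  then have "card {y \<in> marks ?c ?i. z k < y} = card {y \<in> marks (1 - ?c) (\<sigma> ?i). z (Suc k) < y}"
    by (rule bij_betw_same_card)
  then have "rank (z k) = rank (z (Suc k))"
    using rank_mark[OF ci(1) mk(1)] rank_mark[OF ci(2) mk(2)] right_count_once[OF ci(3,1,2)] by simp
  then have "z k = z (Suc k)" using k by (intro rank_inj) (auto simp: Z_def)
  then show False using inj_onD[OF z_inj, of k "Suc k"] k by simp
qed

text \<open>The reflection carries the marks left of \<open>z k\<close> to those right of
  \<open>z (Suc k)\<close>. Together with \<open>z k\<close> and the marks right of it they exhaust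
  the piece, whose marks number \<open>crossings\<close>.\<close>

lemma crossing_rank_sum:
  assumes k: "k < r"
  shows "\<epsilon> (Suc k) = 1 - \<epsilon> k" "\<sigma> (\<iota> k) \<in> row (\<epsilon> k)" "rank (z k) + rank (z (Suc k)) + 1 = weight (\<epsilon> k) (\<iota> k)"
proof -
  let ?c = "\<epsilon> k" and ?i = "\<iota> k" and ?\<phi> = "image_point (\<epsilon> k) (\<epsilon> k) (\<iota> k)"
  show e: "\<epsilon> (Suc k) = 1 - ?c" using crossing_flips[OF k] crossing_in(3,4)[OF k] by arith
  have e': "1 - \<epsilon> (Suc k) = ?c" using e crossing_in(3)[OF k] by arith
  note ci = crossing_in[OF k, unfolded e']
  note mk = crossing_marks[OF k, unfolded e']
  show "\<sigma> ?i \<in> row ?c" by (rule ci(2))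
  have z': "z (Suc k) = ?\<phi> (z k)" using crossing[OF k] e' by simp
  have bij: "bij_betw ?\<phi> (marks ?c ?i) (marks ?c (\<sigma> ?i))" using marks_image[of ?c ?c ?i] ci by simp
  have mono: "?\<phi> x < ?\<phi> y \<longleftrightarrow> y < x" for x y by (simp add: image_point_def)
  have "bij_betw ?\<phi> {y \<in> marks ?c ?i. y < z k} {y \<in> marks ?c (\<sigma> ?i). z (Suc k) < y}"
    unfolding z' by (rule bij_betw_filter[OF bij]) (simp add: mono)
  then have "card {y \<in> marks ?c ?i. y < z k} = card {y \<in> marks ?c (\<sigma> ?i). z (Suc k) < y}"
    by (rule bij_betw_same_card)
  moreover have fin: "finite (marks ?c ?i)" by (simp add: marks_def)
  have split: "marks ?c ?i = insert (z k) ({y \<in> marks ?c ?i. y < z k} \<union> {y \<in> marks ?c ?i. z k < y})"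
    using mk(1) by auto
  have "card ({y \<in> marks ?c ?i. y < z k} \<union> {y \<in> marks ?c ?i. z k < y}) =
      card {y \<in> marks ?c ?i. y < z k} + card {y \<in> marks ?c ?i. z k < y}"
    using fin by (intro card_Un_disjoint) auto
  then have "card (marks ?c ?i) = card {y \<in> marks ?c ?i. y < z k} + 1 + card {y \<in> marks ?c ?i. z k < y}"
    using fin arg_cong[OF split, of card] by simp
  ultimately show "rank (z k) + rank (z (Suc k)) + 1 = weight ?c ?i"
    using rank_mark[OF ci(1) mk(1)] rank_mark[OF ci(2) mk(2)] card_marks[OF ci(3,1,2)] by (simp add: weight_def)
qed

lemma r_le_1: "r \<le> 1"
proof (rule ccontr)
  assume "\<not> r \<le> 1"
  then have r: "0 < r" "Suc 0 < r" by auto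
  obtain K where K: "\<And>c g. c \<le> 1 \<Longrightarrow> g \<in> row c \<Longrightarrow> \<sigma> g \<in> row c \<Longrightarrow> weight c g = K"
    using weight_const by blast
  have "rank (z k) + rank (z (Suc k)) + 1 = K" if "k < r" for k
    using crossing_rank_sum(3)[OF that] K[OF crossing_in(3,1)[OF that] crossing_rank_sum(2)[OF that]] by simp
  from this[OF r(1)] this[OF r(2)] have "rank (z 0) = rank (z (Suc (Suc 0)))" by simp
  then have "z 0 = z (Suc (Suc 0))" using r by (intro rank_inj) (auto simp: Z_def)
  then show False using inj_onD[OF z_inj, of 0 "Suc (Suc 0)"] r by simp
qed

section \<open>Decompositions read off from a connection\<close>

lemma right_count_le_iff:
  assumes "g \<in> row c" "pos c i \<le> x" "x < pos c (Suc i)" "i \<in> row c"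
  shows "pos c (Suc g) \<le> x \<longleftrightarrow> g < i"
  using assms pos_mono[of c "Suc g" i] pos_mono[of c "Suc i" "Suc g"]
  by (cases "g < i") (auto simp: row_eq)

text \<open>By \<open>right_count_once\<close> the number \<open>n\<close> is the same for both
  occurrences; it decides to which corner the letter belongs.\<close>

definition once_labels :: "nat \<Rightarrow> 'a set" where
  "once_labels n = \<pi> ` {g \<in> row 0. \<sigma> g \<notin> row 0 \<and> right_count 0 g = n}"

definition twice_labels :: "nat \<Rightarrow> nat set \<Rightarrow> 'a set" where
  "twice_labels c S = \<pi> ` {g \<in> S. \<sigma> g \<in> row c}"

lemma once_labels_eq:
  assumes c: "c \<le> 1" shows "once_labels n = \<pi> ` {g \<in> row c. \<sigma> g \<notin> row c \<and> right_count c g = n}"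
proof -
  have sub: "\<pi> ` {g \<in> row c. \<sigma> g \<notin> row c \<and> right_count c g = n} \<subseteq> \<pi> ` {g \<in> row d. \<sigma> g \<notin> row d \<and> right_count d g = n}"
    if cd: "c \<le> 1" "d = 1 - c" for c d
  proof
    fix a assume "a \<in> \<pi> ` {g \<in> row c. \<sigma> g \<notin> row c \<and> right_count c g = n}"
    then obtain g where g: "g \<in> row c" "\<sigma> g \<notin> row c" "right_count c g = n" "a = \<pi> g" by blast
    have s: "\<sigma> g \<in> row d" using partner_rows(4)[OF cd(1) g(1)] g(2) cd(2) by blast
    have "\<sigma> (\<sigma> g) \<notin> row d" using partner_rows(1)[OF cd(1) g(1)] row_disjoint[OF cd(1) g(1)] cd(2) by simp
    moreover have "right_count d (\<sigma> g) = n" using right_count_once[OF cd(1) g(1)] s g(3) cd(2) by simp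
    ultimately show "a \<in> \<pi> ` {g \<in> row d. \<sigma> g \<notin> row d \<and> right_count d g = n}"
      using s partner_rows(3)[OF cd(1) g(1)] g(4) by (intro image_eqI[of _ _ "\<sigma> g"]) auto
  qed
  have "c = 0 \<or> c = 1" using c by arith
  then show ?thesis
  proof
    assume "c = 1"
    then show ?thesis using sub[of 0 1] sub[of 1 0] by (simp add: once_labels_def subset_antisym)
  qed (simp add: once_labels_def)
qed

lemma once_labels_subset:
  assumes "c \<le> 1" shows "once_labels n \<subseteq> once_in_each (row_list c) (row_list (1 - c))"
  unfolding once_labels_eq[OF assms] using once_in_each_row_list[OF assms] by blast

lemma twice_labels_subset:
  assumes "c \<le> 1" "S \<subseteq> row c" shows "twice_labels c S \<subseteq> twice_in (row_list c)"
  unfolding twice_labels_def using twice_in_row_list[OF assms(1)] assms(2) by blast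

lemma bij_betw_segment:
  assumes c: "c \<le> 1" and S: "S \<subseteq> row c" "\<And>g. g \<in> S \<Longrightarrow> \<sigma> g \<notin> S"
    and once: "\<And>g. g \<in> row c \<Longrightarrow> \<sigma> g \<notin> row c \<Longrightarrow> g \<in> S \<longleftrightarrow> right_count c g = n"
  shows "bij_betw \<pi> S (once_labels n \<union> twice_labels c S)"
proof (rule bij_betw_labels[OF c S])
  have "S = {g \<in> row c. \<sigma> g \<notin> row c \<and> right_count c g = n} \<union> {g \<in> S. \<sigma> g \<in> row c}"
    using S(1) once by blast
  then show "\<pi> ` S = once_labels n \<union> twice_labels c S"
    unfolding once_labels_eq[OF c] twice_labels_def by (metis image_Un)
qed

text \<open>Supplies the sets \<open>B\<close> and \<open>C\<close> that must recur in both corners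
  of a row: taking partners exchanges the corners.\<close>

lemma twice_labels_swap:
  assumes c: "c \<le> 1" and S: "S \<subseteq> row c" "S' \<subseteq> row c"
    and swap: "\<And>g. g \<in> S \<Longrightarrow> \<sigma> g \<in> row c \<Longrightarrow> \<sigma> g \<in> S'" "\<And>g. g \<in> S' \<Longrightarrow> \<sigma> g \<in> row c \<Longrightarrow> \<sigma> g \<in> S"
  shows "twice_labels c S = twice_labels c S'"
proof -
  have "twice_labels c U \<subseteq> twice_labels c V"
    if "U \<subseteq> row c" "\<And>g. g \<in> U \<Longrightarrow> \<sigma> g \<in> row c \<Longrightarrow> \<sigma> g \<in> V" for U V
  proof
    fix a assume "a \<in> twice_labels c U"
    then obtain g where g: "g \<in> U" "\<sigma> g \<in> row c" "a = \<pi> g" unfolding twice_labels_def by blast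
    have "g \<in> row c" using g(1) that(1) by blast
    then show "a \<in> twice_labels c V"
      unfolding twice_labels_def using g that(2)[OF g(1,2)] partner_rows[OF c \<open>g \<in> row c\<close>]
      by (intro image_eqI[of _ _ "\<sigma> g"]) auto
  qed
  from this[of S S'] this[of S' S] S swap show ?thesis by blast
qed

text \<open>The single point is a division point of both rows, at index \<open>h c\<close>, so right
  counts are 1 before the cut and 0 after it. Without crossings, \<open>K\<close> is the number of
  occurrences before the cut, the same for all doubled letters.\<close>

lemma reducible_of_connection_0:
  assumes r: "r = 0" shows "reducible_a (row_list 0) (row_list 1)"
proof -
  have sing: "(z 0, c) \<in> Sing" if "c \<le> 1" for c
  proof -
    have "c = \<epsilon> 0 \<or> c = 1 - \<epsilon> 0" using that eps[of 0] by arith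
    then show ?thesis using start_sing stop_sing r by auto
  qed
  have "\<exists>h. h \<in> row c \<and> z 0 = pos c h \<and> start c < h" if "c \<le> 1" for c
    using Sing_pos[OF sing[OF that]] by metis
  then obtain h where h: "\<And>c. c \<le> 1 \<Longrightarrow> h c \<in> row c \<and> z 0 = pos c (h c) \<and> start c < h c" by metis
  have Rh: "right_count c g = (if g < h c then 1 else 0)" if "c \<le> 1" "g \<in> row c" for c g
  proof -
    have "pos c (Suc g) \<le> z 0 \<longleftrightarrow> g < h c"
      using right_count_le_iff[OF that(2), of "h c" "z 0"] h[OF that(1)] pos_row_bounds[of "h c" c] by simp
    then have "{k \<in> {..r}. pos c (Suc g) \<le> z k} = (if g < h c then {0} else {})" using r by auto
    then show ?thesis by (simp add: right_count_def)
  qed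
  obtain K where K: "\<And>c g. c \<le> 1 \<Longrightarrow> g \<in> row c \<Longrightarrow> \<sigma> g \<in> row c \<Longrightarrow> weight c g = K"
    using weight_const by blast
  have N0: "crossings g = 0" for g unfolding crossings_def using r by simp
  have Mh: "(if g < h c then 1 else 0) + (if \<sigma> g < h c then 1 else 0) = K"
    if "c \<le> 1" "g \<in> row c" "\<sigma> g \<in> row c" for c g
    using K[OF that] Rh[OF that(1,2)] Rh[OF that(1,3)] by (simp add: weight_def N0)
  define SL where "SL c = {start c..<h c}" for c
  define SR where "SR c = {h c..<stop c}" for c
  have bounds: "start c \<le> h c" "h c < stop c" if "c \<le> 1" for c using h[OF that] by (auto simp: row_eq)
  have rows: "SL c \<subseteq> row c" "SR c \<subseteq> row c" if "c \<le> 1" for c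
    using bounds[OF that] by (auto simp: row_eq SL_def SR_def)
  have SL_iff: "g \<in> SL c \<longleftrightarrow> g < h c" and SR_iff: "g \<in> SR c \<longleftrightarrow> \<not> g < h c" if "g \<in> row c" for c g
    using that by (auto simp: SL_def SR_def row_eq)
  obtain g0 where g0: "g0 \<in> row 0" "\<sigma> g0 \<in> row 0" using twice_in_row[of 0] by auto
  have "K \<le> 2" using Mh[OF _ g0] by (auto split: if_splits)
  then consider "K = 0" | "K = 1" | "K = 2" by linarith
  then show ?thesis
  proof cases
    case 1
    have none: "\<sigma> g \<notin> row c" if "c \<le> 1" "g \<in> SL c" for c g
      using Mh[OF that(1), of g] rows(1)[OF that(1)] SL_iff[of g c] that(2) 1 by (auto split: if_splits)
    have "bij_betw \<pi> (SL c) (once_labels 1)" if c: "c \<le> 1" for c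
    proof -
      have "twice_labels c (SL c) = {}" using none[OF c] unfolding twice_labels_def by blast
      moreover have "bij_betw \<pi> (SL c) (once_labels 1 \<union> twice_labels c (SL c))"
        by (rule bij_betw_segment[OF c rows(1)[OF c]])
          (use none[OF c] rows(1)[OF c] SL_iff Rh[OF c] in \<open>auto split: if_splits\<close>)
      ultimately show ?thesis by simp
    qed
    then have cor: "corners (row_list c) (once_labels 1) (map \<pi> [h c..<stop c]) {}" if "c \<le> 1" for c
      unfolding corners_row_iff using bounds[OF that] that
      by (intro exI[of _ "h c"] exI[of _ "stop c"]) (simp add: bij_betw_def SL_def)
    have "start 0 \<in> SL 0" using h[of 0] by (simp add: SL_def)
    then have "\<pi> (start 0) \<in> once_labels 1"
      using \<open>\<And>c. c \<le> 1 \<Longrightarrow> bij_betw \<pi> (SL c) (once_labels 1)\<close>[of 0] by (auto simp: bij_betw_def)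
    then have "once_labels 1 \<noteq> {}" by blast
    then show ?thesis unfolding reducible_a_def
      using once_labels_subset[of 0 1] cor[of 0] cor[of 1] by auto
  next
    case 2
    have one: "g < h c \<longleftrightarrow> \<not> \<sigma> g < h c" if "c \<le> 1" "g \<in> row c" "\<sigma> g \<in> row c" for c g
      using Mh[OF that] 2 by (cases "g < h c"; cases "\<sigma> g < h c") simp_all
    have cor: "corners (row_list c) (once_labels 1 \<union> twice_in (row_list c)) [] (once_labels 0 \<union> twice_in (row_list c))"
      if c: "c \<le> 1" for c
    proof -
      have opp: "\<sigma> g \<in> SR c" if "g \<in> SL c" "\<sigma> g \<in> row c" for g
        using that rows(1)[OF c] one[OF c _ that(2)] SL_iff SR_iff[OF that(2)] by blast
      have opp': "\<sigma> g \<in> SL c" if "g \<in> SR c" "\<sigma> g \<in> row c" for g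
        using that rows(2)[OF c] one[OF c _ that(2)] SL_iff[OF that(2)] SR_iff by blast
      have eq: "twice_labels c (SL c) = twice_labels c (SR c)"
        using twice_labels_swap[OF c rows[OF c] opp opp'] .
      have "twice_in (row_list c) \<subseteq> twice_labels c (SL c)"
      proof
        fix a assume "a \<in> twice_in (row_list c)"
        then obtain i where i: "i \<in> row c" "\<sigma> i \<in> row c" "\<pi> i = a" by (rule twice_labelE[OF _ c])
        then have "i \<in> SL c \<or> i \<in> SR c" using SL_iff SR_iff by blast
        then have "a \<in> twice_labels c (SL c) \<or> a \<in> twice_labels c (SR c)" using i unfolding twice_labels_def by blast
        then show "a \<in> twice_labels c (SL c)" using eq by blast
      qed
      then have tw: "twice_labels c (SL c) = twice_in (row_list c)" "twice_labels c (SR c) = twice_in (row_list c)"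
        using twice_labels_subset[OF c rows(1)[OF c]] eq by auto
      have "bij_betw \<pi> (SL c) (once_labels 1 \<union> twice_labels c (SL c))"
      proof (rule bij_betw_segment[OF c rows(1)[OF c]])
        show "\<sigma> g \<notin> SL c" if "g \<in> SL c" for g
          using opp[OF that] rows(1)[OF c] SL_iff SR_iff by blast
        show "g \<in> SL c \<longleftrightarrow> right_count c g = 1" if "g \<in> row c" for g using Rh[OF c that] SL_iff[OF that] by simp
      qed
      moreover have "bij_betw \<pi> (SR c) (once_labels 0 \<union> twice_labels c (SR c))"
      proof (rule bij_betw_segment[OF c rows(2)[OF c]])
        show "\<sigma> g \<notin> SR c" if "g \<in> SR c" for g
          using opp'[OF that] rows(2)[OF c] SL_iff SR_iff by blast
        show "g \<in> SR c \<longleftrightarrow> right_count c g = 0" if "g \<in> row c" for g using Rh[OF c that] SR_iff[OF that] by simp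
      qed
      ultimately show ?thesis unfolding corners_row_iff tw using bounds[OF c]
        by (intro exI[of _ "h c"]) (simp add: SL_def SR_def)
    qed
    show ?thesis unfolding reducible_a_def
      using once_labels_subset[of 0] cor[of 0] cor[of 1] by auto
  next
    case 3
    have none: "\<sigma> g \<notin> row c" if "c \<le> 1" "g \<in> SR c" for c g
      using Mh[OF that(1), of g] rows(2)[OF that(1)] SR_iff[of g c] that(2) 3 by (auto split: if_splits)
    have "bij_betw \<pi> (SR c) (once_labels 0)" if c: "c \<le> 1" for c
    proof -
      have "twice_labels c (SR c) = {}" using none[OF c] unfolding twice_labels_def by blast
      moreover have "bij_betw \<pi> (SR c) (once_labels 0 \<union> twice_labels c (SR c))"
        by (rule bij_betw_segment[OF c rows(2)[OF c]])
          (use none[OF c] rows(2)[OF c] SR_iff Rh[OF c] in \<open>auto split: if_splits\<close>)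
      ultimately show ?thesis by simp
    qed
    then have cor: "corners (row_list c) {} (map \<pi> [start c..<h c]) (once_labels 0)" if "c \<le> 1" for c
      unfolding corners_row_iff using bounds[OF that] that
      by (intro exI[of _ "start c"] exI[of _ "h c"]) (simp add: bij_betw_def SR_def)
    have "h 0 \<in> SR 0" using bounds[of 0] by (simp add: SR_def)
    then have "\<pi> (h 0) \<in> once_labels 0"
      using \<open>\<And>c. c \<le> 1 \<Longrightarrow> bij_betw \<pi> (SR c) (once_labels 0)\<close>[of 0] by (auto simp: bij_betw_def)
    then have "once_labels 0 \<noteq> {}" by blast
    moreover have "once_labels 0 \<subseteq> once_in_each (row_list 0) (row_list 1)"
      using once_labels_subset[of 0 0] by simp
    ultimately have "\<exists>D v v'. D \<subseteq> once_in_each (row_list 0) (row_list 1) \<and> D \<noteq> {} \<and>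
        corners (row_list 0) {} v D \<and> corners (row_list 1) {} v' D"
      using cor[OF zero_le] cor[OF le_refl] by blast
    then show ?thesis unfolding reducible_a_def by (intro disjI2 disjI1)
  qed
qed

text \<open>The crossed letter is doubled in row \<open>c'\<close>, and row \<open>c\<close> is cut
  at both points. Every other doubled letter has no crossing, so its two right counts add up to 2:
  its occurrences lie in opposite corners or both in the middle.\<close>

lemma reducible_of_connection_1:
  assumes r: "r = 1"
  shows "\<exists>c\<le>1. reducible_b len (row_list c) (row_list (1 - c))"
proof -
  define c' where "c' = \<epsilon> 0"
  define c where "c = 1 - c'"
  have c: "c \<le> 1" "c' \<le> 1" "1 - c = c'" "1 - c' = c" using eps[of 0] by (auto simp: c_def c'_def)
  have k0: "0 < r" using r by simp
  define i0 where "i0 = \<iota> 0"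
  define j0 where "j0 = \<sigma> i0"
  have e1: "\<epsilon> (Suc 0) = c" "1 - \<epsilon> (Suc 0) = c'" using crossing_rank_sum(1)[OF k0] c by (auto simp: c'_def)
  have i0: "i0 \<in> row c'" "j0 \<in> row c'" using crossing_in(1)[OF k0] crossing_rank_sum(2)[OF k0] by (auto simp: i0_def j0_def c'_def)
  have mk: "z 0 \<in> marks c' i0" "z 1 \<in> marks c' j0"
    using crossing_marks[OF k0] e1 by (auto simp: i0_def j0_def c'_def)
  have sing: "(z 0, c) \<in> Sing" "(z 1, c) \<in> Sing" using start_sing stop_sing e1 r by (auto simp: c_def c'_def)
  have ne: "z 0 \<noteq> z 1" using inj_onD[OF z_inj, of 0 1] r by auto
  have j0_part: "\<sigma> j0 = i0" "j0 \<noteq> i0" "\<pi> j0 = \<pi> i0" using partner_rows[OF c(2) i0(1)] by (auto simp: j0_def)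
  have Z: "Z = {z 0, z 1}" unfolding Z_def using r by (auto simp: atMost_Suc)
  obtain K where K: "\<And>c g. c \<le> 1 \<Longrightarrow> g \<in> row c \<Longrightarrow> \<sigma> g \<in> row c \<Longrightarrow> weight c g = K"
    using weight_const by blast
  have "rank (z 0) + rank (z 1) = 1"
  proof -
    have "{x' \<in> Z. z 0 < x'} = (if z 0 < z 1 then {z 1} else {})" "{x' \<in> Z. z 1 < x'} = (if z 1 < z 0 then {z 0} else {})"
      using Z by auto
    then show ?thesis using ne by (auto simp: rank_def)
  qed
  then have K2: "K = 2" using crossing_rank_sum(3)[OF k0] K[OF c(2) i0(1)] i0(2) by (simp add: i0_def j0_def c'_def)
  \<comment> \<open>The crossing may run either way: \<open>x1\<close> and \<open>x2\<close> are its
    ends in increasing order, \<open>i1\<close> and \<open>i2\<close> the occurrences of the crossed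
    letter around them.\<close>
  obtain x1 x2 i1 i2 where x: "x1 < x2" "Z = {x1, x2}" "x1 \<in> marks c' i1" "x2 \<in> marks c' i2"
      "(x1, c) \<in> Sing" "(x2, c) \<in> Sing" "i1 \<in> row c'" "i2 = \<sigma> i1" "i2 \<in> row c'" "\<sigma> i2 = i1" "i1 \<noteq> i2"
      "\<pi> i1 = \<pi> i0" "\<pi> i2 = \<pi> i0"
  proof (cases "z 0 < z 1")
    case True
    then show thesis using that[of "z 0" "z 1" i0 j0] Z mk sing i0 j0_part j0_def by auto
  next
    case False
    then have lt: "z 1 < z 0" and Z': "Z = {z 1, z 0}" using ne Z by auto
    show thesis
      by (rule that[OF lt Z' mk(2,1) sing(2,1) i0(2) j0_part(1)[symmetric] i0(1) j0_def[symmetric]])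
        (use j0_part in auto)
  qed
  obtain P where P: "P \<in> row c" "x1 = pos c P" "start c < P" using Sing_pos[OF x(5)] .
  obtain Q where Q: "Q \<in> row c" "x2 = pos c Q" "start c < Q" using Sing_pos[OF x(6)] .
  have "P < Q" using x(1) P Q by (simp add: pos_less_iff)
  have b: "pos c' i1 < x1" "x1 < pos c' (Suc i1)" "pos c' i2 < x2" "x2 < pos c' (Suc i2)"
    using x(3,4) by (auto simp: marks_def)
  have "i1 < i2"
  proof (rule ccontr)
    assume "\<not> i1 < i2"
    then have "Suc i2 \<le> i1" using x(11) by simp
    then have "pos c' (Suc i2) \<le> pos c' i1" using x(9) by (intro pos_mono) (auto simp: row_eq)
    then show False using b x(1) by linarith
  qed
  have cc: "c' \<noteq> c" using c by arith
  have Rc: "right_count c g = (if g < P then 2 else if g < Q then 1 else 0)" if g: "g \<in> row c" for g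
  proof -
    have "pos c (Suc g) \<le> x1 \<longleftrightarrow> g < P" "pos c (Suc g) \<le> x2 \<longleftrightarrow> g < Q"
      using right_count_le_iff[OF g, of P x1] right_count_le_iff[OF g, of Q x2] P Q pos_row_bounds[OF P(1)] pos_row_bounds[OF Q(1)]
      by simp_all
    then have "{x \<in> Z. pos c (Suc g) \<le> x} = (if g < P then {x1, x2} else if g < Q then {x2} else {})"
      using x(2) \<open>P < Q\<close> by auto
    then show ?thesis unfolding right_count_eq using x(1) by simp
  qed
  have Rc': "right_count c' g = (if g < i1 then 2 else if g < i2 then 1 else 0)" if g: "g \<in> row c'" for g
  proof -
    have "pos c' (Suc g) \<le> x1 \<longleftrightarrow> g < i1" "pos c' (Suc g) \<le> x2 \<longleftrightarrow> g < i2"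
      using right_count_le_iff[OF g, of i1 x1] right_count_le_iff[OF g, of i2 x2] b x(7,9) by simp_all
    then have "{x \<in> Z. pos c' (Suc g) \<le> x} = (if g < i1 then {x1, x2} else if g < i2 then {x2} else {})"
      using x(2) \<open>i1 < i2\<close> by auto
    then show ?thesis unfolding right_count_eq using x(1) by simp
  qed
  have a0_row: "\<pi> g = \<pi> i0 \<longleftrightarrow> g = i1 \<or> g = i2" if "e \<le> 1" "g \<in> row e" for e g
  proof -
    have "i1 \<in> {1..l + m}" "g \<in> {1..l + m}" using x(7) that row_component[OF c(2)] row_component[OF that(1)] by blast+
    then show ?thesis using same_label[of i1 g] x(8,12,13) by auto
  qed
  have N0: "crossings g = 0" if "\<pi> g \<noteq> \<pi> i0" for g
  proof -
    have "{k \<in> {..<r}. \<pi> (\<iota> k) = \<pi> g} = {}" using that r by (auto simp: i0_def)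
    then show ?thesis by (simp add: crossings_def)
  qed
  have twice: "right_count e g + right_count e (\<sigma> g) = 2" if "e \<le> 1" "g \<in> row e" "\<sigma> g \<in> row e" "g \<noteq> i1" "g \<noteq> i2" for e g
    using K[OF that(1-3)] N0[of g] a0_row[OF that(1,2)] that(4,5) K2 by (simp add: weight_def)
  have PQ: "start c \<le> P" "P \<le> Q" "Q \<le> stop c" using P Q \<open>P < Q\<close> by (auto simp: row_eq)
  \<comment> \<open>The right corner of row \<open>c'\<close> begins at \<open>Suc i2\<close>, so
    both occurrences of the crossed letter stay in the middle.\<close>
  have PQ': "start c' \<le> i1" "i1 \<le> Suc i2" "Suc i2 \<le> stop c'" using x(7,9) \<open>i1 < i2\<close> by (auto simp: row_eq)
  have not_i: "g \<noteq> i1" "g \<noteq> i2" if "g \<in> row c" for g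
    using that x(7,9) row_disjoint[OF c(1)] c(3) by auto
  define SL where "SL = {start c..<P}"
  define SR where "SR = {Q..<stop c}"
  define SL' where "SL' = {start c'..<i1}"
  define SR' where "SR' = {Suc i2..<stop c'}"
  have rows: "SL \<subseteq> row c" "SR \<subseteq> row c" "SL' \<subseteq> row c'" "SR' \<subseteq> row c'"
    using PQ PQ' by (auto simp: row_eq SL_def SR_def SL'_def SR'_def)
  have S: "g \<in> SL \<longleftrightarrow> right_count c g = 2" "g \<in> SR \<longleftrightarrow> right_count c g = 0" if "g \<in> row c" for g
    using that Rc[OF that] \<open>P < Q\<close> by (auto simp: SL_def SR_def row_eq)
  \<comment> \<open>As \<open>x2\<close> lies inside piece \<open>i2\<close>, this piece also has
    right count 0 without belonging to the corner.\<close>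
  have S': "g \<in> SL' \<longleftrightarrow> right_count c' g = 2" "g \<in> SR' \<longleftrightarrow> right_count c' g = 0 \<and> g \<noteq> i2" if "g \<in> row c'" for g
    using that Rc'[OF that] \<open>i1 < i2\<close> by (auto simp: SL'_def SR'_def row_eq)
  have right_count_i: "right_count c' i1 = 1" "right_count c' i2 = 0" using Rc'[OF x(7)] Rc'[OF x(9)] \<open>i1 < i2\<close> by simp_all
  have opp: "\<sigma> g \<in> SR" if "g \<in> SL" "\<sigma> g \<in> row c" for g
    using twice[OF c(1) _ that(2)] that rows(1) not_i S(1)[of g] S(2)[OF that(2)] by fastforce
  have opp2: "\<sigma> g \<in> SL" if "g \<in> SR" "\<sigma> g \<in> row c" for g
    using twice[OF c(1) _ that(2)] that rows(2) not_i S(2)[of g] S(1)[OF that(2)] by fastforce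
  have opp': "\<sigma> g \<in> SR'" if "g \<in> SL'" "\<sigma> g \<in> row c'" for g
  proof -
    have g: "g \<in> row c'" "right_count c' g = 2" using that(1) rows(3) S'(1)[of g] by blast+
    then have n: "g \<noteq> i1" "g \<noteq> i2" using right_count_i by auto
    then have "right_count c' (\<sigma> g) = 0" using twice[OF c(2) g(1) that(2)] g(2) by simp
    moreover have "\<sigma> g \<noteq> i2" using n(1) x(10) partner_rows(1)[OF c(2) g(1)] by metis
    ultimately show ?thesis using S'(2)[OF that(2)] by blast
  qed
  have opp2': "\<sigma> g \<in> SL'" if "g \<in> SR'" "\<sigma> g \<in> row c'" for g
  proof -
    have g: "g \<in> row c'" "right_count c' g = 0" "g \<noteq> i2" using that(1) rows(4) S'(2)[of g] by blast+
    then have n: "g \<noteq> i1" using right_count_i by auto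
    then have "right_count c' (\<sigma> g) = 2" using twice[OF c(2) g(1) that(2) n g(3)] g(2) by simp
    then show ?thesis using S'(1)[OF that(2)] by blast
  qed
  have disj: "SL \<inter> SR = {}" "SL' \<inter> SR' = {}"
    using \<open>P < Q\<close> \<open>i1 < i2\<close> by (auto simp: SL_def SR_def SL'_def SR'_def)
  have bij: "bij_betw \<pi> SL (once_labels 2 \<union> twice_labels c SL)"
    "bij_betw \<pi> SR (once_labels 0 \<union> twice_labels c SR)"
    "bij_betw \<pi> SL' (once_labels 2 \<union> twice_labels c' SL')"
    "bij_betw \<pi> SR' (once_labels 0 \<union> twice_labels c' SR')"
  proof -
    show "bij_betw \<pi> SL (once_labels 2 \<union> twice_labels c SL)"
      by (rule bij_betw_segment[OF c(1) rows(1)]) (use opp rows(1) disj(1) S(1) in blast)+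
    show "bij_betw \<pi> SR (once_labels 0 \<union> twice_labels c SR)"
      by (rule bij_betw_segment[OF c(1) rows(2)]) (use opp2 rows(2) disj(1) S(2) in blast)+
    show "bij_betw \<pi> SL' (once_labels 2 \<union> twice_labels c' SL')"
      by (rule bij_betw_segment[OF c(2) rows(3)]) (use opp' rows(3) disj(2) S'(1) in blast)+
    show "bij_betw \<pi> SR' (once_labels 0 \<union> twice_labels c' SR')"
    proof (rule bij_betw_segment[OF c(2) rows(4)])
      show "\<sigma> g \<notin> SR'" if "g \<in> SR'" for g using opp2'[OF that] rows(4) disj(2) by blast
      show "g \<in> SR' \<longleftrightarrow> right_count c' g = 0" if "g \<in> row c'" "\<sigma> g \<notin> row c'" for g
        using S'(2)[OF that(1)] that(2) x(7,10) by auto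
    qed
  qed
  have eq: "twice_labels c SL = twice_labels c SR" "twice_labels c' SL' = twice_labels c' SR'"
    using twice_labels_swap[OF c(1) rows(1,2) opp opp2] twice_labels_swap[OF c(2) rows(3,4) opp' opp2'] by blast+
  define B where "B = twice_labels c SL"
  define C where "C = twice_labels c' SL'"
  have bijBC: "bij_betw \<pi> {start c..<P} (once_labels 2 \<union> B)" "bij_betw \<pi> {Q..<stop c} (B \<union> once_labels 0)"
    "bij_betw \<pi> {start c'..<i1} (once_labels 2 \<union> C)" "bij_betw \<pi> {Suc i2..<stop c'} (C \<union> once_labels 0)"
    using bij eq unfolding B_def C_def SL_def[symmetric] SR_def[symmetric] SL'_def[symmetric] SR'_def[symmetric]
    by (simp_all add: Un_commute)
  have OT: "once_labels n \<subseteq> once_in_each (row_list c) (row_list c')" for n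
    using once_labels_subset[OF c(1)] c(3) by simp
  have TT: "B \<subseteq> twice_in (row_list c)" "C \<subseteq> twice_in (row_list c')"
    unfolding B_def C_def using twice_labels_subset c rows by blast+
  have sums: "(\<Sum>a\<in>once_labels 2 \<union> B. len $ a) = (\<Sum>a\<in>once_labels 2. len $ a) + (\<Sum>a\<in>B. len $ a)"
    "(\<Sum>a\<in>once_labels 2 \<union> C. len $ a) = (\<Sum>a\<in>once_labels 2. len $ a) + (\<Sum>a\<in>C. len $ a)"
    using sum_Un_once_twice[OF OT] TT by blast+
  have "pos c' (Suc i1) = pos c' i1 + len $ \<pi> i0" using pos_Suc[of c' i1] PQ' x(12) by simp
  \<comment> \<open>The cut \<open>x1\<close> of row \<open>c\<close> lies strictly inside piece
    \<open>i1\<close> of row \<open>c'\<close>, so both inequalities are strict; the first one also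
    forces \<open>B\<close> to be non-empty.\<close>
  then have ineq: "(\<Sum>a\<in>C. len $ a) < (\<Sum>a\<in>B. len $ a)"
    "(\<Sum>a\<in>B. len $ a) < len $ \<pi> i0 + (\<Sum>a\<in>C. len $ a)"
    using b(1,2) pos_bij[OF bijBC(1)] pos_bij[OF bijBC(3)] P(2) sums by auto
  have "0 \<le> (\<Sum>a\<in>C. len $ a)" by (rule sum_nonneg) (simp add: len_pos less_imp_le)
  then have nonempty: "B \<noteq> {}" using ineq(1) by auto
  have "map \<pi> [i1..<Suc i2] = [\<pi> i0] @ map \<pi> [Suc i1..<i2] @ [\<pi> i0]"
    using \<open>i1 < i2\<close> x(12,13) by (simp add: upt_rec[of i1 i2])
  then have "corners (row_list c') (once_labels 2 \<union> C)
      ([\<pi> i0] @ map \<pi> [Suc i1..<i2] @ [\<pi> i0]) (C \<union> once_labels 0)"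
    unfolding corners_row_iff using PQ' bijBC(3,4)
    by (intro exI[of _ i1] exI[of _ "Suc i2"]) simp
  moreover have "corners (row_list c) (once_labels 2 \<union> B) (map \<pi> [P..<Q]) (B \<union> once_labels 0)"
    unfolding corners_row_iff using PQ bijBC(1,2) by blast
  ultimately have "reducible_b len (row_list c) (row_list c')"
    unfolding reducible_b_def using OT TT nonempty ineq[THEN less_imp_le] by blast
  then show ?thesis using c by blast
qed

lemma not_admissible: "len \<notin> admissible_parameters l m \<pi>"
proof -
  have "r = 0 \<or> r = 1" using r_le_1 by arith
  then show ?thesis
  proof
    assume "r = 0"
    then show ?thesis using reducible_of_connection_0
      unfolding admissible_parameters_def top_row_eq bottom_row_eq by blast
  next
    assume "r = 1"
    then obtain c where c: "c \<le> 1" "reducible_b len (row_list c) (row_list (1 - c))"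
      using reducible_of_connection_1 by blast
    then have "c = 0 \<or> c = 1" by arith
    then show ?thesis using c(2)
      unfolding admissible_parameters_def top_row_eq bottom_row_eq by auto
  qed
qed

end

section \<open>From generic lengths to the Keane property\<close>

context parametrized_permutation begin

lemma generic_admissible_keane:
  assumes gen: "generic_in (balanced_vectors l m \<pi>) len" and adm: "len \<in> admissible_parameters l m \<pi>"
  shows "keane_property l m \<pi> len"
  unfolding keane_property_def
proof
  assume "\<exists>r. has_connection l m \<pi> len r"
  then obtain r p q s where conn: "p = f s" "s \<in> Sing" "q \<in> Sing" "iter r p = Some q"
    unfolding has_connection_def inverse_singularities_def by blast
  have X: "s \<in> X" "p \<in> X" using conn by (auto simp: Sing_iff)
  have ex: "\<exists>u. iter k p = Some u" if "k \<le> r" for k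
  proof -
    have "iter (k + (r - k)) p = Some q" using conn(4) that by simp
    then show ?thesis unfolding iter_add_iff by blast
  qed
  define pt where "pt k = the (iter k p)" for k
  have pt: "iter k p = Some (pt k)" if "k \<le> r" for k using ex[OF that] by (auto simp: pt_def)
  have ptX: "pt k \<in> X" if "k \<le> r" for k using iter_in_phase[OF X(2) pt[OF that]] .
  have ptT: "T (pt k) = Some (pt (Suc k))" if "k < r" for k
    using pt[of k] pt[of "Suc k"] that by (auto simp: iter_Suc_iff)
  have pt0: "pt 0 = f s" and ptr: "pt r = q" using conn pt[of 0] pt[of r] by auto
  define z where "z k = fst (pt k)" for k
  define e where "e k = snd (pt k)" for k
  have pt_eq: "pt k = (z k, e k)" for k by (simp add: z_def e_def)
  have e1: "e k \<le> 1" if "k \<le> r" for k using phase_snd[OF ptX[OF that]] by (simp add: e_def)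
  have "\<exists>i. i \<in> row (e k) \<and> \<sigma> i \<in> row (1 - e (Suc k)) \<and> pos (e k) i < z k \<and> z k < pos (e k) (Suc i) \<and>
          z (Suc k) = image_point (e k) (1 - e (Suc k)) i (z k)" if k: "k < r" for k
    using ptT[OF k, unfolded pt_eq]
  proof (rule T_SomeD)
    fix i c' assume h: "e k \<le> 1" "c' \<le> 1" "i \<in> row (e k)" "\<sigma> i \<in> row c'" "pos (e k) i < z k" "z k < pos (e k) (Suc i)"
      "(z (Suc k), e (Suc k)) = (image_point (e k) c' i (z k), 1 - c')"
    have "c' = 1 - e (Suc k)" using h(2,7) by auto
    then show ?thesis using h by auto
  qed
  then obtain \<iota> where \<iota>: "\<And>k. k < r \<Longrightarrow> \<iota> k \<in> row (e k) \<and> \<sigma> (\<iota> k) \<in> row (1 - e (Suc k)) \<and>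
      pos (e k) (\<iota> k) < z k \<and> z k < pos (e k) (Suc (\<iota> k)) \<and>
      z (Suc k) = image_point (e k) (1 - e (Suc k)) (\<iota> k) (z k)" by metis
  \<comment> \<open>Equal first coordinates mean the same point or the opposite one. The first is a
    return of an orbit issued from an inverse singularity, the second a turn.\<close>
  have distinct: "z j \<noteq> z k" if "j < k" "k \<le> r" for j k
  proof
    assume eq: "z j = z k"
    have jr: "j \<le> r" using that by simp
    have "iter (j + (k - j)) p = Some (pt k)" using pt[OF that(2)] that by simp
    then have it: "iter (k - j) (pt j) = Some (pt k)" using pt[OF jr] by (auto simp: iter_add_iff)
    have "e k = e j \<or> e k = 1 - e j" using e1[OF jr] e1[OF that(2)] by arith
    then have "pt k = pt j \<or> pt k = f (pt j)" using eq by (auto simp: pt_eq swap_component_def)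
    then show False
      using it iter_no_turn[OF ptX[OF jr]] inverse_singularity_no_return[OF conn(2), of "k - j" j "pt j"]
        pt[OF jr] conn(1) that by auto
  qed
  have "inj_on z {..r}"
    by (rule linorder_inj_onI) (use distinct in auto)
  moreover have "(z 0, 1 - e 0) = f (pt 0)" by (simp add: pt_eq swap_component_def)
  then have "(z 0, 1 - e 0) \<in> Sing" using conn(2) X by (simp add: pt0)
  moreover have "(z r, e r) \<in> Sing" using conn(3) by (simp add: pt_eq[symmetric] ptr)
  ultimately have "generic_connection l m \<pi> len r z e \<iota>"
    using e1 \<iota> gen by unfold_locales auto
  then show False using generic_connection.not_admissible adm by blast
qed

end

theorem theoremB:
  fixes l m :: nat and \<pi> :: "nat \<Rightarrow> 'a::finite"
  assumes "generalized_permutation l m \<pi>"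
  shows "(\<forall>len \<in> length_vectors l m \<pi>.
            \<not> dynamically_irreducible l m \<pi> \<or>
            (dynamically_irreducible l m \<pi> \<and> len \<notin> admissible_parameters l m \<pi>) \<longrightarrow>
            \<not> minimal_involution l m \<pi> len) \<and>
         (dynamically_irreducible l m \<pi> \<longrightarrow>
            (AE len in subspace_lborel (balanced_vectors l m \<pi>).
               len \<in> admissible_parameters l m \<pi> \<longrightarrow> keane_property l m \<pi> len \<and> minimal_involution l m \<pi> len))"
proof (intro conjI ballI impI)
  fix len :: "real ^ 'a"
  assume len: "len \<in> length_vectors l m \<pi>"
    and "\<not> dynamically_irreducible l m \<pi> \<or>
      (dynamically_irreducible l m \<pi> \<and> len \<notin> admissible_parameters l m \<pi>)"
  \<comment> \<open>Irreducibility means that some parameter is admissible, so both alternatives say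
    that \<open>len\<close> is not.\<close>
  then have "len \<notin> admissible_parameters l m \<pi>" by (auto simp: dynamically_irreducible_def)
  moreover have "parametrized_permutation l m \<pi> len" using assms len by unfold_locales
  ultimately show "\<not> minimal_involution l m \<pi> len"
    using parametrized_permutation.not_admissible_not_minimal by blast
next
  have "keane_property l m \<pi> len \<and> minimal_involution l m \<pi> len"
    if "generic_in (balanced_vectors l m \<pi>) len" "len \<in> admissible_parameters l m \<pi>" for len
  proof -
    have "len \<in> length_vectors l m \<pi>" using that(2) by (simp add: admissible_parameters_def)
    then interpret parametrized_permutation l m \<pi> len
      using assms by unfold_locales
    show ?thesis using generic_admissible_keane[OF that] keane_imp_minimal by blast
  qed
  then show "AE len in subspace_lborel (balanced_vectors l m \<pi>).
      len \<in> admissible_parameters l m \<pi> \<longrightarrow> keane_property l m \<pi> len \<and> minimal_involution l m \<pi> len"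
    by (intro eventually_mono[OF AE_generic_in[OF subspace_balanced_vectors]]) blast
qed

end
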